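(* Let $a,b\in\mathbb C$ satisfy $|a|^2+|b|^2=1$, $a\neq0$ and $b\neq0$ (i.e. $(a,b)\in S^3\setminus(C_1\cup C_2)$, where $S^3$ is the unit sphere of $\mathbb C^2$, $C_1=\{(a,0):|a|=1\}$ and $C_2=\{(0,b):|b|=1\}$). Let $\sigma_{a,b}:F\to\mathcal U(\mathscr H)$ be the Pythagorean representation of Thompson's group $F$ associated to the Pythagorean pair $(a,b)$ acting by scalar multiplication on $\mathfrak H=\mathbb C$. Then $\sigma_{a,b}$ is Ind-mixing; that is, for every non-trivial subgroup $K\subset F$ and every non-zero finite-dimensional unitary representation $\theta$ of $K$, the induced representation $\mathrm{Ind}_K^F\theta$ is not contained in $\sigma_{a,b}$ (it is not unitarily equivalent to a subrepresentation of $\sigma_{a,b}$).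
   Context: All Hilbert spaces are complex, all groups are discrete, all representations are unitary. Trees and forests. A tree is a finite non-empty rooted binary tree in which each vertex has either no children (a leaf) or exactly two children (left and right); it is viewed as a rooted subtree of the infinite rooted binary tree, and its leaves are ordered from left to right. $\mathrm{Leaf}(t)$ is the set of leaves of $t$. A forest is a finite ordered list of trees; its roots and leaves are ordered from left to right. If a forest $f$ has as many roots as $t$ has leaves, $f\circ t$ is the tree obtained by attaching the $j$th tree of $f$ at the $j$th leaf of $t$. Composition of forests is defined similarly. Write $t\preceq s$ if $t$ is a rooted subtree of $s$, equivalently $s=f\circ t$ for a (unique) forest $f$. Thompson's group $F$. $F$ is the set of classes $[t,s]$ of pairs of trees with the same number of leaves, for the equivalence relation generated by $(f\circ t,f\circ s)\sim(t,s)$, with product $[t,s][t',s']=[f\circ t,f'\circ s']$ for any forests $f,f'$ with $f\circ s=f'\circ t'$; then $[t,s]^{-1}=[s,t]$. Pythagorean pair. A pair of bounded operators $(A,B)$ on a Hilbert space $\mathfrak H$ with $A^*A+B^*B=\mathrm{id}_{\mathfrak H}$. For $\mathfrak H=\mathbb C$ these are exactly the pairs of complex numbers $(a,b)$ with $|a|^2+|b|^2=1$. Pythagorean representation. For a tree $t$ let $\mathfrak H_t=\ell^2(\mathrm{Leaf}(t),\mathfrak H)\cong\mathfrak H^{\oplus n}$, where $n=|\mathrm{Leaf}(t)|$; elements are written $(t,\xi)$, decorations of the leaves of $t$ by vectors of $\mathfrak H$. For the forest $f_{k,n}$ with $n$ roots, all of whose trees are trivial except the $k$th which has two leaves, set $\Phi(f_{k,n})(\xi_1,\dots,\xi_n)=(\xi_1,\dots,\xi_{k-1},A\xi_k,B\xi_k,\xi_{k+1},\dots,\xi_n)$,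 and extend $\Phi$ to all forests by $\Phi(f\circ g)=\Phi(f)\Phi(g)$ (this is well-defined, and each $\Phi(f)$ is an isometry). The maps $\mathfrak H_t\to\mathfrak H_{f\circ t}$, $(t,\xi)\mapsto(f\circ t,\Phi(f)\xi)$, form a directed system of isometries indexed by the directed poset of trees; $\mathscr K$ is its direct limit (a pre-Hilbert space), with elements written $[t,\xi]$, and $\mathscr H$ is the completion of $\mathscr K$. The Pythagorean representation $\sigma=\sigma_{A,B}$ of $F$ on $\mathscr H$ is the unitary representation determined by $\sigma([t,s])[s,\xi]=[t,\xi]$ (given $g\in F$ and $z\in\mathscr K$ one can always choose representatives $g=[t,s]$, $z=[s,\xi]$ with a common tree $s$). *)

theory Defs
  imports "HOL-Analysis.Infinite_Sum" "HOL-Algebra.Module" "HOL-Algebra.Left_Coset"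
begin

section \<open>Trees and forests\<close>

datatype btree = Leaf | Node btree btree

type_synonym forest = "btree list"

fun leaves :: "btree \<Rightarrow> nat" where
  "leaves Leaf = 1"
| "leaves (Node l r) = leaves l + leaves r"

definition fleaves :: "forest \<Rightarrow> nat" where
  "fleaves f = sum_list (map leaves f)"

text \<open>\<open>graft f t\<close> is \<open>f \<circ> t\<close> and \<open>fcomp f g\<close> is \<open>f \<circ> g\<close>. They are meaningful only if
  \<open>length f\<close> is \<open>leaves t\<close>, resp. \<open>fleaves g\<close>.\<close>

fun graft :: "forest \<Rightarrow> btree \<Rightarrow> btree" where
  "graft f Leaf = hd f"
| "graft f (Node l r) = Node (graft (take (leaves l) f) l) (graft (drop (leaves l) f) r)"

fun fcomp :: "forest \<Rightarrow> forest \<Rightarrow> forest" where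
  "fcomp f [] = []"
| "fcomp f (t # g) = graft (take (leaves t) f) t # fcomp (drop (leaves t) f) g"

lemma leaves_pos [simp]: "0 < leaves t"
  by (induction t) auto

lemma fleaves_simps [simp]:
  "fleaves [] = 0" "fleaves (t # f) = leaves t + fleaves f" "fleaves (f @ g) = fleaves f + fleaves g"
  by (auto simp: fleaves_def)

lemma leaves_graft: "length f = leaves t \<Longrightarrow> leaves (graft f t) = fleaves f"
proof (induction t arbitrary: f)
  case Leaf
  then show ?case by (cases f) auto
next
  case (Node l r)
  have "fleaves f = fleaves (take (leaves l) f) + fleaves (drop (leaves l) f)"
    by (metis append_take_drop_id fleaves_simps(3))
  with Node show ?case by simp
qed

lemma graft_trivial: "graft (replicate (leaves t) Leaf) t = t"
  by (induction t) (auto simp: min_def)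

lemma graft_trivial': "n = leaves t \<Longrightarrow> graft (replicate n Leaf) t = t"
  by (simp add: graft_trivial)

lemma length_fcomp [simp]: "length (fcomp f g) = length g"
  by (induction g arbitrary: f) auto

lemma fcomp_append:
  "fcomp h (f @ g) = fcomp (take (fleaves f) h) f @ fcomp (drop (fleaves f) h) g"
  by (induction f arbitrary: h) (auto simp: take_drop add.commute min_def)

lemma graft_graft:
  "length f = leaves t \<Longrightarrow> length h = fleaves f \<Longrightarrow> graft h (graft f t) = graft (fcomp h f) t"
proof (induction t arbitrary: f h)
  case Leaf
  then show ?case by (cases f) auto
next
  case (Node l r)
  let ?f1 = "take (leaves l) f" and ?f2 = "drop (leaves l) f"
  have len: "length ?f1 = leaves l" "length ?f2 = leaves r" using Node.prems by auto
  have f: "f = ?f1 @ ?f2" by simp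
  have fl: "fleaves f = fleaves ?f1 + fleaves ?f2" by (metis f fleaves_simps(3))
  have c: "fcomp h f = fcomp (take (fleaves ?f1) h) ?f1 @ fcomp (drop (fleaves ?f1) h) ?f2"
    by (metis f fcomp_append)
  show ?case using Node len fl unfolding c by (simp add: leaves_graft)
qed

lemma graft_inj:
  "length f = leaves t \<Longrightarrow> length f' = leaves t \<Longrightarrow> graft f t = graft f' t \<Longrightarrow> f = f'"
proof (induction t arbitrary: f f')
  case Leaf
  then show ?case by (cases f; cases f') auto
next
  case (Node l r)
  have "take (leaves l) f = take (leaves l) f'" using Node by simp
  moreover have "drop (leaves l) f = drop (leaves l) f'" using Node by simp
  ultimately show ?case by (metis append_take_drop_id)
qed

lemma common_refinement:
  obtains f f' where "length f = leaves t" "length f' = leaves s" "graft f t = graft f' s"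
proof -
  have "\<exists>f f'. length f = leaves t \<and> length f' = leaves s \<and> graft f t = graft f' s"
  proof (induction t arbitrary: s)
    case Leaf
    show ?case
      by (rule exI[of _ "[s]"], rule exI[of _ "replicate (leaves s) Leaf"]) (simp add: graft_trivial)
  next
    case (Node l r)
    show ?case
    proof (cases s)
      case Leaf
      then show ?thesis
        by (intro exI[of _ "replicate (leaves (Node l r)) Leaf"] exI[of _ "[Node l r]"])
          (simp add: graft_trivial min_def)
    next
      case (Node l' r')
      obtain f f' where 1: "length f = leaves l" "length f' = leaves l'" "graft f l = graft f' l'"
        using Node.IH(1) by blast
      obtain g g' where 2: "length g = leaves r" "length g' = leaves r'" "graft g r = graft g' r'"
        using Node.IH(2) by blast
      show ?thesis using 1 2 Node
        by (intro exI[of _ "f @ g"] exI[of _ "f' @ g'"]) simp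
    qed
  qed
  then show ?thesis using that by blast
qed

lemma fleaves_take_inj:
  assumes "m \<le> length f" "m' \<le> length f" "fleaves (take m f) = fleaves (take m' f)"
  shows "m = m'"
proof -
  have lt: "fleaves (take i f) < fleaves (take j f)" if "i < j" "j \<le> length f" for i j
  proof -
    have "take j f = take i f @ take (j - i) (drop i f)"
      using that by (metis le_add_diff_inverse less_imp_le take_add)
    moreover have "take (j - i) (drop i f) \<noteq> []" using that by simp
    then have "0 < fleaves (take (j - i) (drop i f))"
      by (cases "take (j - i) (drop i f)") auto
    ultimately show ?thesis by simp
  qed
  show ?thesis using lt[of m m'] lt[of m' m] assms by (metis less_irrefl nat_neq_iff)
qed

lemma graft_cancel:
  "graft f s = graft f s' \<Longrightarrow> length f = leaves s \<Longrightarrow> length f = leaves s' \<Longrightarrow> s = s'"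
proof (induction s arbitrary: f s')
  case Leaf
  have "leaves u + leaves v \<noteq> 1" for u v using leaves_pos[of u] leaves_pos[of v] by linarith
  then show ?case using Leaf by (cases s') auto
next
  case (Node l r)
  have ne: "leaves u + leaves v \<noteq> 1" for u v using leaves_pos[of u] leaves_pos[of v] by linarith
  obtain l' r' where s': "s' = Node l' r'" using Node.prems ne by (cases s') auto
  have len: "length f = leaves l + leaves r" "length f = leaves l' + leaves r'"
    using Node.prems(2,3) s' by simp_all
  have g1: "graft (take (leaves l) f) l = graft (take (leaves l') f) l'"
    and g2: "graft (drop (leaves l) f) r = graft (drop (leaves l') f) r'"
    using Node.prems(1) s' by simp_all
  have "leaves (graft (take (leaves l) f) l) = fleaves (take (leaves l) f)"
    "leaves (graft (take (leaves l') f) l') = fleaves (take (leaves l') f)"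
    by (rule leaves_graft, use len in simp)+
  then have ll: "leaves l = leaves l'"
    using fleaves_take_inj[of "leaves l" f "leaves l'"] len g1 by (metis le_add1)
  have "l = l'" using g1 by (intro Node.IH(1)[of "take (leaves l) f"]) (use ll len in simp_all)
  moreover have "r = r'" using g2 by (intro Node.IH(2)[of "drop (leaves l) f"]) (use ll len in simp_all)
  ultimately show ?case using s' by simp
qed

section \<open>Thompson's group\<close>

definition tree_pairs :: "(btree \<times> btree) set" where
  "tree_pairs = {(t, s). leaves t = leaves s}"

definition tree_pair_step :: "((btree \<times> btree) \<times> (btree \<times> btree)) set" where
  "tree_pair_step = {((graft f t, graft f s), (t, s)) | f t s.
     leaves t = leaves s \<and> length f = leaves t}"

definition F_rel :: "((btree \<times> btree) \<times> (btree \<times> btree)) set" where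
  "F_rel = Restr ((tree_pair_step \<union> tree_pair_step\<inverse>)\<^sup>*) tree_pairs"

definition F_class :: "btree \<times> btree \<Rightarrow> (btree \<times> btree) set" where
  "F_class p = F_rel `` {p}"

definition thompson_F :: "(btree \<times> btree) set monoid" where
  "thompson_F = \<lparr>carrier = tree_pairs // F_rel,
     mult = (\<lambda>X Y. THE Z. \<exists>t s t' s' f f'. (t, s) \<in> X \<and> (t', s') \<in> Y \<and>
        length f = leaves s \<and> length f' = leaves t' \<and> graft f s = graft f' t' \<and>
        Z = F_class (graft f t, graft f' s')),
     one = F_class (Leaf, Leaf)\<rparr>"

lemma F_rel_eq:
  "F_rel = {((t, s), (t', s')). leaves t = leaves s \<and> leaves t' = leaves s' \<and>
     (\<exists>f f'. length f = leaves t \<and> length f' = leaves t' \<and>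
        graft f t = graft f' t' \<and> graft f s = graft f' s')}" (is "_ = ?R")
proof
  have trans: "((t, s), (t'', s'')) \<in> ?R"
    if 1: "((t, s), (t', s')) \<in> ?R" and 2: "((t', s'), (t'', s'')) \<in> ?R" for t s t' s' t'' s''
  proof -
    from 1 obtain f f' where f: "leaves t = leaves s" "leaves t' = leaves s'" "length f = leaves t"
      "length f' = leaves t'" "graft f t = graft f' t'" "graft f s = graft f' s'" by auto
    from 2 obtain g g' where g: "leaves t'' = leaves s''" "length g = leaves t'"
      "length g' = leaves t''" "graft g t' = graft g' t''" "graft g s' = graft g' s''" by auto
    obtain h h' where h: "length h = leaves (graft f' t')" "length h' = leaves (graft g t')"
      "graft h (graft f' t') = graft h' (graft g t')" by (rule common_refinement)
    have hl: "length h = fleaves f'" "length h' = fleaves g"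
      using h f g leaves_graft[of f' t'] leaves_graft[of g t'] by simp_all
    have hl': "length h = fleaves f" "length h' = fleaves g'"
      using h f g leaves_graft[of f t] leaves_graft[of g' t''] by simp_all
    have eq: "fcomp h f' = fcomp h' g"
    proof (rule graft_inj[of _ t'])
      show "graft (fcomp h f') t' = graft (fcomp h' g) t'"
        using h(3) graft_graft[OF f(4) hl(1)] graft_graft[OF g(2) hl(2)] by simp
    qed (use f g in auto)
    have "graft (fcomp h f) t = graft (fcomp h' g') t''"
      using graft_graft[OF f(3) hl'(1)] graft_graft[OF g(3) hl'(2)] h(3) f(5) g(4) by simp
    moreover have "graft (fcomp h f) s = graft (fcomp h' g') s''"
    proof -
      have "graft (fcomp h f) s = graft h (graft f' s')"
        using graft_graft[of f s h] f hl' by simp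
      also have "\<dots> = graft (fcomp h' g) s'"
        using graft_graft[of f' s' h] f hl eq by simp
      also have "\<dots> = graft h' (graft g' s'')"
        using graft_graft[of g s' h'] f g hl by simp
      also have "\<dots> = graft (fcomp h' g') s''"
        using graft_graft[of g' s'' h'] g hl' by simp
      finally show ?thesis .
    qed
    moreover have "length (fcomp h f) = leaves t" "length (fcomp h' g') = leaves t''"
      using f g by simp_all
    ultimately show ?thesis using f g by blast
  qed
  have step: "(q, p) \<in> ?R \<and> (p, q) \<in> ?R" if "(p, q) \<in> tree_pair_step" for p q
  proof -
    from that obtain f t s where f: "p = (graft f t, graft f s)" "q = (t, s)"
      "leaves t = leaves s" "length f = leaves t" by (auto simp: tree_pair_step_def)
    have "graft (replicate (fleaves f) Leaf) (graft f t) = graft f t"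
      "graft (replicate (fleaves f) Leaf) (graft f s) = graft f s"
      "length (replicate (fleaves f) Leaf) = leaves (graft f t)" "leaves (graft f t) = leaves (graft f s)"
      using f by (simp_all add: graft_trivial' leaves_graft)
    then have "\<exists>g h. length g = leaves (graft f t) \<and> length h = leaves t \<and>
        graft g (graft f t) = graft h t \<and> graft g (graft f s) = graft h s"
      "leaves (graft f t) = leaves (graft f s)"
      using f by blast+
    then show ?thesis unfolding f(1,2) using f(3) by simp metis
  qed
  have refl: "(p, p) \<in> ?R" if "p \<in> tree_pairs" for p
  proof -
    obtain t s where p: "p = (t, s)" "leaves t = leaves s" using \<open>p \<in> tree_pairs\<close> by (auto simp: tree_pairs_def)
    have "length (replicate (leaves t) Leaf) = leaves t" by simp
    then show ?thesis unfolding p(1) using p(2) by blast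
  qed
  have "(p, q) \<in> ?R" if "(p, q) \<in> (tree_pair_step \<union> tree_pair_step\<inverse>)\<^sup>*" "p \<in> tree_pairs" for p q
    using that
  proof (induction rule: rtrancl_induct)
    case base
    then show ?case using refl by blast
  next
    case (step y z)
    then have "(p, y) \<in> ?R" "(y, z) \<in> ?R" using \<open>\<And>p q. (p, q) \<in> tree_pair_step \<Longrightarrow> _\<close> by blast+
    then show ?case using trans by (cases p; cases y; cases z) blast
  qed
  then show "F_rel \<subseteq> ?R" unfolding F_rel_def by blast
  show "?R \<subseteq> F_rel"
  proof clarify
    fix t s t' s' f f'
    assume f: "leaves t = leaves s" "leaves t' = leaves s'" "length f = leaves t"
      "length f' = leaves t'" "graft f t = graft f' t'" "graft f s = graft f' s'"
    have "((t, s), (graft f t, graft f s)) \<in> tree_pair_step\<inverse>"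
      unfolding tree_pair_step_def converse_iff using f(1,3) by blast
    moreover have "((graft f t, graft f s), (t', s')) \<in> tree_pair_step"
      unfolding tree_pair_step_def f(5,6) using f(2,4) by blast
    ultimately show "((t, s), (t', s')) \<in> F_rel"
      unfolding F_rel_def tree_pairs_def using f(1,2)
      by (auto intro: converse_rtrancl_into_rtrancl)
  qed
qed

lemma equiv_F_rel: "equiv tree_pairs F_rel"
proof -
  let ?E = "(tree_pair_step \<union> tree_pair_step\<inverse>)\<^sup>*"
  have "sym ?E" by (intro sym_rtrancl sym_Un_converse)
  then have "sym F_rel" by (auto simp: F_rel_def sym_def)
  moreover have "trans F_rel" by (auto simp: F_rel_def trans_def)
  ultimately show ?thesis
    by (intro equivI) (auto simp: F_rel_def refl_on_def)
qed

lemma F_class_graft: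
  assumes "leaves t = leaves s" "length f = leaves t"
  shows "F_class (graft f t, graft f s) = F_class (t, s)"
  unfolding F_class_def
proof (rule equiv_class_eq[OF equiv_F_rel])
  have "graft (replicate (fleaves f) Leaf) (graft f t) = graft f t"
      "graft (replicate (fleaves f) Leaf) (graft f s) = graft f s"
      "length (replicate (fleaves f) Leaf) = leaves (graft f t)" "leaves (graft f t) = leaves (graft f s)"
    using assms by (simp_all add: graft_trivial' leaves_graft)
  then have "\<exists>g h. length g = leaves (graft f t) \<and> length h = leaves t \<and>
      graft g (graft f t) = graft h t \<and> graft g (graft f s) = graft h s"
    using assms(2) by blast
  then show "((graft f t, graft f s), t, s) \<in> F_rel"
    unfolding F_rel_eq using assms \<open>leaves (graft f t) = leaves (graft f s)\<close> by blast
qed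

lemma F_class_eq_iff:
  assumes "leaves t = leaves s" "leaves t' = leaves s'"
  shows "F_class (t, s) = F_class (t', s') \<longleftrightarrow> ((t, s), (t', s')) \<in> F_rel"
  using eq_equiv_class_iff[OF equiv_F_rel] assms by (auto simp: F_class_def tree_pairs_def)

lemma F_class_fst_inj:
  assumes "leaves t = leaves s" "leaves t = leaves s'" "F_class (t, s) = F_class (t, s')"
  shows "s = s'"
proof -
  have "((t, s), (t, s')) \<in> F_rel" using assms F_class_eq_iff by auto
  then obtain f f' where f: "length f = leaves t" "length f' = leaves t" "graft f t = graft f' t"
      "graft f s = graft f' s'" by (auto simp: F_rel_eq)
  then have ff: "f = f'" by (metis graft_inj)
  show ?thesis using f assms unfolding ff by - (rule graft_cancel, auto)
qed

lemma F_class_sym: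
  assumes "leaves t = leaves s" "leaves t' = leaves s'" "F_class (t, s) = F_class (t', s')"
  shows "F_class (s, t) = F_class (s', t')"
proof -
  have "((t, s), (t', s')) \<in> F_rel" using assms F_class_eq_iff by auto
  then have "((s, t), (s', t')) \<in> F_rel" unfolding F_rel_eq using assms by auto
  then show ?thesis using assms F_class_eq_iff by auto
qed

lemma F_class_snd_inj:
  assumes "leaves t = leaves s" "leaves t' = leaves s" "F_class (t, s) = F_class (t', s)"
  shows "t = t'"
  using F_class_sym[OF _ _ assms(3)] F_class_fst_inj assms by metis

lemma F_class_carrier: "leaves t = leaves s \<Longrightarrow> F_class (t, s) \<in> carrier thompson_F"
  by (auto simp: thompson_F_def F_class_def tree_pairs_def intro: quotientI)

lemma F_carrier_cases:
  assumes "X \<in> carrier thompson_F"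
  obtains t s where "leaves t = leaves s" "X = F_class (t, s)"
  using assms by (auto simp: thompson_F_def F_class_def tree_pairs_def elim!: quotientE)

lemma in_F_class_iff:
  assumes "leaves t = leaves s"
  shows "(t', s') \<in> F_class (t, s) \<longleftrightarrow> leaves t' = leaves s' \<and> F_class (t', s') = F_class (t, s)"
proof
  assume "(t', s') \<in> F_class (t, s)"
  then have r: "((t, s), (t', s')) \<in> F_rel" by (simp add: F_class_def)
  then have "leaves t' = leaves s'" by (simp add: F_rel_eq)
  then show "leaves t' = leaves s' \<and> F_class (t', s') = F_class (t, s)"
    using F_class_eq_iff[of t s t' s'] assms r by simp
next
  assume "leaves t' = leaves s' \<and> F_class (t', s') = F_class (t, s)"
  then have "((t, s), (t', s')) \<in> F_rel" using F_class_eq_iff[of t s t' s'] assms by simp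
  then show "(t', s') \<in> F_class (t, s)" by (simp add: F_class_def)
qed

lemma F_mult_wd:
  assumes l: "leaves t = leaves s" "leaves s = leaves u" "leaves t' = leaves s'" "leaves s' = leaves u'"
    and eq: "F_class (t, s) = F_class (t', s')" "F_class (s, u) = F_class (s', u')"
  shows "F_class (t, u) = F_class (t', u')"
proof -
  obtain g g' where g: "length g = leaves s" "length g' = leaves s'" "graft g s = graft g' s'"
    by (rule common_refinement)
  have fl: "fleaves g = fleaves g'" using g leaves_graft[of g s] leaves_graft[of g' s'] by simp
  have "F_class (graft g t, graft g s) = F_class (graft g' t', graft g s)"
    using F_class_graft[of t s g] F_class_graft[of t' s' g'] l eq g by simp
  then have 1: "graft g t = graft g' t'"
    using l g fl by - (rule F_class_snd_inj[of _ "graft g s"], simp_all add: leaves_graft)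
  have "F_class (graft g s, graft g u) = F_class (graft g s, graft g' u')"
    using F_class_graft[of s u g] F_class_graft[of s' u' g'] l eq g by simp
  then have 2: "graft g u = graft g' u'"
    using l g fl by - (rule F_class_fst_inj[of "graft g s"], simp_all add: leaves_graft)
  have "F_class (t, u) = F_class (graft g t, graft g u)"
    by (rule F_class_graft[symmetric]) (use l g in simp_all)
  also have "\<dots> = F_class (graft g' t', graft g' u')" by (simp only: 1 2)
  also have "\<dots> = F_class (t', u')" by (rule F_class_graft) (use l g in simp_all)
  finally show ?thesis .
qed

lemma F_mult:
  assumes l: "leaves t = leaves s" "leaves s = leaves u"
  shows "F_class (t, s) \<otimes>\<^bsub>thompson_F\<^esub> F_class (s, u) = F_class (t, u)"
  unfolding thompson_F_def monoid.select_convs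
proof (rule the_equality)
  let ?f = "replicate (leaves s) Leaf"
  have "graft ?f t = t" "graft ?f u = u" using l by (simp_all add: graft_trivial')
  moreover have "(t, s) \<in> F_class (t, s)" "(s, u) \<in> F_class (s, u)" using l by (simp_all add: in_F_class_iff)
  ultimately have "(t, s) \<in> F_class (t, s) \<and> (s, u) \<in> F_class (s, u) \<and>
       length ?f = leaves s \<and> length ?f = leaves s \<and> graft ?f s = graft ?f s \<and>
       F_class (t, u) = F_class (graft ?f t, graft ?f u)" by simp
  then show "\<exists>t' s' t'' s'' f f'. (t', s') \<in> F_class (t, s) \<and> (t'', s'') \<in> F_class (s, u) \<and>
       length f = leaves s' \<and> length f' = leaves t'' \<and> graft f s' = graft f' t'' \<and>
       F_class (t, u) = F_class (graft f t', graft f' s'')"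
    by - ((rule exI)+, assumption)
next
  fix Z assume "\<exists>t' s' t'' s'' f f'. (t', s') \<in> F_class (t, s) \<and> (t'', s'') \<in> F_class (s, u) \<and>
       length f = leaves s' \<and> length f' = leaves t'' \<and> graft f s' = graft f' t'' \<and>
       Z = F_class (graft f t', graft f' s'')"
  then obtain t' s' t'' s'' f f' where
    *: "leaves t' = leaves s'" "F_class (t', s') = F_class (t, s)"
      "leaves t'' = leaves s''" "F_class (t'', s'') = F_class (s, u)"
      "length f = leaves s'" "length f' = leaves t''" "graft f s' = graft f' t''"
      "Z = F_class (graft f t', graft f' s'')"
    using l by (auto simp: in_F_class_iff)
  have 1: "F_class (graft f t', graft f s') = F_class (t, s)"
    using F_class_graft[of t' s' f] *(1,2,5) by simp
  have 2: "F_class (graft f s', graft f' s'') = F_class (s, u)"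
    using F_class_graft[of t'' s'' f'] *(3,4,6) unfolding *(7) by simp
  have 3: "leaves (graft f t') = leaves (graft f s')"
    using *(1,5) by (simp add: leaves_graft)
  have 4: "leaves (graft f s') = leaves (graft f' s'')"
    unfolding *(7) using *(3,6) by (simp add: leaves_graft)
  show "Z = F_class (t, u)"
    unfolding *(8) by (rule F_mult_wd[OF 3 4 l 1 2])
qed

lemma F_carrier_refine:
  assumes "X \<in> carrier thompson_F"
  obtains f t where "length f = leaves s" "leaves t = leaves (graft f s)" "X = F_class (graft f s, t)"
proof -
  obtain u v where uv: "leaves u = leaves v" "X = F_class (u, v)"
    using assms by (rule F_carrier_cases)
  obtain f g where fg: "length f = leaves s" "length g = leaves u" "graft f s = graft g u"
    by (rule common_refinement)
  show ?thesis
  proof (rule that[of f "graft g v"])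
    show "X = F_class (graft f s, graft g v)" using F_class_graft[of u v g] uv fg by simp
    show "leaves (graft g v) = leaves (graft f s)" using uv fg leaves_graft[of g v] leaves_graft[of g u] by simp
  qed (use fg in auto)
qed

lemma F_mult_cases:
  assumes "X \<in> carrier thompson_F" "Y \<in> carrier thompson_F"
  obtains t s u where "leaves t = leaves s" "leaves s = leaves u" "X = F_class (t, s)" "Y = F_class (s, u)"
proof -
  obtain t s where ts: "leaves t = leaves s" "X = F_class (t, s)" using assms F_carrier_cases by blast
  obtain f u where fu: "length f = leaves s" "leaves u = leaves (graft f s)" "Y = F_class (graft f s, u)"
    using assms F_carrier_refine by blast
  show ?thesis
  proof (rule that[of "graft f t" "graft f s" u])
    show "X = F_class (graft f t, graft f s)" using ts fu F_class_graft[of t s f] by simp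
  qed (use ts fu leaves_graft[of f t] leaves_graft[of f s] in simp_all)
qed

lemma F_one: "F_class (t, t) = \<one>\<^bsub>thompson_F\<^esub>"
  using F_class_graft[of Leaf Leaf "[t]"] by (simp add: thompson_F_def)

lemma group_thompson_F: "group thompson_F"
proof (rule groupI)
  show "\<one>\<^bsub>thompson_F\<^esub> \<in> carrier thompson_F"
    using F_class_carrier[of Leaf Leaf] by (simp add: F_one)
  fix X Y assume X: "X \<in> carrier thompson_F"
  from X obtain t s where ts: "leaves t = leaves s" "X = F_class (t, s)" by (rule F_carrier_cases)
  show "\<one>\<^bsub>thompson_F\<^esub> \<otimes>\<^bsub>thompson_F\<^esub> X = X"
    using ts F_mult[of t t s] by (simp add: F_one)
  show "\<exists>Y\<in>carrier thompson_F. Y \<otimes>\<^bsub>thompson_F\<^esub> X = \<one>\<^bsub>thompson_F\<^esub>"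
    using ts F_mult[of s t s] F_class_carrier[of s t] by (auto simp: F_one intro!: bexI[of _ "F_class (s, t)"])
  assume Y: "Y \<in> carrier thompson_F"
  show "X \<otimes>\<^bsub>thompson_F\<^esub> Y \<in> carrier thompson_F"
    by (rule F_mult_cases[OF X Y]) (simp add: F_mult F_class_carrier)
  fix Z assume Z: "Z \<in> carrier thompson_F"
  obtain t s u where a: "leaves t = leaves s" "leaves s = leaves u" "X = F_class (t, s)" "Y = F_class (s, u)"
    using F_mult_cases[OF X Y] .
  obtain f v where b: "length f = leaves u" "leaves v = leaves (graft f u)" "Z = F_class (graft f u, v)"
    using F_carrier_refine[OF Z] .
  have c: "X = F_class (graft f t, graft f s)" "Y = F_class (graft f s, graft f u)"
    unfolding a(3,4) by (rule F_class_graft[symmetric], use a(1,2) b(1) in simp_all)+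
  have d: "leaves (graft f t) = leaves (graft f s)" "leaves (graft f s) = leaves (graft f u)"
    using a(1,2) b(1) by (simp_all add: leaves_graft)
  show "X \<otimes>\<^bsub>thompson_F\<^esub> Y \<otimes>\<^bsub>thompson_F\<^esub> Z = X \<otimes>\<^bsub>thompson_F\<^esub> (Y \<otimes>\<^bsub>thompson_F\<^esub> Z)"
    unfolding c b(3) using d b(2) by (simp add: F_mult del: graft.simps)
qed

lemma F_inv:
  assumes "leaves t = leaves s"
  shows "inv\<^bsub>thompson_F\<^esub> F_class (t, s) = F_class (s, t)"
  by (rule group.inv_equality[OF group_thompson_F])
    (use assms in \<open>auto simp: F_mult F_one intro: F_class_carrier\<close>)

section \<open>Complex Hilbert spaces\<close>

definition complex_ring :: "complex ring" where
  "complex_ring = \<lparr>carrier = UNIV, mult = (*), one = 1, zero = 0, add = (+)\<rparr>"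

text \<open>The record \<open>module\<close> extends \<open>ring\<close>; the multiplicative fields \<open>mult\<close> and \<open>one\<close> of a space
  are never used, and are \<open>undefined\<close> in the constructions below.\<close>

record 'v cspace = "(complex, 'v) module" +
  cip :: "'v \<Rightarrow> 'v \<Rightarrow> complex"

definition vnorm :: "('v, 'm) cspace_scheme \<Rightarrow> 'v \<Rightarrow> real" where
  "vnorm V x = sqrt (Re (cip V x x))"

definition vdist :: "('v, 'm) cspace_scheme \<Rightarrow> 'v \<Rightarrow> 'v \<Rightarrow> real" where
  "vdist V x y = vnorm V (x \<ominus>\<^bsub>V\<^esub> y)"

definition cauchy_seqs :: "('v, 'm) cspace_scheme \<Rightarrow> (nat \<Rightarrow> 'v) set" where
  "cauchy_seqs V = {x. range x \<subseteq> carrier V \<and>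
     (\<forall>e>0. \<exists>N. \<forall>m\<ge>N. \<forall>n\<ge>N. vdist V (x m) (x n) < e)}"

text \<open>Inner products are linear in the first and conjugate-linear in the second variable.\<close>

locale pre_hilbert = Module.module complex_ring V for V :: "('v, 'm) cspace_scheme" (structure) +
  assumes cip_commute: "x \<in> carrier V \<Longrightarrow> y \<in> carrier V \<Longrightarrow> cip V x y = cnj (cip V y x)"
    and cip_add_left: "x \<in> carrier V \<Longrightarrow> y \<in> carrier V \<Longrightarrow> z \<in> carrier V \<Longrightarrow>
      cip V (x \<oplus> y) z = cip V x z + cip V y z"
    and cip_smult_left: "x \<in> carrier V \<Longrightarrow> y \<in> carrier V \<Longrightarrow> cip V (c \<odot> x) y = c * cip V x y"
    and cip_pos: "x \<in> carrier V \<Longrightarrow> x \<noteq> \<zero> \<Longrightarrow> 0 < Re (cip V x x)"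

locale hilbert = pre_hilbert +
  assumes complete: "x \<in> cauchy_seqs V \<Longrightarrow> \<exists>l\<in>carrier V. (\<lambda>n. vdist V (x n) l) \<longlonglongrightarrow> 0"

definition fin_dim :: "('v, 'm) cspace_scheme \<Rightarrow> bool" where
  "fin_dim V \<longleftrightarrow> (\<exists>S. finite S \<and> S \<subseteq> carrier V \<and>
     (\<forall>v\<in>carrier V. \<exists>c. v = finsum V (\<lambda>s. c s \<odot>\<^bsub>V\<^esub> s) S))"

definition complex_line :: "complex cspace" where
  "complex_line = \<lparr>carrier = UNIV, mult = undefined, one = undefined, zero = 0, add = (+),
     smult = (*), cip = (\<lambda>x y. x * cnj y)\<rparr>"

definition null_rel :: "('v, 'm) cspace_scheme \<Rightarrow> ((nat \<Rightarrow> 'v) \<times> (nat \<Rightarrow> 'v)) set" where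
  "null_rel V = {(x, y). x \<in> cauchy_seqs V \<and> y \<in> cauchy_seqs V \<and> (\<lambda>n. vdist V (x n) (y n)) \<longlonglongrightarrow> 0}"

definition limit_class :: "('v, 'm) cspace_scheme \<Rightarrow> (nat \<Rightarrow> 'v) \<Rightarrow> (nat \<Rightarrow> 'v) set" where
  "limit_class V x = null_rel V `` {x}"

definition completion :: "('v, 'm) cspace_scheme \<Rightarrow> (nat \<Rightarrow> 'v) set cspace" where
  "completion V = \<lparr>carrier = cauchy_seqs V // null_rel V, mult = undefined, one = undefined,
     zero = limit_class V (\<lambda>n. \<zero>\<^bsub>V\<^esub>),
     add = (\<lambda>X Y. THE Z. \<exists>x\<in>X. \<exists>y\<in>Y. Z = limit_class V (\<lambda>n. x n \<oplus>\<^bsub>V\<^esub> y n)),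
     smult = (\<lambda>c X. THE Z. \<exists>x\<in>X. Z = limit_class V (\<lambda>n. c \<odot>\<^bsub>V\<^esub> x n)),
     cip = (\<lambda>X Y. THE z. \<exists>x\<in>X. \<exists>y\<in>Y. (\<lambda>n. cip V (x n) (y n)) \<longlonglongrightarrow> z)\<rparr>"

definition completion_map :: "('v, 'm) cspace_scheme \<Rightarrow> ('v \<Rightarrow> 'v) \<Rightarrow> (nat \<Rightarrow> 'v) set \<Rightarrow> (nat \<Rightarrow> 'v) set" where
  "completion_map V T X = (THE Z. \<exists>x\<in>X. Z = limit_class V (\<lambda>n. T (x n)))"

lemma null_dominated:
  fixes f g :: "nat \<Rightarrow> real"
  assumes "g \<longlonglongrightarrow> 0" "\<And>n. 0 \<le> f n" "\<And>n. f n \<le> g n"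
  shows "f \<longlonglongrightarrow> 0"
  by (rule tendsto_sandwich[of "\<lambda>n. 0" f _ g]) (use assms in auto)

lemma complex_ring_simps [simp]:
  "carrier complex_ring = UNIV" "mult complex_ring = (*)" "one complex_ring = 1"
  "zero complex_ring = 0" "add complex_ring = (+)"
  by (simp_all add: complex_ring_def)

lemma cring_complex_ring: "cring complex_ring"
  by (intro cringI abelian_groupI comm_monoidI) (auto simp: algebra_simps intro: exI[of _ "- _"])

lemma pre_hilbertI:
  fixes V :: "('v, 'm) cspace_scheme" (structure)
  assumes "\<And>x y. x \<in> carrier V \<Longrightarrow> y \<in> carrier V \<Longrightarrow> x \<oplus> y \<in> carrier V"
    and "\<zero> \<in> carrier V"
    and "\<And>x y z. x \<in> carrier V \<Longrightarrow> y \<in> carrier V \<Longrightarrow> z \<in> carrier V \<Longrightarrow> (x \<oplus> y) \<oplus> z = x \<oplus> (y \<oplus> z)"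
    and "\<And>x y. x \<in> carrier V \<Longrightarrow> y \<in> carrier V \<Longrightarrow> x \<oplus> y = y \<oplus> x"
    and "\<And>x. x \<in> carrier V \<Longrightarrow> \<zero> \<oplus> x = x"
    and smult: "\<And>c x. x \<in> carrier V \<Longrightarrow> c \<odot> x \<in> carrier V"
    and ldistr: "\<And>c d x. x \<in> carrier V \<Longrightarrow> (c + d) \<odot> x = c \<odot> x \<oplus> d \<odot> x"
    and "\<And>c x y. x \<in> carrier V \<Longrightarrow> y \<in> carrier V \<Longrightarrow> c \<odot> (x \<oplus> y) = c \<odot> x \<oplus> c \<odot> y"
    and "\<And>c d x. x \<in> carrier V \<Longrightarrow> (c * d) \<odot> x = c \<odot> (d \<odot> x)"
    and one: "\<And>x. x \<in> carrier V \<Longrightarrow> 1 \<odot> x = x"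
    and null: "\<And>x. x \<in> carrier V \<Longrightarrow> 0 \<odot> x = \<zero>"
    and "\<And>x y. x \<in> carrier V \<Longrightarrow> y \<in> carrier V \<Longrightarrow> cip V x y = cnj (cip V y x)"
    and "\<And>x y z. x \<in> carrier V \<Longrightarrow> y \<in> carrier V \<Longrightarrow> z \<in> carrier V \<Longrightarrow>
      cip V (x \<oplus> y) z = cip V x z + cip V y z"
    and "\<And>c x y. x \<in> carrier V \<Longrightarrow> y \<in> carrier V \<Longrightarrow> cip V (c \<odot> x) y = c * cip V x y"
    and "\<And>x. x \<in> carrier V \<Longrightarrow> x \<noteq> \<zero> \<Longrightarrow> 0 < Re (cip V x x)"
  shows "pre_hilbert V"
proof (intro pre_hilbert.intro pre_hilbert_axioms.intro moduleI cring_complex_ring abelian_groupI)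
  fix x assume x: "x \<in> carrier V"
  have "(-1) \<odot> x \<oplus> x = \<zero>" using ldistr[OF x, of "-1" 1] one[OF x] null[OF x] by simp
  then show "\<exists>y\<in>carrier V. y \<oplus> x = \<zero>" using smult[OF x] by blast
qed ((simp only: complex_ring_simps)?, (rule assms; assumption))+

context pre_hilbert
begin

lemma minus_eq_smult: "x \<in> carrier V \<Longrightarrow> y \<in> carrier V \<Longrightarrow> x \<ominus> y = x \<oplus> (-1) \<odot> y"
proof -
  assume xy: "x \<in> carrier V" "y \<in> carrier V"
  have "(-1) \<odot> y \<oplus> y = \<zero>"
    using smult_l_distr[of "-1" 1 y] smult_one smult_l_null xy by simp
  then have "\<ominus> y = (-1) \<odot> y" using xy smult_closed[of "-1" y] by (simp add: minus_equality)
  then show ?thesis by (simp add: a_minus_def)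
qed

lemma minus_eq_zero_iff: "x \<in> carrier V \<Longrightarrow> y \<in> carrier V \<Longrightarrow> x \<ominus> y = \<zero> \<longleftrightarrow> x = y"
  by (metis a_minus_def r_neg add.inv_closed minus_equality minus_minus)

lemma smult_mem [simp]: "x \<in> carrier V \<Longrightarrow> c \<odot> x \<in> carrier V"
  using smult_closed[of c x] by simp

lemma cip_add_right: "x \<in> carrier V \<Longrightarrow> y \<in> carrier V \<Longrightarrow> z \<in> carrier V \<Longrightarrow>
    cip V z (x \<oplus> y) = cip V z x + cip V z y"
  by (metis cip_add_left cip_commute add.m_closed complex_cnj_add)

lemma cip_smult_right: "x \<in> carrier V \<Longrightarrow> y \<in> carrier V \<Longrightarrow> cip V y (c \<odot> x) = cnj c * cip V y x"
  by (metis cip_smult_left cip_commute smult_mem complex_cnj_mult)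

lemma cip_zero_left [simp]: "x \<in> carrier V \<Longrightarrow> cip V \<zero> x = 0"
  using cip_add_left[of \<zero> \<zero> x] by simp

lemma cip_zero_right [simp]: "x \<in> carrier V \<Longrightarrow> cip V x \<zero> = 0"
  using cip_add_right[of \<zero> \<zero> x] by simp

lemma cip_minus_left: "x \<in> carrier V \<Longrightarrow> y \<in> carrier V \<Longrightarrow> z \<in> carrier V \<Longrightarrow>
    cip V (x \<ominus> y) z = cip V x z - cip V y z"
  by (simp add: minus_eq_smult cip_add_left cip_smult_left)

lemma cip_minus_right: "x \<in> carrier V \<Longrightarrow> y \<in> carrier V \<Longrightarrow> z \<in> carrier V \<Longrightarrow>
    cip V z (x \<ominus> y) = cip V z x - cip V z y"
  by (simp add: minus_eq_smult cip_add_right cip_smult_right)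

lemma Im_cip_self [simp]: "x \<in> carrier V \<Longrightarrow> Im (cip V x x) = 0"
  using cip_commute[of x x] by (metis cnj.simps(2) equal_neg_zero)

lemma Re_cip_self_nonneg [simp]: "x \<in> carrier V \<Longrightarrow> 0 \<le> Re (cip V x x)"
  using cip_pos[of x] by (cases "x = \<zero>") auto

lemma vnorm_nonneg [simp]: "x \<in> carrier V \<Longrightarrow> 0 \<le> vnorm V x"
  by (simp add: vnorm_def)

lemma vnorm_sq: "x \<in> carrier V \<Longrightarrow> (vnorm V x)\<^sup>2 = Re (cip V x x)"
  by (simp add: vnorm_def)

lemma cip_self: "x \<in> carrier V \<Longrightarrow> cip V x x = complex_of_real ((vnorm V x)\<^sup>2)"
  by (simp add: vnorm_sq complex_eq_iff)

lemma vnorm_eq_0_iff: "x \<in> carrier V \<Longrightarrow> vnorm V x = 0 \<longleftrightarrow> x = \<zero>"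
  using cip_pos[of x] by (cases "x = \<zero>") (auto simp: vnorm_def)

lemma cauchy_schwarz:
  assumes x: "x \<in> carrier V" and y: "y \<in> carrier V"
  shows "cmod (cip V x y) \<le> vnorm V x * vnorm V y"
proof (cases "y = \<zero>")
  case True
  then show ?thesis using x y by simp
next
  case False
  define r where "r = Re (cip V y y)"
  have r: "0 < r" using cip_pos y False by (simp add: r_def)
  have ry: "cip V y y = complex_of_real r" using y by (simp add: r_def complex_eq_iff)
  define c where "c = cip V x y / complex_of_real r"
  have z: "x \<ominus> c \<odot> y \<in> carrier V" using x y by simp
  have yx: "cip V y x = cnj (cip V x y)" using cip_commute x y by metis
  have "cip V (x \<ominus> c \<odot> y) (x \<ominus> c \<odot> y) = cip V x x - cnj c * cip V x y - c * cip V y x + c * cnj c * cip V y y"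
    using x y z by (simp add: cip_minus_left cip_minus_right cip_smult_left cip_smult_right algebra_simps)
  also have "\<dots> = cip V x x - cip V x y * cnj (cip V x y) / complex_of_real r"
    using r unfolding yx ry c_def by (simp add: field_simps)
  also have "cip V x y * cnj (cip V x y) = complex_of_real ((cmod (cip V x y))\<^sup>2)"
    by (rule complex_norm_square[symmetric])
  finally have "Re (cip V (x \<ominus> c \<odot> y) (x \<ominus> c \<odot> y)) = Re (cip V x x) - (cmod (cip V x y))\<^sup>2 / r"
    by (simp add: Re_divide_of_real)
  then have "(cmod (cip V x y))\<^sup>2 / r \<le> Re (cip V x x)"
    using Re_cip_self_nonneg[OF z] by simp
  then have "(cmod (cip V x y))\<^sup>2 \<le> (vnorm V x * vnorm V y)\<^sup>2"
    using r x y by (simp add: vnorm_sq power_mult_distrib r_def divide_le_eq)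
  then show ?thesis using x y by (meson power2_le_imp_le mult_nonneg_nonneg vnorm_nonneg)
qed

lemma vnorm_triangle:
  assumes x: "x \<in> carrier V" and y: "y \<in> carrier V"
  shows "vnorm V (x \<oplus> y) \<le> vnorm V x + vnorm V y"
proof -
  have "(vnorm V (x \<oplus> y))\<^sup>2 = (vnorm V x)\<^sup>2 + (vnorm V y)\<^sup>2 + 2 * Re (cip V x y)"
    using x y cip_commute[of y x] by (simp add: vnorm_sq cip_add_left cip_add_right)
  also have "\<dots> \<le> (vnorm V x)\<^sup>2 + (vnorm V y)\<^sup>2 + 2 * (vnorm V x * vnorm V y)"
    using cauchy_schwarz[OF x y] complex_Re_le_cmod[of "cip V x y"] by simp
  also have "\<dots> = (vnorm V x + vnorm V y)\<^sup>2" by (simp add: power2_sum)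
  finally show ?thesis using x y by (meson power2_le_imp_le add_nonneg_nonneg vnorm_nonneg)
qed

lemma vnorm_smult: "x \<in> carrier V \<Longrightarrow> vnorm V (c \<odot> x) = cmod c * vnorm V x"
proof -
  assume x: "x \<in> carrier V"
  have "cip V (c \<odot> x) (c \<odot> x) = complex_of_real ((cmod c)\<^sup>2) * cip V x x"
    using x complex_norm_square[of c] by (simp add: cip_smult_left cip_smult_right)
  then show ?thesis using x by (simp add: vnorm_def real_sqrt_mult)
qed

lemma vdist_nonneg [simp]: "x \<in> carrier V \<Longrightarrow> y \<in> carrier V \<Longrightarrow> 0 \<le> vdist V x y"
  by (simp add: vdist_def)

lemma vdist_self [simp]: "x \<in> carrier V \<Longrightarrow> vdist V x x = 0"
  using minus_eq_zero_iff[of x x] by (simp add: vdist_def vnorm_def)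

lemma vdist_eq_0_iff: "x \<in> carrier V \<Longrightarrow> y \<in> carrier V \<Longrightarrow> vdist V x y = 0 \<longleftrightarrow> x = y"
  by (simp add: vdist_def vnorm_eq_0_iff minus_eq_zero_iff)

lemma vdist_sq: "x \<in> carrier V \<Longrightarrow> y \<in> carrier V \<Longrightarrow>
    (vdist V x y)\<^sup>2 = Re (cip V x x) + Re (cip V y y) - 2 * Re (cip V x y)"
  using cip_commute[of y x] by (simp add: vdist_def vnorm_sq cip_minus_left cip_minus_right)

lemma vdist_commute: "x \<in> carrier V \<Longrightarrow> y \<in> carrier V \<Longrightarrow> vdist V x y = vdist V y x"
proof -
  assume xy: "x \<in> carrier V" "y \<in> carrier V"
  have "(vdist V x y)\<^sup>2 = (vdist V y x)\<^sup>2"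
    using xy cip_commute[of y x] by (simp add: vdist_sq)
  then show ?thesis using xy by (simp add: power2_eq_iff_nonneg)
qed

lemma vdist_triangle:
  assumes "x \<in> carrier V" "y \<in> carrier V" "z \<in> carrier V"
  shows "vdist V x z \<le> vdist V x y + vdist V y z"
proof -
  have "x \<ominus> z = (x \<ominus> y) \<oplus> (y \<ominus> z)"
    using assms by (simp add: a_minus_def a_assoc[symmetric])
      (simp add: a_assoc l_neg)
  then show ?thesis using assms vnorm_triangle[of "x \<ominus> y" "y \<ominus> z"] by (simp add: vdist_def)
qed

lemma vdist_add:
  assumes "x \<in> carrier V" "y \<in> carrier V" "x' \<in> carrier V" "y' \<in> carrier V"
  shows "vdist V (x \<oplus> y) (x' \<oplus> y') \<le> vdist V x x' + vdist V y y'"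
proof -
  have "(x \<oplus> y) \<ominus> (x' \<oplus> y') = (x \<ominus> x') \<oplus> (y \<ominus> y')"
    using assms by (simp add: a_minus_def minus_add a_ac)
  then show ?thesis using assms vnorm_triangle[of "x \<ominus> x'" "y \<ominus> y'"] by (simp add: vdist_def)
qed

lemma vdist_smult:
  assumes "x \<in> carrier V" "y \<in> carrier V"
  shows "vdist V (c \<odot> x) (c \<odot> y) = cmod c * vdist V x y"
proof -
  have "c \<odot> x \<ominus> c \<odot> y = c \<odot> (x \<ominus> y)"
    using assms smult_r_distr[of c x "(-1) \<odot> y"] smult_assoc1[of c "-1" y] smult_assoc1[of "-1" c y]
    by (simp add: minus_eq_smult)
  then show ?thesis using assms by (simp add: vdist_def vnorm_smult)
qed

lemma vnorm_diff_le:
  assumes "x \<in> carrier V" "y \<in> carrier V"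
  shows "\<bar>vnorm V x - vnorm V y\<bar> \<le> vdist V x y"
proof -
  have "vdist V z \<zero> = vnorm V z" if "z \<in> carrier V" for z
    using that smult_r_null[of "-1"] by (simp add: vdist_def minus_eq_smult)
  then show ?thesis
    using vdist_triangle[of x y \<zero>] vdist_triangle[of y x \<zero>] vdist_commute[of x y] assms by simp
qed

lemma cip_diff_le:
  assumes "x \<in> carrier V" "y \<in> carrier V" "x' \<in> carrier V" "y' \<in> carrier V"
  shows "cmod (cip V x y - cip V x' y') \<le> vdist V x x' * vnorm V y + vnorm V x' * vdist V y y'"
proof -
  have "cip V x y - cip V x' y' = cip V (x \<ominus> x') y + cip V x' (y \<ominus> y')"
    using assms by (simp add: cip_minus_left cip_minus_right)
  then have "cmod (cip V x y - cip V x' y') \<le> cmod (cip V (x \<ominus> x') y) + cmod (cip V x' (y \<ominus> y'))"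
    using norm_triangle_ineq by metis
  also have "\<dots> \<le> vdist V x x' * vnorm V y + vnorm V x' * vdist V y y'"
    using assms by (intro add_mono) (simp_all add: vdist_def cauchy_schwarz)
  finally show ?thesis .
qed

lemma cauchy_seqs_carrier: "x \<in> cauchy_seqs V \<Longrightarrow> x n \<in> carrier V"
  by (auto simp: cauchy_seqs_def)

lemma cauchy_seqsD:
  assumes "x \<in> cauchy_seqs V" "0 < e"
  obtains N where "\<And>m n. m \<ge> N \<Longrightarrow> n \<ge> N \<Longrightarrow> vdist V (x m) (x n) < e"
proof -
  from assms have "\<exists>N. \<forall>m\<ge>N. \<forall>n\<ge>N. vdist V (x m) (x n) < e" by (simp add: cauchy_seqs_def)
  then obtain N where "\<forall>m\<ge>N. \<forall>n\<ge>N. vdist V (x m) (x n) < e" ..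
  then show ?thesis using that[of N] by simp
qed

lemma cauchy_seqs_const [simp]: "v \<in> carrier V \<Longrightarrow> (\<lambda>n. v) \<in> cauchy_seqs V"
  by (auto simp: cauchy_seqs_def)

lemma cauchy_seqs_add:
  assumes x: "x \<in> cauchy_seqs V" and y: "y \<in> cauchy_seqs V"
  shows "(\<lambda>n. x n \<oplus> y n) \<in> cauchy_seqs V"
proof -
  have "\<exists>N. \<forall>m\<ge>N. \<forall>n\<ge>N. vdist V (x m \<oplus> y m) (x n \<oplus> y n) < e" if "0 < e" for e
  proof -
    from that have e2: "0 < e / 2" by simp
    obtain N where N: "\<And>m n. m \<ge> N \<Longrightarrow> n \<ge> N \<Longrightarrow> vdist V (x m) (x n) < e / 2"
      using cauchy_seqsD[OF x e2] by blast
    obtain M where M: "\<And>m n. m \<ge> M \<Longrightarrow> n \<ge> M \<Longrightarrow> vdist V (y m) (y n) < e / 2"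
      using cauchy_seqsD[OF y e2] by blast
    have "vdist V (x m \<oplus> y m) (x n \<oplus> y n) < e" if "m \<ge> max N M" "n \<ge> max N M" for m n
      using vdist_add[of "x m" "y m" "x n" "y n"] N[of m n] M[of m n] that x y
      by (simp add: cauchy_seqs_carrier)
    then show ?thesis by blast
  qed
  moreover have "range (\<lambda>n. x n \<oplus> y n) \<subseteq> carrier V" using x y by (auto simp: cauchy_seqs_carrier)
  ultimately show ?thesis by (simp add: cauchy_seqs_def)
qed

lemma cauchy_seqs_smult:
  assumes x: "x \<in> cauchy_seqs V"
  shows "(\<lambda>n. c \<odot> x n) \<in> cauchy_seqs V"
proof -
  have "\<exists>N. \<forall>m\<ge>N. \<forall>n\<ge>N. vdist V (c \<odot> x m) (c \<odot> x n) < e" if e: "0 < e" for e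
  proof -
    have c: "0 < cmod c + 1" by (simp add: add_nonneg_pos)
    then have "0 < e / (cmod c + 1)" using e by simp
    then obtain N where N: "\<And>m n. m \<ge> N \<Longrightarrow> n \<ge> N \<Longrightarrow> vdist V (x m) (x n) < e / (cmod c + 1)"
      using cauchy_seqsD[OF x] by blast
    have "vdist V (c \<odot> x m) (c \<odot> x n) < e" if "m \<ge> N" "n \<ge> N" for m n
    proof -
      have nn: "0 \<le> vdist V (x m) (x n)" using x by (simp add: cauchy_seqs_carrier)
      have "vdist V (c \<odot> x m) (c \<odot> x n) \<le> (cmod c + 1) * vdist V (x m) (x n)"
        using x nn by (simp add: vdist_smult cauchy_seqs_carrier distrib_right)
      also have "\<dots> < e" using N[OF that] c by (simp add: pos_less_divide_eq mult.commute)
      finally show ?thesis .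
    qed
    then show ?thesis by blast
  qed
  moreover have "range (\<lambda>n. c \<odot> x n) \<subseteq> carrier V" using x by (auto simp: cauchy_seqs_carrier)
  ultimately show ?thesis by (simp add: cauchy_seqs_def)
qed

lemma cauchy_seqs_vnorm_bounded:
  assumes x: "x \<in> cauchy_seqs V"
  obtains B where "\<And>n. vnorm V (x n) \<le> B"
proof -
  have "Cauchy (\<lambda>n. vnorm V (x n))"
  proof (rule metric_CauchyI)
    fix e :: real assume "0 < e"
    then obtain N where N: "\<And>m n. m \<ge> N \<Longrightarrow> n \<ge> N \<Longrightarrow> vdist V (x m) (x n) < e"
      using cauchy_seqsD[OF x] by blast
    have "dist (vnorm V (x m)) (vnorm V (x n)) < e" if "m \<ge> N" "n \<ge> N" for m n
      using N[OF that] vnorm_diff_le[of "x m" "x n"] x by (simp add: dist_real_def cauchy_seqs_carrier)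
    then show "\<exists>M. \<forall>m\<ge>M. \<forall>n\<ge>M. dist (vnorm V (x m)) (vnorm V (x n)) < e" by blast
  qed
  then have "Bseq (\<lambda>n. vnorm V (x n))" by (rule Cauchy_Bseq)
  then obtain B where "\<And>n. norm (vnorm V (x n)) \<le> B" by (auto simp: Bseq_def)
  then show ?thesis using that[of B] by (metis abs_le_D1 real_norm_def)
qed

lemma convergent_cip:
  assumes x: "x \<in> cauchy_seqs V" and y: "y \<in> cauchy_seqs V"
  shows "convergent (\<lambda>n. cip V (x n) (y n))"
proof -
  obtain B where B: "\<And>n. vnorm V (x n) \<le> B" using cauchy_seqs_vnorm_bounded[OF x] by blast
  obtain C where C: "\<And>n. vnorm V (y n) \<le> C" using cauchy_seqs_vnorm_bounded[OF y] by blast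
  define D where "D = max B C + 1"
  have "0 \<le> B" using B[of 0] vnorm_nonneg[OF cauchy_seqs_carrier[OF x, of 0]] by linarith
  then have D: "0 < D" "\<And>n. vnorm V (x n) \<le> D" "\<And>n. vnorm V (y n) \<le> D"
    using B C by (auto simp: D_def le_max_iff_disj intro: order_trans add_increasing2)
  have "Cauchy (\<lambda>n. cip V (x n) (y n))"
  proof (rule metric_CauchyI)
    fix e :: real assume "0 < e"
    then have e2: "0 < e / (2 * D)" using D by simp
    obtain N where N: "\<And>m n. m \<ge> N \<Longrightarrow> n \<ge> N \<Longrightarrow> vdist V (x m) (x n) < e / (2 * D)"
      using cauchy_seqsD[OF x e2] by blast
    obtain M where M: "\<And>m n. m \<ge> M \<Longrightarrow> n \<ge> M \<Longrightarrow> vdist V (y m) (y n) < e / (2 * D)"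
      using cauchy_seqsD[OF y e2] by blast
    have "dist (cip V (x m) (y m)) (cip V (x n) (y n)) < e" if mn: "m \<ge> max N M" "n \<ge> max N M" for m n
    proof -
      have c: "x m \<in> carrier V" "y m \<in> carrier V" "x n \<in> carrier V" "y n \<in> carrier V"
        using x y by (simp_all add: cauchy_seqs_carrier)
      have "vdist V (x m) (x n) * vnorm V (y m) \<le> vdist V (x m) (x n) * D"
        using c D by (intro mult_left_mono) auto
      also have "\<dots> < e / (2 * D) * D" using N[of m n] mn D by (intro mult_strict_right_mono) auto
      also have "\<dots> = e / 2" using D by simp
      finally have 1: "vdist V (x m) (x n) * vnorm V (y m) < e / 2" .
      have "vnorm V (x n) * vdist V (y m) (y n) \<le> D * vdist V (y m) (y n)"
        using c D by (intro mult_right_mono) auto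
      also have "\<dots> < D * (e / (2 * D))" using M[of m n] mn D by (intro mult_strict_left_mono) auto
      also have "\<dots> = e / 2" using D by simp
      finally have 2: "vnorm V (x n) * vdist V (y m) (y n) < e / 2" .
      show ?thesis using cip_diff_le[OF c] 1 2 by (simp add: dist_norm)
    qed
    then show "\<exists>M. \<forall>m\<ge>M. \<forall>n\<ge>M. dist (cip V (x m) (y m)) (cip V (x n) (y n)) < e" by blast
  qed
  then show ?thesis by (rule Cauchy_convergent)
qed

lemma equiv_null_rel: "equiv (cauchy_seqs V) (null_rel V)"
proof (intro equivI)
  show "null_rel V \<subseteq> cauchy_seqs V \<times> cauchy_seqs V" by (auto simp: null_rel_def)
  show "refl_on (cauchy_seqs V) (null_rel V)"
    by (auto simp: refl_on_def null_rel_def cauchy_seqs_carrier)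
  show "sym (null_rel V)"
  proof (rule symI)
    fix x y assume "(x, y) \<in> null_rel V"
    moreover from this have "(\<lambda>n. vdist V (x n) (y n)) = (\<lambda>n. vdist V (y n) (x n))"
      by (intro ext vdist_commute) (auto simp: null_rel_def cauchy_seqs_carrier)
    ultimately show "(y, x) \<in> null_rel V" by (simp add: null_rel_def)
  qed
  show "trans (null_rel V)"
  proof (rule transI)
    fix x y z assume 1: "(x, y) \<in> null_rel V" and 2: "(y, z) \<in> null_rel V"
    then have c: "x \<in> cauchy_seqs V" "y \<in> cauchy_seqs V" "z \<in> cauchy_seqs V" by (auto simp: null_rel_def)
    have "(\<lambda>n. vdist V (x n) (y n) + vdist V (y n) (z n)) \<longlonglongrightarrow> 0"
      using 1 2 by (intro tendsto_add_zero) (simp_all add: null_rel_def)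
    then have "(\<lambda>n. vdist V (x n) (z n)) \<longlonglongrightarrow> 0"
      using c by (elim null_dominated)
        (simp_all add: cauchy_seqs_carrier vdist_triangle)
    then show "(x, z) \<in> null_rel V" using c by (simp add: null_rel_def)
  qed
qed

lemma limit_class_eq_iff:
  "x \<in> cauchy_seqs V \<Longrightarrow> y \<in> cauchy_seqs V \<Longrightarrow>
    limit_class V x = limit_class V y \<longleftrightarrow> (\<lambda>n. vdist V (x n) (y n)) \<longlonglongrightarrow> 0"
  unfolding limit_class_def using eq_equiv_class_iff[OF equiv_null_rel, of x y] by (simp add: null_rel_def)

lemma limit_class_eqI:
  "x \<in> cauchy_seqs V \<Longrightarrow> y \<in> cauchy_seqs V \<Longrightarrow> (\<lambda>n. vdist V (x n) (y n)) \<longlonglongrightarrow> 0 \<Longrightarrow>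
    limit_class V x = limit_class V y"
  by (simp add: limit_class_eq_iff)

lemma mem_limit_class_iff:
  "x \<in> cauchy_seqs V \<Longrightarrow> y \<in> limit_class V x \<longleftrightarrow> y \<in> cauchy_seqs V \<and> limit_class V x = limit_class V y"
proof -
  assume x: "x \<in> cauchy_seqs V"
  have "y \<in> limit_class V x \<longleftrightarrow> y \<in> cauchy_seqs V \<and> (\<lambda>n. vdist V (x n) (y n)) \<longlonglongrightarrow> 0"
    using x by (simp add: limit_class_def null_rel_def)
  then show ?thesis using limit_class_eq_iff[OF x, of y] by blast
qed

lemma limit_class_self: "x \<in> cauchy_seqs V \<Longrightarrow> x \<in> limit_class V x"
  by (simp add: mem_limit_class_iff)

lemma completion_cases:
  assumes "X \<in> carrier (completion V)"
  obtains x where "x \<in> cauchy_seqs V" "X = limit_class V x"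
  using assms by (auto simp: completion_def limit_class_def elim: quotientE)

lemma limit_class_closed [simp]: "x \<in> cauchy_seqs V \<Longrightarrow> limit_class V x \<in> carrier (completion V)"
  by (auto simp: completion_def limit_class_def intro: quotientI)

lemma completion_add:
  assumes x: "x \<in> cauchy_seqs V" and y: "y \<in> cauchy_seqs V"
  shows "limit_class V x \<oplus>\<^bsub>completion V\<^esub> limit_class V y = limit_class V (\<lambda>n. x n \<oplus> y n)"
  unfolding completion_def module.select_convs ring.select_convs
proof (rule the_equality)
  show "\<exists>u\<in>limit_class V x. \<exists>v\<in>limit_class V y.
      limit_class V (\<lambda>n. x n \<oplus> y n) = limit_class V (\<lambda>n. u n \<oplus> v n)"
    using limit_class_self x y by blast
next
  fix Z assume "\<exists>u\<in>limit_class V x. \<exists>v\<in>limit_class V y. Z = limit_class V (\<lambda>n. u n \<oplus> v n)"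
  then obtain u v where u: "u \<in> cauchy_seqs V" "limit_class V x = limit_class V u"
    and v: "v \<in> cauchy_seqs V" "limit_class V y = limit_class V v"
    and Z: "Z = limit_class V (\<lambda>n. u n \<oplus> v n)"
    using x y by (auto simp: mem_limit_class_iff)
  have "(\<lambda>n. vdist V (x n) (u n) + vdist V (y n) (v n)) \<longlonglongrightarrow> 0"
    using u v x y by (intro tendsto_add_zero) (simp_all add: limit_class_eq_iff)
  then have "(\<lambda>n. vdist V (x n \<oplus> y n) (u n \<oplus> v n)) \<longlonglongrightarrow> 0"
    using x y u(1) v(1) by (elim null_dominated)
      (simp_all add: cauchy_seqs_carrier vdist_add)
  then show "Z = limit_class V (\<lambda>n. x n \<oplus> y n)"
    unfolding Z using x y u v by (intro limit_class_eqI[symmetric] cauchy_seqs_add)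
qed

lemma completion_smult:
  assumes x: "x \<in> cauchy_seqs V"
  shows "c \<odot>\<^bsub>completion V\<^esub> limit_class V x = limit_class V (\<lambda>n. c \<odot> x n)"
  unfolding completion_def module.select_convs ring.select_convs
proof (rule the_equality)
  show "\<exists>u\<in>limit_class V x. limit_class V (\<lambda>n. c \<odot> x n) = limit_class V (\<lambda>n. c \<odot> u n)"
    using limit_class_self x by blast
next
  fix Z assume "\<exists>u\<in>limit_class V x. Z = limit_class V (\<lambda>n. c \<odot> u n)"
  then obtain u where u: "u \<in> cauchy_seqs V" "limit_class V x = limit_class V u"
    and Z: "Z = limit_class V (\<lambda>n. c \<odot> u n)"
    using x by (auto simp: mem_limit_class_iff)
  have "(\<lambda>n. cmod c * vdist V (x n) (u n)) \<longlonglongrightarrow> cmod c * 0"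
    using u x by (intro tendsto_mult_left) (simp add: limit_class_eq_iff)
  then have "(\<lambda>n. vdist V (c \<odot> x n) (c \<odot> u n)) \<longlonglongrightarrow> 0"
    using x u by (simp add: vdist_smult cauchy_seqs_carrier)
  then show "Z = limit_class V (\<lambda>n. c \<odot> x n)"
    unfolding Z using x u by (intro limit_class_eqI[symmetric] cauchy_seqs_smult)
qed

lemma completion_cip:
  assumes x: "x \<in> cauchy_seqs V" and y: "y \<in> cauchy_seqs V"
  shows "(\<lambda>n. cip V (x n) (y n)) \<longlonglongrightarrow> cip (completion V) (limit_class V x) (limit_class V y)"
proof -
  obtain z where z: "(\<lambda>n. cip V (x n) (y n)) \<longlonglongrightarrow> z"
    using convergent_cip[OF x y] by (auto simp: convergent_def)
  have "cip (completion V) (limit_class V x) (limit_class V y) = z"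
    unfolding completion_def cspace.select_convs
  proof (rule the_equality)
    show "\<exists>u\<in>limit_class V x. \<exists>v\<in>limit_class V y. (\<lambda>n. cip V (u n) (v n)) \<longlonglongrightarrow> z"
      using limit_class_self x y z by blast
  next
    fix w assume "\<exists>u\<in>limit_class V x. \<exists>v\<in>limit_class V y. (\<lambda>n. cip V (u n) (v n)) \<longlonglongrightarrow> w"
    then obtain u v where u: "u \<in> cauchy_seqs V" "limit_class V x = limit_class V u"
      and v: "v \<in> cauchy_seqs V" "limit_class V y = limit_class V v"
      and w: "(\<lambda>n. cip V (u n) (v n)) \<longlonglongrightarrow> w"
      using x y by (auto simp: mem_limit_class_iff)
    obtain B where B: "\<And>n. vnorm V (u n) \<le> B" using cauchy_seqs_vnorm_bounded[OF u(1)] by blast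
    obtain C where C: "\<And>n. vnorm V (y n) \<le> C" using cauchy_seqs_vnorm_bounded[OF y] by blast
    have "(\<lambda>n. vdist V (x n) (u n) * C + B * vdist V (y n) (v n)) \<longlonglongrightarrow> 0 * C + B * 0"
      using u v x y by (intro tendsto_intros) (simp_all add: limit_class_eq_iff)
    then have "(\<lambda>n. vdist V (x n) (u n) * C + B * vdist V (y n) (v n)) \<longlonglongrightarrow> 0" by simp
    moreover have "norm (cip V (x n) (y n) - cip V (u n) (v n)) \<le> vdist V (x n) (u n) * C + B * vdist V (y n) (v n)" for n
    proof -
      have c: "x n \<in> carrier V" "y n \<in> carrier V" "u n \<in> carrier V" "v n \<in> carrier V"
        using x y u v by (simp_all add: cauchy_seqs_carrier)
      have "vdist V (x n) (u n) * vnorm V (y n) \<le> vdist V (x n) (u n) * C"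
        "vnorm V (u n) * vdist V (y n) (v n) \<le> B * vdist V (y n) (v n)"
        using c B C by (auto intro!: mult_left_mono mult_right_mono)
      then show ?thesis using cip_diff_le[OF c] by linarith
    qed
    ultimately have "(\<lambda>n. norm (cip V (x n) (y n) - cip V (u n) (v n))) \<longlonglongrightarrow> 0"
      by (rule null_dominated[OF _ norm_ge_zero])
    then have "(\<lambda>n. cip V (x n) (y n) - cip V (u n) (v n)) \<longlonglongrightarrow> 0"
      by (rule tendsto_norm_zero_cancel)
    moreover have "(\<lambda>n. cip V (x n) (y n) - cip V (u n) (v n)) \<longlonglongrightarrow> z - w" using z w by (rule tendsto_diff)
    ultimately show "w = z" using LIMSEQ_unique by fastforce
  qed
  then show ?thesis using z by simp
qed

lemma pre_hilbert_completion: "pre_hilbert (completion V)"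
proof (rule pre_hilbertI)
  let ?W = "completion V"
  have zero: "\<zero>\<^bsub>?W\<^esub> = limit_class V (\<lambda>n. \<zero>)" by (simp add: completion_def)
  show "\<zero>\<^bsub>?W\<^esub> \<in> carrier ?W" by (simp add: zero)
  fix X assume "X \<in> carrier ?W"
  then obtain x where x: "x \<in> cauchy_seqs V" "X = limit_class V x" by (rule completion_cases)
  note xc = cauchy_seqs_carrier[OF x(1)]
  note simps = completion_add completion_smult cauchy_seqs_add cauchy_seqs_smult cauchy_seqs_carrier
  show "\<zero>\<^bsub>?W\<^esub> \<oplus>\<^bsub>?W\<^esub> X = X" using x xc by (simp add: zero simps)
  show "c \<odot>\<^bsub>?W\<^esub> X \<in> carrier ?W" for c using x by (simp add: simps)
  show "(c + d) \<odot>\<^bsub>?W\<^esub> X = c \<odot>\<^bsub>?W\<^esub> X \<oplus>\<^bsub>?W\<^esub> d \<odot>\<^bsub>?W\<^esub> X" for c d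
    using x smult_l_distr[of c d] xc by (simp add: simps)
  show "(c * d) \<odot>\<^bsub>?W\<^esub> X = c \<odot>\<^bsub>?W\<^esub> (d \<odot>\<^bsub>?W\<^esub> X)" for c d
    using x smult_assoc1[of c d] xc by (simp add: simps)
  show "1 \<odot>\<^bsub>?W\<^esub> X = X" using x smult_one xc by (simp add: simps)
  show "0 \<odot>\<^bsub>?W\<^esub> X = \<zero>\<^bsub>?W\<^esub>" using x smult_l_null xc by (simp add: simps zero)
  show "0 < Re (cip ?W X X)" if "X \<noteq> \<zero>\<^bsub>?W\<^esub>"
  proof -
    have lim: "(\<lambda>n. Re (cip V (x n) (x n))) \<longlonglongrightarrow> Re (cip ?W X X)"
      unfolding x(2) by (intro tendsto_Re completion_cip x)
    have "0 \<le> Re (cip ?W X X)"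
      using lim by (rule LIMSEQ_le_const) (use xc in auto)
    moreover have "Re (cip ?W X X) \<noteq> 0"
    proof
      assume "Re (cip ?W X X) = 0"
      then have "(\<lambda>n. sqrt (Re (cip V (x n) (x n)))) \<longlonglongrightarrow> sqrt 0"
        using lim by (intro tendsto_real_sqrt) simp
      moreover have "sqrt (Re (cip V (x n) (x n))) = vdist V (x n) \<zero>" for n
        using xc smult_r_null[of "-1"] by (simp add: vdist_def vnorm_def minus_eq_smult)
      ultimately have "(\<lambda>n. vdist V (x n) \<zero>) \<longlonglongrightarrow> 0" by simp
      then have "X = \<zero>\<^bsub>?W\<^esub>" unfolding x(2) zero using x by (simp add: limit_class_eq_iff)
      with that show False by simp
    qed
    ultimately show ?thesis by simp
  qed
  fix Y assume "Y \<in> carrier ?W"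
  then obtain y where y: "y \<in> cauchy_seqs V" "Y = limit_class V y" by (rule completion_cases)
  note yc = cauchy_seqs_carrier[OF y(1)]
  show "X \<oplus>\<^bsub>?W\<^esub> Y \<in> carrier ?W" using x y by (simp add: simps)
  show "X \<oplus>\<^bsub>?W\<^esub> Y = Y \<oplus>\<^bsub>?W\<^esub> X" using x y xc yc by (simp add: simps a_comm)
  show "c \<odot>\<^bsub>?W\<^esub> (X \<oplus>\<^bsub>?W\<^esub> Y) = c \<odot>\<^bsub>?W\<^esub> X \<oplus>\<^bsub>?W\<^esub> c \<odot>\<^bsub>?W\<^esub> Y" for c
    using x y xc yc smult_r_distr[of c] by (simp add: simps)
  show "cip ?W X Y = cnj (cip ?W Y X)"
  proof (rule LIMSEQ_unique)
    show "(\<lambda>n. cip V (x n) (y n)) \<longlonglongrightarrow> cip ?W X Y" unfolding x y by (intro completion_cip x y)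
    have "(\<lambda>n. cnj (cip V (y n) (x n))) \<longlonglongrightarrow> cnj (cip ?W Y X)"
      unfolding x y by (intro tendsto_cnj completion_cip x y)
    then show "(\<lambda>n. cip V (x n) (y n)) \<longlonglongrightarrow> cnj (cip ?W Y X)"
      using cip_commute[OF xc yc] by simp
  qed
  show "cip ?W (c \<odot>\<^bsub>?W\<^esub> X) Y = c * cip ?W X Y" for c
  proof (rule LIMSEQ_unique)
    show "(\<lambda>n. cip V (c \<odot> x n) (y n)) \<longlonglongrightarrow> cip ?W (c \<odot>\<^bsub>?W\<^esub> X) Y"
      unfolding x y completion_smult[OF x(1)] by (intro completion_cip x y cauchy_seqs_smult)
    have "(\<lambda>n. c * cip V (x n) (y n)) \<longlonglongrightarrow> c * cip ?W X Y"
      unfolding x y by (intro tendsto_mult_left completion_cip x y)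
    then show "(\<lambda>n. cip V (c \<odot> x n) (y n)) \<longlonglongrightarrow> c * cip ?W X Y"
      using cip_smult_left xc yc by simp
  qed
  fix Z assume "Z \<in> carrier ?W"
  then obtain z where z: "z \<in> cauchy_seqs V" "Z = limit_class V z" by (rule completion_cases)
  note zc = cauchy_seqs_carrier[OF z(1)]
  show "X \<oplus>\<^bsub>?W\<^esub> Y \<oplus>\<^bsub>?W\<^esub> Z = X \<oplus>\<^bsub>?W\<^esub> (Y \<oplus>\<^bsub>?W\<^esub> Z)"
    using x y z xc yc zc by (simp add: simps a_assoc)
  show "cip ?W (X \<oplus>\<^bsub>?W\<^esub> Y) Z = cip ?W X Z + cip ?W Y Z"
  proof (rule LIMSEQ_unique)
    show "(\<lambda>n. cip V (x n \<oplus> y n) (z n)) \<longlonglongrightarrow> cip ?W (X \<oplus>\<^bsub>?W\<^esub> Y) Z"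
      unfolding x y z completion_add[OF x(1) y(1)] by (intro completion_cip x y z cauchy_seqs_add)
    have "(\<lambda>n. cip V (x n) (z n) + cip V (y n) (z n)) \<longlonglongrightarrow> cip ?W X Z + cip ?W Y Z"
      unfolding x y z by (intro tendsto_add completion_cip x y z)
    then show "(\<lambda>n. cip V (x n \<oplus> y n) (z n)) \<longlonglongrightarrow> cip ?W X Z + cip ?W Y Z"
      using cip_add_left xc yc zc by simp
  qed
qed

lemma completion_vdist:
  assumes x: "x \<in> cauchy_seqs V" and y: "y \<in> cauchy_seqs V"
  shows "(\<lambda>n. vdist V (x n) (y n)) \<longlonglongrightarrow> vdist (completion V) (limit_class V x) (limit_class V y)"
proof -
  interpret W: pre_hilbert "completion V" by (rule pre_hilbert_completion)
  let ?z = "\<lambda>n. x n \<ominus> y n"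
  have z: "?z = (\<lambda>n. x n \<oplus> (-1) \<odot> y n)" using x y by (simp add: minus_eq_smult cauchy_seqs_carrier)
  then have zc: "?z \<in> cauchy_seqs V" using x y by (simp add: cauchy_seqs_add cauchy_seqs_smult)
  have "limit_class V x \<ominus>\<^bsub>completion V\<^esub> limit_class V y = limit_class V ?z"
    using x y unfolding z by (simp add: W.minus_eq_smult completion_add completion_smult cauchy_seqs_smult)
  then show ?thesis unfolding vdist_def vnorm_def
    by (auto intro!: tendsto_real_sqrt tendsto_Re completion_cip zc)
qed

lemma hilbert_completion: "hilbert (completion V)"
proof -
  let ?W = "completion V"
  interpret W: pre_hilbert ?W by (rule pre_hilbert_completion)
  have "\<exists>L\<in>carrier ?W. (\<lambda>n. vdist ?W (X n) L) \<longlonglongrightarrow> 0" if X: "X \<in> cauchy_seqs ?W" for X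
  proof -
    have "\<forall>k. \<exists>x. x \<in> cauchy_seqs V \<and> X k = limit_class V x"
      using X W.cauchy_seqs_carrier completion_cases by metis
    then obtain x where x: "\<And>k. x k \<in> cauchy_seqs V" "\<And>k. X k = limit_class V (x k)" by metis
    have "\<forall>k. \<exists>N. \<forall>m\<ge>N. \<forall>n\<ge>N. vdist V (x k m) (x k n) < 1 / real (Suc k)"
      using cauchy_seqsD[OF x(1)] by (metis zero_less_divide_1_iff of_nat_0_less_iff zero_less_Suc)
    then obtain N where N: "\<And>k m n. m \<ge> N k \<Longrightarrow> n \<ge> N k \<Longrightarrow> vdist V (x k m) (x k n) < 1 / real (Suc k)"
      by metis
    define y where "y k = x k (N k)" for k
    have yc: "y k \<in> carrier V" for k using x by (simp add: y_def cauchy_seqs_carrier)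
    have Xy: "vdist ?W (X k) (limit_class V (\<lambda>n. y k)) \<le> 1 / real (Suc k)" for k
    proof -
      have "(\<lambda>n. vdist V (x k n) (y k)) \<longlonglongrightarrow> vdist ?W (X k) (limit_class V (\<lambda>n. y k))"
        unfolding x(2) using completion_vdist[OF x(1)[of k] cauchy_seqs_const[OF yc[of k]]] .
      moreover have "\<exists>M. \<forall>n\<ge>M. vdist V (x k n) (y k) \<le> 1 / real (Suc k)"
        using N unfolding y_def by (meson less_imp_le order_refl)
      ultimately show ?thesis by (rule LIMSEQ_le_const2)
    qed
    have dconst: "vdist ?W (limit_class V (\<lambda>n. u)) (limit_class V (\<lambda>n. v)) = vdist V u v"
      if "u \<in> carrier V" "v \<in> carrier V" for u v
      using completion_vdist[of "\<lambda>n. u" "\<lambda>n. v"] that by (simp add: LIMSEQ_const_iff)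
    have ylc: "limit_class V (\<lambda>n. y k) \<in> carrier ?W" for k using yc by simp
    have Xc: "X k \<in> carrier ?W" for k using X W.cauchy_seqs_carrier by blast
    have y: "y \<in> cauchy_seqs V"
    proof -
      have "\<exists>M. \<forall>m\<ge>M. \<forall>n\<ge>M. vdist V (y m) (y n) < e" if e: "0 < e" for e
      proof -
        have e3: "0 < e / 3" using e by simp
        obtain M where M: "\<And>m n. m \<ge> M \<Longrightarrow> n \<ge> M \<Longrightarrow> vdist ?W (X m) (X n) < e / 3"
          using W.cauchy_seqsD[OF X e3] by blast
        obtain K where K: "1 / real (Suc K) < e / 3" using nat_approx_posE[OF e3] by blast
        have inv: "1 / real (Suc k) < e / 3" if "k \<ge> K" for k
        proof -
          have "1 / real (Suc k) \<le> 1 / real (Suc K)" using that by (simp add: frac_le)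
          then show ?thesis using K by simp
        qed
        have "vdist V (y m) (y n) < e" if mn: "m \<ge> max M K" "n \<ge> max M K" for m n
        proof -
          have "vdist V (y m) (y n) = vdist ?W (limit_class V (\<lambda>i. y m)) (limit_class V (\<lambda>i. y n))"
            using dconst yc by simp
          also have "\<dots> \<le> vdist ?W (limit_class V (\<lambda>i. y m)) (X m) + vdist ?W (X m) (limit_class V (\<lambda>i. y n))"
            by (rule W.vdist_triangle[OF ylc Xc ylc])
          also have "\<dots> \<le> vdist ?W (limit_class V (\<lambda>i. y m)) (X m) + (vdist ?W (X m) (X n) + vdist ?W (X n) (limit_class V (\<lambda>i. y n)))"
            by (intro add_left_mono W.vdist_triangle[OF Xc Xc ylc])
          also have "vdist ?W (limit_class V (\<lambda>i. y m)) (X m) = vdist ?W (X m) (limit_class V (\<lambda>i. y m))"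
            by (rule W.vdist_commute[OF ylc Xc])
          finally show ?thesis
            using Xy[of m] Xy[of n] inv[of m] inv[of n] M[of m n] mn by simp
        qed
        then show ?thesis by blast
      qed
      moreover have "range y \<subseteq> carrier V" using yc by auto
      ultimately show ?thesis by (simp add: cauchy_seqs_def)
    qed
    have "(\<lambda>k. vdist ?W (X k) (limit_class V y)) \<longlonglongrightarrow> 0"
    proof (rule LIMSEQ_I)
      fix e :: real assume e: "0 < e"
      then have e3: "0 < e / 3" by simp
      obtain M where M: "\<And>m n. m \<ge> M \<Longrightarrow> n \<ge> M \<Longrightarrow> vdist V (y m) (y n) < e / 3"
        using cauchy_seqsD[OF y e3] by blast
      obtain K where K: "1 / real (Suc K) < e / 3" using nat_approx_posE[OF e3] by blast
      have "norm (vdist ?W (X k) (limit_class V y) - 0) < e" if k: "k \<ge> max M K" for k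
      proof -
        have "1 / real (Suc k) \<le> 1 / real (Suc K)" using k by (simp add: frac_le)
        then have 1: "vdist ?W (X k) (limit_class V (\<lambda>n. y k)) < e / 3" using Xy[of k] K by linarith
        have "(\<lambda>n. vdist V (y k) (y n)) \<longlonglongrightarrow> vdist ?W (limit_class V (\<lambda>n. y k)) (limit_class V y)"
          using completion_vdist[OF cauchy_seqs_const[OF yc[of k]] y] .
        moreover have "\<exists>M. \<forall>n\<ge>M. vdist V (y k) (y n) \<le> e / 3"
          using M k by (meson less_imp_le max.boundedE)
        ultimately have 2: "vdist ?W (limit_class V (\<lambda>n. y k)) (limit_class V y) \<le> e / 3"
          by (rule LIMSEQ_le_const2)
        have "vdist ?W (X k) (limit_class V y) \<le> vdist ?W (X k) (limit_class V (\<lambda>n. y k)) +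
            vdist ?W (limit_class V (\<lambda>n. y k)) (limit_class V y)"
          using y by (intro W.vdist_triangle[OF Xc ylc]) simp
        moreover have "0 \<le> vdist ?W (X k) (limit_class V y)" using Xc y by simp
        ultimately show ?thesis using 1 2 e by simp
      qed
      then show "\<exists>no. \<forall>k\<ge>no. norm (vdist ?W (X k) (limit_class V y) - 0) < e" by blast
    qed
    then show ?thesis using y by (intro bexI[of _ "limit_class V y"]) auto
  qed
  then show ?thesis by (intro hilbert.intro hilbert_axioms.intro pre_hilbert_completion)
qed

lemma completion_map:
  assumes T: "\<And>u. u \<in> carrier V \<Longrightarrow> T u \<in> carrier V"
      "\<And>u v. u \<in> carrier V \<Longrightarrow> v \<in> carrier V \<Longrightarrow> vdist V (T u) (T v) = vdist V u v"
    and x: "x \<in> cauchy_seqs V"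
  shows "(\<lambda>n. T (x n)) \<in> cauchy_seqs V"
    and "completion_map V T (limit_class V x) = limit_class V (\<lambda>n. T (x n))"
proof -
  have Tc: "(\<lambda>n. T (u n)) \<in> cauchy_seqs V" if "u \<in> cauchy_seqs V" for u
    using that T unfolding cauchy_seqs_def by (auto simp: image_subset_iff)
  then show "(\<lambda>n. T (x n)) \<in> cauchy_seqs V" using x by blast
  show "completion_map V T (limit_class V x) = limit_class V (\<lambda>n. T (x n))"
    unfolding completion_map_def
  proof (rule the_equality)
    show "\<exists>u\<in>limit_class V x. limit_class V (\<lambda>n. T (x n)) = limit_class V (\<lambda>n. T (u n))"
      using limit_class_self x by blast
  next
    fix Z assume "\<exists>u\<in>limit_class V x. Z = limit_class V (\<lambda>n. T (u n))"
    then obtain u where u: "u \<in> cauchy_seqs V" "limit_class V x = limit_class V u"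
      and Z: "Z = limit_class V (\<lambda>n. T (u n))"
      using x by (auto simp: mem_limit_class_iff)
    have "(\<lambda>n. vdist V (x n) (u n)) \<longlonglongrightarrow> 0" using x u by (simp add: limit_class_eq_iff)
    then have "(\<lambda>n. vdist V (T (x n)) (T (u n))) \<longlonglongrightarrow> 0"
      using T x u by (simp add: cauchy_seqs_carrier)
    then show "Z = limit_class V (\<lambda>n. T (x n))"
      unfolding Z using x u by (intro limit_class_eqI[symmetric] Tc)
  qed
qed

end

section \<open>Unitary representations\<close>

definition unitary_iso :: "('v, 'm) cspace_scheme \<Rightarrow> ('w, 'n) cspace_scheme \<Rightarrow> ('v \<Rightarrow> 'w) \<Rightarrow> bool" where
  "unitary_iso V W U \<longleftrightarrow> bij_betw U (carrier V) (carrier W) \<and>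
     (\<forall>x\<in>carrier V. \<forall>y\<in>carrier V. U (x \<oplus>\<^bsub>V\<^esub> y) = U x \<oplus>\<^bsub>W\<^esub> U y) \<and>
     (\<forall>c. \<forall>x\<in>carrier V. U (c \<odot>\<^bsub>V\<^esub> x) = c \<odot>\<^bsub>W\<^esub> U x) \<and>
     (\<forall>x\<in>carrier V. \<forall>y\<in>carrier V. cip W (U x) (U y) = cip V x y)"

definition unitary_rep ::
  "('g, 'k) monoid_scheme \<Rightarrow> ('v, 'm) cspace_scheme \<Rightarrow> ('g \<Rightarrow> 'v \<Rightarrow> 'v) \<Rightarrow> bool" where
  "unitary_rep G V \<pi> \<longleftrightarrow> (\<forall>g\<in>carrier G. unitary_iso V V (\<pi> g)) \<and>
     (\<forall>g\<in>carrier G. \<forall>h\<in>carrier G. \<forall>v\<in>carrier V. \<pi> (g \<otimes>\<^bsub>G\<^esub> h) v = \<pi> g (\<pi> h v))"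

definition closed_subspace :: "('v, 'm) cspace_scheme \<Rightarrow> 'v set \<Rightarrow> bool" where
  "closed_subspace V M \<longleftrightarrow> submodule M complex_ring V \<and>
     (\<forall>x l. range x \<subseteq> M \<and> l \<in> carrier V \<and> (\<lambda>n. vdist V (x n) l) \<longlonglongrightarrow> 0 \<longrightarrow> l \<in> M)"

definition subrep ::
  "('g, 'k) monoid_scheme \<Rightarrow> ('v, 'm) cspace_scheme \<Rightarrow> ('g \<Rightarrow> 'v \<Rightarrow> 'v) \<Rightarrow> 'v set \<Rightarrow> bool" where
  "subrep G V \<pi> M \<longleftrightarrow> closed_subspace V M \<and> (\<forall>g\<in>carrier G. \<forall>v\<in>M. \<pi> g v \<in> M)"

definition unitarily_equivalent ::
  "('g, 'k) monoid_scheme \<Rightarrow> ('v, 'm) cspace_scheme \<Rightarrow> ('g \<Rightarrow> 'v \<Rightarrow> 'v) \<Rightarrow>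
    ('w, 'n) cspace_scheme \<Rightarrow> ('g \<Rightarrow> 'w \<Rightarrow> 'w) \<Rightarrow> bool" where
  "unitarily_equivalent G V \<pi> W \<rho> \<longleftrightarrow> (\<exists>U. unitary_iso V W U \<and>
     (\<forall>g\<in>carrier G. \<forall>v\<in>carrier V. U (\<pi> g v) = \<rho> g (U v)))"

definition rep_contained ::
  "('g, 'k) monoid_scheme \<Rightarrow> ('v, 'm) cspace_scheme \<Rightarrow> ('g \<Rightarrow> 'v \<Rightarrow> 'v) \<Rightarrow>
    ('w, 'n) cspace_scheme \<Rightarrow> ('g \<Rightarrow> 'w \<Rightarrow> 'w) \<Rightarrow> bool" where
  "rep_contained G V \<pi> W \<rho> \<longleftrightarrow>
     (\<exists>M. subrep G W \<rho> M \<and> unitarily_equivalent G V \<pi> (W\<lparr>carrier := M\<rparr>) \<rho>)"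

text \<open>The representation of \<open>G\<close> induced from the representation \<open>\<theta>\<close> of the subgroup \<open>K\<close> on \<open>V\<close>.
  Its vectors are the functions \<open>\<phi>\<close> on \<open>G\<close> with \<open>\<phi> (g k) = \<theta> k\<^sup>-\<^sup>1 (\<phi> g)\<close> that are square-summable
  on \<open>G / K\<close>; norms and inner products of values of such functions depend only on left cosets, so
  that sums over \<open>G / K\<close> may be taken over arbitrary representatives.\<close>

definition coset_rep :: "'g set \<Rightarrow> 'g" where
  "coset_rep C = (SOME g. g \<in> C)"

definition ind_space ::
  "('g, 'k) monoid_scheme \<Rightarrow> 'g set \<Rightarrow> ('v, 'm) cspace_scheme \<Rightarrow> ('g \<Rightarrow> 'v \<Rightarrow> 'v) \<Rightarrow> ('g \<Rightarrow> 'v) cspace" where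
  "ind_space G K V \<theta> = \<lparr>
     carrier = {\<phi> \<in> carrier G \<rightarrow>\<^sub>E carrier V.
       (\<forall>g\<in>carrier G. \<forall>k\<in>K. \<phi> (g \<otimes>\<^bsub>G\<^esub> k) = \<theta> (inv\<^bsub>G\<^esub> k) (\<phi> g)) \<and>
       (\<lambda>C. (vnorm V (\<phi> (coset_rep C)))\<^sup>2) summable_on lcosets\<^bsub>G\<^esub> K},
     mult = undefined, one = undefined,
     zero = (\<lambda>g\<in>carrier G. \<zero>\<^bsub>V\<^esub>),
     add = (\<lambda>\<phi> \<psi>. \<lambda>g\<in>carrier G. \<phi> g \<oplus>\<^bsub>V\<^esub> \<psi> g),
     smult = (\<lambda>c \<phi>. \<lambda>g\<in>carrier G. c \<odot>\<^bsub>V\<^esub> \<phi> g),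
     cip = (\<lambda>\<phi> \<psi>. \<Sum>\<^sub>\<infinity>C\<in>lcosets\<^bsub>G\<^esub> K. cip V (\<phi> (coset_rep C)) (\<psi> (coset_rep C)))\<rparr>"

definition ind_rep :: "('g, 'k) monoid_scheme \<Rightarrow> 'g \<Rightarrow> ('g \<Rightarrow> 'v) \<Rightarrow> 'g \<Rightarrow> 'v" where
  "ind_rep G g \<phi> = (\<lambda>x\<in>carrier G. \<phi> (inv\<^bsub>G\<^esub> g \<otimes>\<^bsub>G\<^esub> x))"

section \<open>Pythagorean representations\<close>

fun Phi_tree :: "('h \<Rightarrow> 'h) \<Rightarrow> ('h \<Rightarrow> 'h) \<Rightarrow> btree \<Rightarrow> 'h \<Rightarrow> 'h list" where
  "Phi_tree A B Leaf x = [x]"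
| "Phi_tree A B (Node l r) x = Phi_tree A B l (A x) @ Phi_tree A B r (B x)"

text \<open>The lemmas \<open>Phi_elementary\<close> and \<open>Phi_fcomp\<close> below are the defining properties of \<open>\<Phi>\<close>.\<close>

definition Phi :: "('h \<Rightarrow> 'h) \<Rightarrow> ('h \<Rightarrow> 'h) \<Rightarrow> forest \<Rightarrow> 'h list \<Rightarrow> 'h list" where
  "Phi A B f \<xi> = concat (map2 (Phi_tree A B) f \<xi>)"

definition decorations :: "('h, 'm) cspace_scheme \<Rightarrow> (btree \<times> 'h list) set" where
  "decorations H = {(t, \<xi>). length \<xi> = leaves t \<and> set \<xi> \<subseteq> carrier H}"

definition limit_rel :: "('h, 'm) cspace_scheme \<Rightarrow> ('h \<Rightarrow> 'h) \<Rightarrow> ('h \<Rightarrow> 'h) \<Rightarrow>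
    ((btree \<times> 'h list) \<times> (btree \<times> 'h list)) set" where
  "limit_rel H A B = {((t, \<xi>), (s, \<eta>)). (t, \<xi>) \<in> decorations H \<and> (s, \<eta>) \<in> decorations H \<and>
     (\<exists>f g. length f = leaves t \<and> length g = leaves s \<and> graft f t = graft g s \<and>
        Phi A B f \<xi> = Phi A B g \<eta>)}"

definition pclass :: "('h, 'm) cspace_scheme \<Rightarrow> ('h \<Rightarrow> 'h) \<Rightarrow> ('h \<Rightarrow> 'h) \<Rightarrow> btree \<Rightarrow> 'h list \<Rightarrow>
    (btree \<times> 'h list) set" where
  "pclass H A B t \<xi> = limit_rel H A B `` {(t, \<xi>)}"

definition list_cip :: "('h, 'm) cspace_scheme \<Rightarrow> 'h list \<Rightarrow> 'h list \<Rightarrow> complex" where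
  "list_cip H \<xi> \<eta> = sum_list (map2 (cip H) \<xi> \<eta>)"

definition pyth_pre_space :: "('h, 'm) cspace_scheme \<Rightarrow> ('h \<Rightarrow> 'h) \<Rightarrow> ('h \<Rightarrow> 'h) \<Rightarrow>
    (btree \<times> 'h list) set cspace" where
  "pyth_pre_space H A B = \<lparr>
     carrier = decorations H // limit_rel H A B, mult = undefined, one = undefined,
     zero = pclass H A B Leaf [\<zero>\<^bsub>H\<^esub>],
     add = (\<lambda>X Y. THE Z. \<exists>t \<xi> \<eta>. (t, \<xi>) \<in> X \<and> (t, \<eta>) \<in> Y \<and>
       Z = pclass H A B t (map2 (\<lambda>x y. x \<oplus>\<^bsub>H\<^esub> y) \<xi> \<eta>)),
     smult = (\<lambda>c X. THE Z. \<exists>t \<xi>. (t, \<xi>) \<in> X \<and> Z = pclass H A B t (map (\<lambda>x. c \<odot>\<^bsub>H\<^esub> x) \<xi>)),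
     cip = (\<lambda>X Y. THE z. \<exists>t \<xi> \<eta>. (t, \<xi>) \<in> X \<and> (t, \<eta>) \<in> Y \<and> z = list_cip H \<xi> \<eta>)\<rparr>"

definition pyth_pre_rep :: "('h, 'm) cspace_scheme \<Rightarrow> ('h \<Rightarrow> 'h) \<Rightarrow> ('h \<Rightarrow> 'h) \<Rightarrow>
    (btree \<times> btree) set \<Rightarrow> (btree \<times> 'h list) set \<Rightarrow> (btree \<times> 'h list) set" where
  "pyth_pre_rep H A B g X = (THE Y. \<exists>t s \<xi>. (t, s) \<in> g \<and> (s, \<xi>) \<in> X \<and> Y = pclass H A B t \<xi>)"

definition pyth_space :: "('h, 'm) cspace_scheme \<Rightarrow> ('h \<Rightarrow> 'h) \<Rightarrow> ('h \<Rightarrow> 'h) \<Rightarrow>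
    (nat \<Rightarrow> (btree \<times> 'h list) set) set cspace" where
  "pyth_space H A B = completion (pyth_pre_space H A B)"

definition pyth_rep :: "('h, 'm) cspace_scheme \<Rightarrow> ('h \<Rightarrow> 'h) \<Rightarrow> ('h \<Rightarrow> 'h) \<Rightarrow> (btree \<times> btree) set \<Rightarrow>
    (nat \<Rightarrow> (btree \<times> 'h list) set) set \<Rightarrow> (nat \<Rightarrow> (btree \<times> 'h list) set) set" where
  "pyth_rep H A B g = completion_map (pyth_pre_space H A B) (pyth_pre_rep H A B g)"

lemma length_Phi_tree [simp]: "length (Phi_tree A B t x) = leaves t"
  by (induction t arbitrary: x) auto

lemma Phi_Cons [simp]: "Phi A B (t # f) (x # \<xi>) = Phi_tree A B t x @ Phi A B f \<xi>"
  by (simp add: Phi_def)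

lemma Phi_Nil [simp]: "Phi A B [] \<xi> = []" "Phi A B f [] = []"
  by (simp_all add: Phi_def)

lemma Phi_append: "length f = length \<xi> \<Longrightarrow> Phi A B (f @ g) (\<xi> @ \<eta>) = Phi A B f \<xi> @ Phi A B g \<eta>"
  by (simp add: Phi_def)

lemma length_Phi [simp]: "length f = length \<xi> \<Longrightarrow> length (Phi A B f \<xi>) = fleaves f"
  by (induction f \<xi> rule: list_induct2) auto

lemma Phi_trivial: "length \<xi> = n \<Longrightarrow> Phi A B (replicate n Leaf) \<xi> = \<xi>"
  by (induction \<xi> arbitrary: n) auto

lemma Phi_elementary:
  "length \<xi> = i \<Longrightarrow> length \<eta> = j \<Longrightarrow>
    Phi A B (replicate i Leaf @ [Node Leaf Leaf] @ replicate j Leaf) (\<xi> @ [x] @ \<eta>) = \<xi> @ [A x, B x] @ \<eta>"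
  by (simp add: Phi_append Phi_trivial)

lemma Phi_tree_graft: "length f = leaves t \<Longrightarrow> Phi_tree A B (graft f t) x = Phi A B f (Phi_tree A B t x)"
proof (induction t arbitrary: f x)
  case Leaf
  then show ?case by (cases f) auto
next
  case (Node l r)
  have "Phi A B f (Phi_tree A B (Node l r) x) =
      Phi A B (take (leaves l) f @ drop (leaves l) f) (Phi_tree A B l (A x) @ Phi_tree A B r (B x))" by simp
  also have "\<dots> = Phi A B (take (leaves l) f) (Phi_tree A B l (A x)) @ Phi A B (drop (leaves l) f) (Phi_tree A B r (B x))"
    by (rule Phi_append) (use Node.prems in simp)
  finally show ?case using Node by simp
qed

lemma Phi_fcomp:
  assumes "length g = length \<xi>" "length f = fleaves g"
  shows "Phi A B (fcomp f g) \<xi> = Phi A B f (Phi A B g \<xi>)"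
  using assms
proof (induction g \<xi> arbitrary: f rule: list_induct2)
  case Nil
  then show ?case by simp
next
  case (Cons t g x \<xi>)
  have "Phi A B f (Phi A B (t # g) (x # \<xi>)) =
      Phi A B (take (leaves t) f @ drop (leaves t) f) (Phi_tree A B t x @ Phi A B g \<xi>)" by simp
  also have "\<dots> = Phi A B (take (leaves t) f) (Phi_tree A B t x) @ Phi A B (drop (leaves t) f) (Phi A B g \<xi>)"
    by (rule Phi_append) (use Cons.prems in simp)
  finally show ?case using Cons by (simp add: Phi_tree_graft)
qed

text \<open>The last assumption is \<open>A\<^sup>*A + B\<^sup>*B = id\<close>; it entails that \<open>A\<close> and \<open>B\<close> are bounded.\<close>

locale pythagorean_pair = hilbert H for H :: "('h, 'm) cspace_scheme" (structure) +
  fixes A B :: "'h \<Rightarrow> 'h"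
  assumes A_closed [simp]: "x \<in> carrier H \<Longrightarrow> A x \<in> carrier H"
    and B_closed [simp]: "x \<in> carrier H \<Longrightarrow> B x \<in> carrier H"
    and A_add: "x \<in> carrier H \<Longrightarrow> y \<in> carrier H \<Longrightarrow> A (x \<oplus> y) = A x \<oplus> A y"
    and B_add: "x \<in> carrier H \<Longrightarrow> y \<in> carrier H \<Longrightarrow> B (x \<oplus> y) = B x \<oplus> B y"
    and A_smult: "x \<in> carrier H \<Longrightarrow> A (c \<odot> x) = c \<odot> A x"
    and B_smult: "x \<in> carrier H \<Longrightarrow> B (c \<odot> x) = c \<odot> B x"
    and pythagorean: "x \<in> carrier H \<Longrightarrow> y \<in> carrier H \<Longrightarrow>
      cip H (A x) (A y) + cip H (B x) (B y) = cip H x y"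
begin

abbreviation "P \<equiv> Phi A B"
abbreviation "cls \<equiv> pclass H A B"
abbreviation "V \<equiv> pyth_pre_space H A B"
abbreviation "vadd \<equiv> map2 (\<lambda>x y. x \<oplus> y)"

lemma zero_smult: "x \<in> carrier H \<Longrightarrow> 0 \<odot> x = \<zero>"
  using smult_l_null[of x] by simp

lemma Phi_tree_closed: "x \<in> carrier H \<Longrightarrow> set (Phi_tree A B t x) \<subseteq> carrier H"
  by (induction t arbitrary: x) auto

lemma Phi_closed: "length f = length \<xi> \<Longrightarrow> set \<xi> \<subseteq> carrier H \<Longrightarrow> set (P f \<xi>) \<subseteq> carrier H"
  by (induction f \<xi> rule: list_induct2) (use Phi_tree_closed in auto)

lemma Phi_tree_add: "x \<in> carrier H \<Longrightarrow> y \<in> carrier H \<Longrightarrow>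
    Phi_tree A B t (x \<oplus> y) = vadd (Phi_tree A B t x) (Phi_tree A B t y)"
  by (induction t arbitrary: x y) (simp_all add: A_add B_add)

lemma Phi_tree_smult: "x \<in> carrier H \<Longrightarrow>
    Phi_tree A B t (c \<odot> x) = map (\<lambda>x. c \<odot> x) (Phi_tree A B t x)"
  by (induction t arbitrary: x) (simp_all add: A_smult B_smult)

lemma list_cip_append: "length \<xi> = length \<xi>' \<Longrightarrow>
    list_cip H (\<xi> @ \<eta>) (\<xi>' @ \<eta>') = list_cip H \<xi> \<xi>' + list_cip H \<eta> \<eta>'"
  by (simp add: list_cip_def)

lemma list_cip_Cons [simp]: "list_cip H (x # \<xi>) (y # \<eta>) = cip H x y + list_cip H \<xi> \<eta>"
  by (simp add: list_cip_def)

lemma list_cip_Nil [simp]: "list_cip H [] \<eta> = 0"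
  by (simp add: list_cip_def)

lemma Phi_tree_cip: "x \<in> carrier H \<Longrightarrow> y \<in> carrier H \<Longrightarrow>
    list_cip H (Phi_tree A B t x) (Phi_tree A B t y) = cip H x y"
  by (induction t arbitrary: x y) (simp_all add: list_cip_append pythagorean)

lemma Phi_add: "length f = length \<xi> \<Longrightarrow> length \<xi> = length \<eta> \<Longrightarrow> set \<xi> \<subseteq> carrier H \<Longrightarrow> set \<eta> \<subseteq> carrier H \<Longrightarrow>
    P f (vadd \<xi> \<eta>) = vadd (P f \<xi>) (P f \<eta>)"
  by (induction f \<xi> \<eta> rule: list_induct3) (simp_all add: Phi_tree_add)

lemma Phi_smult: "length f = length \<xi> \<Longrightarrow> set \<xi> \<subseteq> carrier H \<Longrightarrow>
    P f (map (\<lambda>x. c \<odot> x) \<xi>) = map (\<lambda>x. c \<odot> x) (P f \<xi>)"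
  by (induction f \<xi> rule: list_induct2) (simp_all add: Phi_tree_smult)

lemma Phi_cip: "length f = length \<xi> \<Longrightarrow> length \<xi> = length \<eta> \<Longrightarrow> set \<xi> \<subseteq> carrier H \<Longrightarrow> set \<eta> \<subseteq> carrier H \<Longrightarrow>
    list_cip H (P f \<xi>) (P f \<eta>) = list_cip H \<xi> \<eta>"
  by (induction f \<xi> \<eta> rule: list_induct3) (simp_all add: list_cip_append Phi_tree_cip)

lemma AB_inj:
  assumes "x \<in> carrier H" "y \<in> carrier H" "A x = A y" "B x = B y"
  shows "x = y"
proof -
  have "cip H x x = cip H x y" "cip H y y = cip H x y"
    using pythagorean[of x x] pythagorean[of y y] pythagorean[of x y] assms by simp_all
  then have "(vdist H x y)\<^sup>2 = 0" using assms by (simp add: vdist_sq)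
  then show ?thesis using assms by (simp add: vdist_eq_0_iff)
qed

lemma Phi_tree_inj: "x \<in> carrier H \<Longrightarrow> y \<in> carrier H \<Longrightarrow> Phi_tree A B t x = Phi_tree A B t y \<Longrightarrow> x = y"
proof (induction t arbitrary: x y)
  case Leaf
  then show ?case by simp
next
  case (Node l r)
  have "A x = A y" "B x = B y" using Node.IH[of "A x" "A y"] Node.IH(2)[of "B x" "B y"] Node.prems by simp_all
  then show ?case using AB_inj Node.prems by blast
qed

lemma Phi_inj: "length f = length \<xi> \<Longrightarrow> length \<xi> = length \<eta> \<Longrightarrow> set \<xi> \<subseteq> carrier H \<Longrightarrow> set \<eta> \<subseteq> carrier H \<Longrightarrow>
    P f \<xi> = P f \<eta> \<Longrightarrow> \<xi> = \<eta>"
  by (induction f \<xi> \<eta> rule: list_induct3) (auto dest: Phi_tree_inj)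

lemma decorations_iff: "(t, \<xi>) \<in> decorations H \<longleftrightarrow> length \<xi> = leaves t \<and> set \<xi> \<subseteq> carrier H"
  by (simp add: decorations_def)

lemma decorations_graft:
  "(t, \<xi>) \<in> decorations H \<Longrightarrow> length f = leaves t \<Longrightarrow> (graft f t, P f \<xi>) \<in> decorations H"
  using Phi_closed[of f \<xi>] by (simp add: decorations_iff leaves_graft)

lemma equiv_limit_rel: "equiv (decorations H) (limit_rel H A B)"
proof (intro equivI)
  show "limit_rel H A B \<subseteq> decorations H \<times> decorations H" by (auto simp: limit_rel_def)
  show "refl_on (decorations H) (limit_rel H A B)"
  proof (rule refl_onI)
    fix p assume p: "p \<in> decorations H"
    obtain t \<xi> where t: "p = (t, \<xi>)" by (cases p)
    have "length (replicate (leaves t) Leaf) = leaves t" by simp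
    then show "(p, p) \<in> limit_rel H A B" using p unfolding t limit_rel_def by blast
  qed
  show "sym (limit_rel H A B)"
  proof (rule symI)
    fix p q assume "(p, q) \<in> limit_rel H A B"
    then obtain t \<xi> s \<eta> f g where *: "p = (t, \<xi>)" "q = (s, \<eta>)" "(t, \<xi>) \<in> decorations H" "(s, \<eta>) \<in> decorations H"
      "length f = leaves t" "length g = leaves s" "graft g s = graft f t" "P g \<eta> = P f \<xi>"
      unfolding limit_rel_def by auto
    show "(q, p) \<in> limit_rel H A B" unfolding *(1,2) limit_rel_def using *(3-) by blast
  qed
  show "trans (limit_rel H A B)"
  proof (rule transI)
    fix p q r assume 1: "(p, q) \<in> limit_rel H A B" and 2: "(q, r) \<in> limit_rel H A B"
    obtain t \<xi> s \<eta> f g where a: "p = (t, \<xi>)" "q = (s, \<eta>)" "(t, \<xi>) \<in> decorations H" "(s, \<eta>) \<in> decorations H"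
      "length f = leaves t" "length g = leaves s" "graft f t = graft g s" "P f \<xi> = P g \<eta>"
      using 1 unfolding limit_rel_def by auto
    obtain u \<zeta> f' g' where b: "r = (u, \<zeta>)" "(u, \<zeta>) \<in> decorations H"
      "length f' = leaves s" "length g' = leaves u" "graft f' s = graft g' u" "P f' \<eta> = P g' \<zeta>"
      using 2 a(2) unfolding limit_rel_def by auto
    obtain h h' where h: "length h = leaves (graft g s)" "length h' = leaves (graft f' s)"
      "graft h (graft g s) = graft h' (graft f' s)" by (rule common_refinement)
    have hl: "length h = fleaves g" "length h' = fleaves f'"
      using h(1,2) leaves_graft[OF a(6)] leaves_graft[OF b(3)] by simp_all
    have hl': "length h = fleaves f" "length h' = fleaves g'"
      using h(1,2) leaves_graft[OF a(5)] leaves_graft[OF b(4)] a(7) b(5) by simp_all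
    have eq: "fcomp h g = fcomp h' f'"
    proof (rule graft_inj[of _ s])
      show "graft (fcomp h g) s = graft (fcomp h' f') s"
        using h(3) graft_graft[OF a(6) hl(1)] graft_graft[OF b(3) hl(2)] by simp
    qed (use a(6) b(3) in simp_all)
    have "graft (fcomp h f) t = graft (fcomp h' g') u"
      using graft_graft[OF a(5) hl'(1)] graft_graft[OF b(4) hl'(2)] h(3) a(7) b(5) by simp
    moreover have "P (fcomp h f) \<xi> = P (fcomp h' g') \<zeta>"
    proof -
      have l: "length f = length \<xi>" "length g = length \<eta>" "length f' = length \<eta>" "length g' = length \<zeta>"
        using a(3-6) b(2-4) by (simp_all add: decorations_iff)
      have "P (fcomp h f) \<xi> = P h (P g \<eta>)" using Phi_fcomp[OF l(1) hl'(1)] a(8) by simp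
      also have "\<dots> = P (fcomp h' f') \<eta>" using Phi_fcomp[OF l(2) hl(1)] eq by simp
      also have "\<dots> = P h' (P g' \<zeta>)" using Phi_fcomp[OF l(3) hl(2)] b(6) by simp
      also have "\<dots> = P (fcomp h' g') \<zeta>" using Phi_fcomp[OF l(4) hl'(2)] by simp
      finally show ?thesis .
    qed
    moreover have "length (fcomp h f) = leaves t" "length (fcomp h' g') = leaves u"
      using a(5) b(4) by simp_all
    ultimately show "(p, r) \<in> limit_rel H A B" unfolding a(1) b(1) limit_rel_def using a(3) b(2) by blast
  qed
qed

lemma cls_graft:
  assumes "(t, \<xi>) \<in> decorations H" "length f = leaves t"
  shows "cls (graft f t) (P f \<xi>) = cls t \<xi>"
  unfolding pclass_def
proof (rule equiv_class_eq[OF equiv_limit_rel])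
  have d: "(graft f t, P f \<xi>) \<in> decorations H" using assms by (rule decorations_graft)
  let ?g = "replicate (fleaves f) Leaf"
  have "length ?g = leaves (graft f t)" "graft ?g (graft f t) = graft f t"
    using assms(2) by (simp_all add: leaves_graft graft_trivial')
  moreover have "P ?g (P f \<xi>) = P f \<xi>"
    by (rule Phi_trivial) (use assms in \<open>simp add: decorations_iff\<close>)
  ultimately show "((graft f t, P f \<xi>), t, \<xi>) \<in> limit_rel H A B"
    unfolding limit_rel_def using d assms by blast
qed

lemma cls_inj:
  assumes "(t, \<xi>) \<in> decorations H" "(t, \<eta>) \<in> decorations H" "cls t \<xi> = cls t \<eta>"
  shows "\<xi> = \<eta>"
proof -
  have "((t, \<xi>), (t, \<eta>)) \<in> limit_rel H A B"
    using assms eq_equiv_class_iff[OF equiv_limit_rel assms(1,2)] by (simp add: pclass_def)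
  then obtain f g where f: "length f = leaves t" "length g = leaves t" "graft f t = graft g t" "P f \<xi> = P g \<eta>"
    by (auto simp: limit_rel_def)
  have "f = g" using f(1-3) by (rule graft_inj)
  then show ?thesis using Phi_inj[of f \<xi> \<eta>] f assms by (simp add: decorations_iff)
qed

lemma mem_cls_iff:
  assumes "(t, \<xi>) \<in> decorations H"
  shows "(s, \<eta>) \<in> cls t \<xi> \<longleftrightarrow> (s, \<eta>) \<in> decorations H \<and> cls s \<eta> = cls t \<xi>"
proof
  assume "(s, \<eta>) \<in> cls t \<xi>"
  then have r: "((t, \<xi>), (s, \<eta>)) \<in> limit_rel H A B" by (simp add: pclass_def)
  then show "(s, \<eta>) \<in> decorations H \<and> cls s \<eta> = cls t \<xi>"
    unfolding pclass_def using equiv_class_eq[OF equiv_limit_rel r] equiv_limit_rel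
    by (auto simp: limit_rel_def)
next
  assume "(s, \<eta>) \<in> decorations H \<and> cls s \<eta> = cls t \<xi>"
  then have "((s, \<eta>), (t, \<xi>)) \<in> limit_rel H A B"
    using assms eq_equiv_class_iff[OF equiv_limit_rel, of "(s, \<eta>)" "(t, \<xi>)"] by (simp add: pclass_def)
  then show "(s, \<eta>) \<in> cls t \<xi>"
    unfolding pclass_def using equiv_limit_rel by (auto simp: equiv_def dest: symD)
qed

lemma cls_closed [simp]: "(t, \<xi>) \<in> decorations H \<Longrightarrow> cls t \<xi> \<in> carrier V"
  by (auto simp: pyth_pre_space_def pclass_def intro: quotientI)

lemma pre_space_cases:
  assumes "X \<in> carrier V"
  obtains t \<xi> where "(t, \<xi>) \<in> decorations H" "X = cls t \<xi>"
proof -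
  obtain p where "p \<in> decorations H" "X = limit_rel H A B `` {p}"
    using assms by (auto simp: pyth_pre_space_def elim!: quotientE)
  then show ?thesis using that by (cases p) (auto simp: pclass_def)
qed

lemma pre_space_refine:
  assumes "X \<in> carrier V"
  obtains f \<xi> where "length f = leaves t" "(graft f t, \<xi>) \<in> decorations H" "X = cls (graft f t) \<xi>"
proof -
  obtain s \<eta> where s: "(s, \<eta>) \<in> decorations H" "X = cls s \<eta>" using assms by (rule pre_space_cases)
  obtain f g where f: "length f = leaves t" "length g = leaves s" "graft f t = graft g s"
    by (rule common_refinement)
  show ?thesis
  proof (rule that[of f "P g \<eta>"])
    show "(graft f t, P g \<eta>) \<in> decorations H" unfolding f(3) by (rule decorations_graft[OF s(1) f(2)])
    show "X = cls (graft f t) (P g \<eta>)" unfolding f(3) s(2) by (rule cls_graft[OF s(1) f(2), symmetric])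
  qed (rule f)
qed

lemma pre_space_cases2:
  assumes "X \<in> carrier V" "Y \<in> carrier V"
  obtains t \<xi> \<eta> where "(t, \<xi>) \<in> decorations H" "(t, \<eta>) \<in> decorations H" "X = cls t \<xi>" "Y = cls t \<eta>"
proof -
  obtain t \<xi> where t: "(t, \<xi>) \<in> decorations H" "X = cls t \<xi>" using assms(1) by (rule pre_space_cases)
  obtain f \<eta> where f: "length f = leaves t" "(graft f t, \<eta>) \<in> decorations H" "Y = cls (graft f t) \<eta>"
    using assms(2) by (rule pre_space_refine)
  show ?thesis
    by (rule that[OF decorations_graft[OF t(1) f(1)] f(2) _ f(3)]) (simp add: t(2) cls_graft[OF t(1) f(1)])
qed

lemma pre_space_cases3:
  assumes "X \<in> carrier V" "Y \<in> carrier V" "Z \<in> carrier V"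
  obtains t \<xi> \<eta> \<zeta> where "(t, \<xi>) \<in> decorations H" "(t, \<eta>) \<in> decorations H" "(t, \<zeta>) \<in> decorations H"
    "X = cls t \<xi>" "Y = cls t \<eta>" "Z = cls t \<zeta>"
proof -
  obtain t \<xi> \<eta> where t: "(t, \<xi>) \<in> decorations H" "(t, \<eta>) \<in> decorations H" "X = cls t \<xi>" "Y = cls t \<eta>"
    using assms(1,2) by (rule pre_space_cases2)
  obtain f \<zeta> where f: "length f = leaves t" "(graft f t, \<zeta>) \<in> decorations H" "Z = cls (graft f t) \<zeta>"
    using assms(3) by (rule pre_space_refine)
  show ?thesis
    by (rule that[OF decorations_graft[OF t(1) f(1)] decorations_graft[OF t(2) f(1)] f(2) _ _ f(3)])
      (simp_all add: t(3,4) cls_graft[OF t(1) f(1)] cls_graft[OF t(2) f(1)])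
qed

lemma same_refinement:
  assumes "(t, \<xi>) \<in> decorations H" "(s, \<xi>') \<in> decorations H" "cls s \<xi>' = cls t \<xi>"
    "length f = leaves t" "length g = leaves s" "graft f t = graft g s"
  shows "P f \<xi> = P g \<xi>'"
proof (rule cls_inj[of "graft f t"])
  show "(graft f t, P f \<xi>) \<in> decorations H" by (rule decorations_graft[OF assms(1,4)])
  show "(graft f t, P g \<xi>') \<in> decorations H" unfolding assms(6) by (rule decorations_graft[OF assms(2,5)])
  have "cls (graft f t) (P f \<xi>) = cls t \<xi>" by (rule cls_graft[OF assms(1,4)])
  also have "\<dots> = cls (graft g s) (P g \<xi>')" by (simp add: cls_graft[OF assms(2,5)] assms(3))
  finally show "cls (graft f t) (P f \<xi>) = cls (graft f t) (P g \<xi>')" unfolding assms(6) .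
qed

lemma vadd_decorations: "(t, \<xi>) \<in> decorations H \<Longrightarrow> (t, \<eta>) \<in> decorations H \<Longrightarrow> (t, vadd \<xi> \<eta>) \<in> decorations H"
  by (auto simp: decorations_iff dest: set_zip_leftD set_zip_rightD)

lemma smult_decorations: "(t, \<xi>) \<in> decorations H \<Longrightarrow> (t, map (\<lambda>x. c \<odot> x) \<xi>) \<in> decorations H"
  by (auto simp: decorations_iff)

lemma pre_add:
  assumes d: "(t, \<xi>) \<in> decorations H" "(t, \<eta>) \<in> decorations H"
  shows "cls t \<xi> \<oplus>\<^bsub>V\<^esub> cls t \<eta> = cls t (vadd \<xi> \<eta>)"
  unfolding pyth_pre_space_def module.select_convs ring.select_convs
proof (rule the_equality)
  have "(t, \<xi>) \<in> cls t \<xi> \<and> (t, \<eta>) \<in> cls t \<eta> \<and> cls t (vadd \<xi> \<eta>) = cls t (vadd \<xi> \<eta>)"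
    using d by (simp add: mem_cls_iff)
  then show "\<exists>s \<xi>' \<eta>'. (s, \<xi>') \<in> cls t \<xi> \<and> (s, \<eta>') \<in> cls t \<eta> \<and> cls t (vadd \<xi> \<eta>) = cls s (vadd \<xi>' \<eta>')"
    by - ((rule exI)+, assumption)
next
  fix Z assume "\<exists>s \<xi>' \<eta>'. (s, \<xi>') \<in> cls t \<xi> \<and> (s, \<eta>') \<in> cls t \<eta> \<and> Z = cls s (vadd \<xi>' \<eta>')"
  then obtain s \<xi>' \<eta>' where s: "(s, \<xi>') \<in> decorations H" "(s, \<eta>') \<in> decorations H"
    "cls s \<xi>' = cls t \<xi>" "cls s \<eta>' = cls t \<eta>" "Z = cls s (vadd \<xi>' \<eta>')"
    using d by (auto simp: mem_cls_iff)
  obtain f g where f: "length f = leaves t" "length g = leaves s" "graft f t = graft g s"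
    by (rule common_refinement)
  have e: "P f \<xi> = P g \<xi>'" "P f \<eta> = P g \<eta>'"
    by (rule same_refinement[OF d(1) s(1,3) f] same_refinement[OF d(2) s(2,4) f])+
  have "Z = cls (graft g s) (P g (vadd \<xi>' \<eta>'))"
    unfolding s(5) by (rule cls_graft[OF vadd_decorations[OF s(1,2)] f(2), symmetric])
  also have "P g (vadd \<xi>' \<eta>') = vadd (P g \<xi>') (P g \<eta>')"
    by (rule Phi_add) (use s f in \<open>simp_all add: decorations_iff\<close>)
  also have "\<dots> = P f (vadd \<xi> \<eta>)"
    unfolding e[symmetric] by (rule Phi_add[symmetric]) (use d f in \<open>simp_all add: decorations_iff\<close>)
  also have "cls (graft g s) (P f (vadd \<xi> \<eta>)) = cls t (vadd \<xi> \<eta>)"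
    unfolding f(3)[symmetric] by (rule cls_graft[OF vadd_decorations[OF d] f(1)])
  finally show "Z = cls t (vadd \<xi> \<eta>)" .
qed

lemma pre_smult:
  assumes d: "(t, \<xi>) \<in> decorations H"
  shows "c \<odot>\<^bsub>V\<^esub> cls t \<xi> = cls t (map (\<lambda>x. c \<odot> x) \<xi>)"
  unfolding pyth_pre_space_def module.select_convs ring.select_convs
proof (rule the_equality)
  have "(t, \<xi>) \<in> cls t \<xi> \<and> cls t (map (\<lambda>x. c \<odot> x) \<xi>) = cls t (map (\<lambda>x. c \<odot> x) \<xi>)"
    using d by (simp add: mem_cls_iff)
  then show "\<exists>s \<xi>'. (s, \<xi>') \<in> cls t \<xi> \<and> cls t (map (\<lambda>x. c \<odot> x) \<xi>) = cls s (map (\<lambda>x. c \<odot> x) \<xi>')"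
    by - ((rule exI)+, assumption)
next
  fix Z assume "\<exists>s \<xi>'. (s, \<xi>') \<in> cls t \<xi> \<and> Z = cls s (map (\<lambda>x. c \<odot> x) \<xi>')"
  then obtain s \<xi>' where s: "(s, \<xi>') \<in> decorations H" "cls s \<xi>' = cls t \<xi>" "Z = cls s (map (\<lambda>x. c \<odot> x) \<xi>')"
    using d by (auto simp: mem_cls_iff)
  obtain f g where f: "length f = leaves t" "length g = leaves s" "graft f t = graft g s"
    by (rule common_refinement)
  have e: "P f \<xi> = P g \<xi>'" by (rule same_refinement[OF d s(1,2) f])
  have "Z = cls (graft g s) (P g (map (\<lambda>x. c \<odot> x) \<xi>'))"
    unfolding s(3) by (rule cls_graft[OF smult_decorations[OF s(1)] f(2), symmetric])
  also have "P g (map (\<lambda>x. c \<odot> x) \<xi>') = map (\<lambda>x. c \<odot> x) (P g \<xi>')"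
    by (rule Phi_smult) (use s f in \<open>simp_all add: decorations_iff\<close>)
  also have "\<dots> = P f (map (\<lambda>x. c \<odot> x) \<xi>)"
    unfolding e[symmetric] by (rule Phi_smult[symmetric]) (use d f in \<open>simp_all add: decorations_iff\<close>)
  also have "cls (graft g s) (P f (map (\<lambda>x. c \<odot> x) \<xi>)) = cls t (map (\<lambda>x. c \<odot> x) \<xi>)"
    unfolding f(3)[symmetric] by (rule cls_graft[OF smult_decorations[OF d] f(1)])
  finally show "Z = cls t (map (\<lambda>x. c \<odot> x) \<xi>)" .
qed

lemma pre_cip:
  assumes d: "(t, \<xi>) \<in> decorations H" "(t, \<eta>) \<in> decorations H"
  shows "cip V (cls t \<xi>) (cls t \<eta>) = list_cip H \<xi> \<eta>"
  unfolding pyth_pre_space_def cspace.select_convs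
proof (rule the_equality)
  have "(t, \<xi>) \<in> cls t \<xi> \<and> (t, \<eta>) \<in> cls t \<eta> \<and> list_cip H \<xi> \<eta> = list_cip H \<xi> \<eta>"
    using d by (simp add: mem_cls_iff)
  then show "\<exists>s \<xi>' \<eta>'. (s, \<xi>') \<in> cls t \<xi> \<and> (s, \<eta>') \<in> cls t \<eta> \<and> list_cip H \<xi> \<eta> = list_cip H \<xi>' \<eta>'"
    by - ((rule exI)+, assumption)
next
  fix z assume "\<exists>s \<xi>' \<eta>'. (s, \<xi>') \<in> cls t \<xi> \<and> (s, \<eta>') \<in> cls t \<eta> \<and> z = list_cip H \<xi>' \<eta>'"
  then obtain s \<xi>' \<eta>' where s: "(s, \<xi>') \<in> decorations H" "(s, \<eta>') \<in> decorations H"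
    "cls s \<xi>' = cls t \<xi>" "cls s \<eta>' = cls t \<eta>" "z = list_cip H \<xi>' \<eta>'"
    using d by (auto simp: mem_cls_iff)
  obtain f g where f: "length f = leaves t" "length g = leaves s" "graft f t = graft g s"
    by (rule common_refinement)
  have e: "P f \<xi> = P g \<xi>'" "P f \<eta> = P g \<eta>'"
    by (rule same_refinement[OF d(1) s(1,3) f] same_refinement[OF d(2) s(2,4) f])+
  have "z = list_cip H (P g \<xi>') (P g \<eta>')"
    unfolding s(5) by (rule Phi_cip[symmetric]) (use s f in \<open>simp_all add: decorations_iff\<close>)
  also have "\<dots> = list_cip H \<xi> \<eta>"
    unfolding e[symmetric] by (rule Phi_cip) (use d f in \<open>simp_all add: decorations_iff\<close>)
  finally show "z = list_cip H \<xi> \<eta>" .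
qed

lemma Phi_tree_zero: "Phi_tree A B t \<zero> = replicate (leaves t) \<zero>"
proof -
  have "A \<zero> = \<zero>" "B \<zero> = \<zero>"
    using A_smult[of \<zero> 0] B_smult[of \<zero> 0] by (simp_all add: zero_smult)
  then show ?thesis by (induction t) (simp_all add: replicate_add)
qed

lemma pre_zero: "cls t (replicate (leaves t) \<zero>) = \<zero>\<^bsub>V\<^esub>"
proof -
  have "cls (graft [t] Leaf) (P [t] [\<zero>]) = cls Leaf [\<zero>]"
    by (rule cls_graft) (simp_all add: decorations_iff)
  then show ?thesis by (simp add: Phi_tree_zero pyth_pre_space_def)
qed

lemma zero_decorations [simp]: "(t, replicate (leaves t) \<zero>) \<in> decorations H"
  by (auto simp: decorations_iff)

lemma list_cip_nonneg: "set \<xi> \<subseteq> carrier H \<Longrightarrow> 0 \<le> Re (list_cip H \<xi> \<xi>)"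
  by (induction \<xi>) auto

lemma list_cip_pos: "set \<xi> \<subseteq> carrier H \<Longrightarrow> \<xi> \<noteq> replicate (length \<xi>) \<zero> \<Longrightarrow> 0 < Re (list_cip H \<xi> \<xi>)"
proof (induction \<xi>)
  case Nil
  then show ?case by simp
next
  case (Cons x \<xi>)
  show ?case
  proof (cases "x = \<zero>")
    case True
    then show ?thesis using Cons by simp
  next
    case False
    then show ?thesis using Cons.prems cip_pos[of x] list_cip_nonneg[of \<xi>] by simp
  qed
qed

lemma list_cip_commute: "length \<xi> = length \<eta> \<Longrightarrow> set \<xi> \<subseteq> carrier H \<Longrightarrow> set \<eta> \<subseteq> carrier H \<Longrightarrow>
    list_cip H \<xi> \<eta> = cnj (list_cip H \<eta> \<xi>)"
proof (induction \<xi> \<eta> rule: list_induct2)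
  case (Cons x \<xi> y \<eta>)
  then show ?case using cip_commute[of x y] by simp
qed simp

lemma list_cip_add: "length \<xi> = length \<eta> \<Longrightarrow> length \<eta> = length \<zeta> \<Longrightarrow> set \<xi> \<subseteq> carrier H \<Longrightarrow> set \<eta> \<subseteq> carrier H \<Longrightarrow>
    set \<zeta> \<subseteq> carrier H \<Longrightarrow> list_cip H (vadd \<xi> \<eta>) \<zeta> = list_cip H \<xi> \<zeta> + list_cip H \<eta> \<zeta>"
  by (induction \<xi> \<eta> \<zeta> rule: list_induct3) (simp_all add: cip_add_left)

lemma list_cip_smult: "length \<xi> = length \<eta> \<Longrightarrow> set \<xi> \<subseteq> carrier H \<Longrightarrow> set \<eta> \<subseteq> carrier H \<Longrightarrow>
    list_cip H (map (\<lambda>x. c \<odot> x) \<xi>) \<eta> = c * list_cip H \<xi> \<eta>"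
  by (induction \<xi> \<eta> rule: list_induct2) (simp_all add: cip_smult_left distrib_left)

lemma nth_decorations: "(t, \<xi>) \<in> decorations H \<Longrightarrow> i < leaves t \<Longrightarrow> \<xi> ! i \<in> carrier H"
  by (metis decorations_iff nth_mem subsetD)

lemma length_decorations: "(t, \<xi>) \<in> decorations H \<Longrightarrow> length \<xi> = leaves t"
  by (simp add: decorations_iff)

lemma set_decorations: "(t, \<xi>) \<in> decorations H \<Longrightarrow> set \<xi> \<subseteq> carrier H"
  by (simp add: decorations_iff)

lemma pre_hilbert_pyth_pre_space: "pre_hilbert V"
proof (rule pre_hilbertI)
  show "\<zero>\<^bsub>V\<^esub> \<in> carrier V" unfolding pre_zero[of Leaf, symmetric] by (rule cls_closed[OF zero_decorations])
  note simps = pre_add pre_smult vadd_decorations smult_decorations length_decorations nth_decorations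
  fix X assume X: "X \<in> carrier V"
  obtain t \<xi> where t: "(t, \<xi>) \<in> decorations H" and Xt: "X = cls t \<xi>" using X by (rule pre_space_cases)
  have "vadd (replicate (leaves t) \<zero>) \<xi> = \<xi>"
    using t by (intro nth_equalityI) (simp_all add: simps)
  then show "\<zero>\<^bsub>V\<^esub> \<oplus>\<^bsub>V\<^esub> X = X" unfolding Xt pre_zero[of t, symmetric] using t by (simp add: simps)
  show "c \<odot>\<^bsub>V\<^esub> X \<in> carrier V" for c unfolding Xt using t by (simp add: simps)
  have "map (\<lambda>x. (c + d) \<odot> x) \<xi> = vadd (map (\<lambda>x. c \<odot> x) \<xi>) (map (\<lambda>x. d \<odot> x) \<xi>)" for c d
    using t smult_l_distr[of c d] by (intro nth_equalityI) (simp_all add: simps)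
  then show "(c + d) \<odot>\<^bsub>V\<^esub> X = c \<odot>\<^bsub>V\<^esub> X \<oplus>\<^bsub>V\<^esub> d \<odot>\<^bsub>V\<^esub> X" for c d
    unfolding Xt using t by (simp add: simps)
  have "map (\<lambda>x. (c * d) \<odot> x) \<xi> = map (\<lambda>x. c \<odot> x) (map (\<lambda>x. d \<odot> x) \<xi>)" for c d
    using t smult_assoc1[of c d] by (intro nth_equalityI) (simp_all add: simps)
  then show "(c * d) \<odot>\<^bsub>V\<^esub> X = c \<odot>\<^bsub>V\<^esub> (d \<odot>\<^bsub>V\<^esub> X)" for c d
    unfolding Xt using t by (simp add: simps del: map_map)
  have "map (\<lambda>x. 1 \<odot> x) \<xi> = \<xi>"
    using t smult_one by (intro nth_equalityI) (simp_all add: simps)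
  then show "1 \<odot>\<^bsub>V\<^esub> X = X" unfolding Xt using t by (simp add: simps)
  have "map (\<lambda>x. 0 \<odot> x) \<xi> = replicate (leaves t) \<zero>"
    using t by (intro nth_equalityI) (simp_all add: simps zero_smult)
  then show "0 \<odot>\<^bsub>V\<^esub> X = \<zero>\<^bsub>V\<^esub>" unfolding Xt using t by (simp add: simps pre_zero)
  show "0 < Re (cip V X X)" if "X \<noteq> \<zero>\<^bsub>V\<^esub>"
    using that t list_cip_pos[of \<xi>] pre_zero[of t] unfolding Xt
    by (auto simp: pre_cip length_decorations dest: set_decorations)
  fix Y assume Y: "Y \<in> carrier V"
  obtain u \<xi>' \<eta> where u: "(u, \<xi>') \<in> decorations H" "(u, \<eta>) \<in> decorations H"
    and XY: "X = cls u \<xi>'" "Y = cls u \<eta>" using X Y by (rule pre_space_cases2)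
  show "X \<oplus>\<^bsub>V\<^esub> Y \<in> carrier V" unfolding XY using u by (simp add: simps)
  have "vadd \<xi>' \<eta> = vadd \<eta> \<xi>'"
    using u by (intro nth_equalityI) (simp_all add: simps a_comm)
  then show "X \<oplus>\<^bsub>V\<^esub> Y = Y \<oplus>\<^bsub>V\<^esub> X" unfolding XY using u by (simp add: simps)
  have "map (\<lambda>x. c \<odot> x) (vadd \<xi>' \<eta>) = vadd (map (\<lambda>x. c \<odot> x) \<xi>') (map (\<lambda>x. c \<odot> x) \<eta>)" for c
    using u smult_r_distr[of c] by (intro nth_equalityI) (simp_all add: simps)
  then show "c \<odot>\<^bsub>V\<^esub> (X \<oplus>\<^bsub>V\<^esub> Y) = c \<odot>\<^bsub>V\<^esub> X \<oplus>\<^bsub>V\<^esub> c \<odot>\<^bsub>V\<^esub> Y" for c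
    unfolding XY using u by (simp add: simps del: map_map)
  show "cip V X Y = cnj (cip V Y X)"
    unfolding XY pre_cip[OF u] pre_cip[OF u(2,1)]
    by (rule list_cip_commute) (use u in \<open>simp_all add: decorations_iff\<close>)
  show "cip V (c \<odot>\<^bsub>V\<^esub> X) Y = c * cip V X Y" for c
    unfolding XY pre_cip[OF u] pre_smult[OF u(1)] pre_cip[OF smult_decorations[OF u(1)] u(2)]
    by (rule list_cip_smult) (use u in \<open>simp_all add: decorations_iff\<close>)
  fix Z assume Z: "Z \<in> carrier V"
  obtain w \<alpha> \<beta> \<gamma> where w: "(w, \<alpha>) \<in> decorations H" "(w, \<beta>) \<in> decorations H" "(w, \<gamma>) \<in> decorations H"
    and XYZ: "X = cls w \<alpha>" "Y = cls w \<beta>" "Z = cls w \<gamma>" using X Y Z by (rule pre_space_cases3)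
  have "vadd (vadd \<alpha> \<beta>) \<gamma> = vadd \<alpha> (vadd \<beta> \<gamma>)"
    using w by (intro nth_equalityI) (simp_all add: simps a_assoc)
  then show "X \<oplus>\<^bsub>V\<^esub> Y \<oplus>\<^bsub>V\<^esub> Z = X \<oplus>\<^bsub>V\<^esub> (Y \<oplus>\<^bsub>V\<^esub> Z)" unfolding XYZ using w by (simp add: simps)
  show "cip V (X \<oplus>\<^bsub>V\<^esub> Y) Z = cip V X Z + cip V Y Z"
    unfolding XYZ pre_add[OF w(1,2)] pre_cip[OF vadd_decorations[OF w(1,2)] w(3)] pre_cip[OF w(1,3)] pre_cip[OF w(2,3)]
    by (rule list_cip_add) (use w in \<open>simp_all add: decorations_iff\<close>)
qed

lemma hilbert_pyth_space: "hilbert (pyth_space H A B)"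
  unfolding pyth_space_def by (rule pre_hilbert.hilbert_completion[OF pre_hilbert_pyth_pre_space])

lemma pyth_pre_rep:
  assumes l: "leaves t = leaves s" and d: "(s, \<xi>) \<in> decorations H"
  shows "pyth_pre_rep H A B (F_class (t, s)) (cls s \<xi>) = cls t \<xi>"
  unfolding pyth_pre_rep_def
proof (rule the_equality)
  have "(t, s) \<in> F_class (t, s) \<and> (s, \<xi>) \<in> cls s \<xi> \<and> cls t \<xi> = cls t \<xi>"
    using l d by (simp add: mem_cls_iff in_F_class_iff)
  then show "\<exists>t' s' \<xi>'. (t', s') \<in> F_class (t, s) \<and> (s', \<xi>') \<in> cls s \<xi> \<and> cls t \<xi> = cls t' \<xi>'"
    by - ((rule exI)+, assumption)
next
  fix Y assume "\<exists>t' s' \<xi>'. (t', s') \<in> F_class (t, s) \<and> (s', \<xi>') \<in> cls s \<xi> \<and> Y = cls t' \<xi>'"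
  then obtain t' s' \<xi>' where *: "leaves t' = leaves s'" "F_class (t', s') = F_class (t, s)"
    "(s', \<xi>') \<in> decorations H" "cls s' \<xi>' = cls s \<xi>" "Y = cls t' \<xi>'"
    using l d by (auto simp: mem_cls_iff in_F_class_iff)
  obtain f g where f: "length f = leaves s" "length g = leaves s'" "graft f s = graft g s'"
    by (rule common_refinement)
  have e: "P f \<xi> = P g \<xi>'" by (rule same_refinement[OF d *(3,4) f])
  have "F_class (graft f t, graft f s) = F_class (graft g t', graft f s)"
    using F_class_graft[of t s f] F_class_graft[of t' s' g] l f *(1,2) by simp
  moreover have "leaves (graft f t) = leaves (graft f s)" "leaves (graft g t') = leaves (graft f s)"
    using l f(1) leaves_graft[of f t] leaves_graft[of f s] apply simp
    unfolding f(3) using f(2) *(1) leaves_graft[of g t'] leaves_graft[of g s'] by simp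
  ultimately have ft: "graft f t = graft g t'" using F_class_snd_inj by blast
  have dt: "(t, \<xi>) \<in> decorations H" "(t', \<xi>') \<in> decorations H"
    using d l *(1,3) by (simp_all add: decorations_iff)
  have "Y = cls (graft g t') (P g \<xi>')"
    unfolding *(5) by (rule cls_graft[symmetric]) (use dt f *(1) in simp_all)
  also have "\<dots> = cls (graft f t) (P f \<xi>)" by (simp only: ft e)
  also have "\<dots> = cls t \<xi>" by (rule cls_graft) (use dt f l in simp_all)
  finally show "Y = cls t \<xi>" .
qed

lemma pre_rep_cases:
  assumes "g \<in> carrier thompson_F" "X \<in> carrier V"
  obtains t s \<xi> where "leaves t = leaves s" "(s, \<xi>) \<in> decorations H" "(t, \<xi>) \<in> decorations H"
    "g = F_class (t, s)" "X = cls s \<xi>"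
proof -
  obtain s \<xi> where s: "(s, \<xi>) \<in> decorations H" "X = cls s \<xi>" using assms(2) by (rule pre_space_cases)
  obtain t u where t: "leaves t = leaves u" "g = F_class (t, u)" using assms(1) by (rule F_carrier_cases)
  obtain f h where f: "length f = leaves s" "length h = leaves u" "graft f s = graft h u"
    by (rule common_refinement)
  have l: "leaves (graft h t) = leaves (graft f s)"
    unfolding f(3) using leaves_graft[of h t] leaves_graft[of h u] t(1) f(2) by simp
  have d: "(graft f s, P f \<xi>) \<in> decorations H" by (rule decorations_graft[OF s(1) f(1)])
  show ?thesis
  proof (rule that[OF l d])
    show "(graft h t, P f \<xi>) \<in> decorations H" using d l by (simp add: decorations_iff)
    show "g = F_class (graft h t, graft f s)"
      unfolding f(3) t(2) by (rule F_class_graft[symmetric]) (use t f in simp_all)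
    show "X = cls (graft f s) (P f \<xi>)" unfolding s(2) by (rule cls_graft[OF s(1) f(1), symmetric])
  qed
qed

lemma pre_rep_cases2:
  assumes "g \<in> carrier thompson_F" "X \<in> carrier V" "Y \<in> carrier V"
  obtains t s \<xi> \<eta> where "leaves t = leaves s" "(s, \<xi>) \<in> decorations H" "(s, \<eta>) \<in> decorations H"
    "(t, \<xi>) \<in> decorations H" "(t, \<eta>) \<in> decorations H"
    "g = F_class (t, s)" "X = cls s \<xi>" "Y = cls s \<eta>"
proof -
  obtain t s \<xi> where a: "leaves t = leaves s" "(s, \<xi>) \<in> decorations H" "(t, \<xi>) \<in> decorations H"
    "g = F_class (t, s)" "X = cls s \<xi>" using assms(1,2) by (rule pre_rep_cases)
  obtain f \<eta> where f: "length f = leaves s" "(graft f s, \<eta>) \<in> decorations H" "Y = cls (graft f s) \<eta>"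
    using assms(3) by (rule pre_space_refine)
  have l: "leaves (graft f t) = leaves (graft f s)" using a(1) f(1) by (simp add: leaves_graft)
  have d: "(graft f s, P f \<xi>) \<in> decorations H" by (rule decorations_graft[OF a(2) f(1)])
  show ?thesis
  proof (rule that[OF l d f(2) _ _ _ _ f(3)])
    show "(graft f t, P f \<xi>) \<in> decorations H" "(graft f t, \<eta>) \<in> decorations H"
      using d f(2) l by (simp_all add: decorations_iff)
    show "g = F_class (graft f t, graft f s)"
      unfolding a(4) by (rule F_class_graft[symmetric]) (use a f in simp_all)
    show "X = cls (graft f s) (P f \<xi>)" unfolding a(5) by (rule cls_graft[OF a(2) f(1), symmetric])
  qed
qed

lemma pyth_pre_rep_closed:
  assumes "g \<in> carrier thompson_F" "X \<in> carrier V"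
  shows "pyth_pre_rep H A B g X \<in> carrier V"
  using assms by (rule pre_rep_cases) (simp add: pyth_pre_rep)

lemma pyth_pre_rep_mult:
  assumes g: "g \<in> carrier thompson_F" and h: "h \<in> carrier thompson_F" and X: "X \<in> carrier V"
  shows "pyth_pre_rep H A B (g \<otimes>\<^bsub>thompson_F\<^esub> h) X = pyth_pre_rep H A B g (pyth_pre_rep H A B h X)"
proof -
  obtain s u \<xi> where a: "leaves s = leaves u" "(u, \<xi>) \<in> decorations H" "(s, \<xi>) \<in> decorations H"
    "h = F_class (s, u)" "X = cls u \<xi>" using h X by (rule pre_rep_cases)
  have "cls s \<xi> \<in> carrier V" using a(3) by simp
  with g obtain t v \<eta> where b: "leaves t = leaves v" "(v, \<eta>) \<in> decorations H" "(t, \<eta>) \<in> decorations H"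
    "g = F_class (t, v)" "cls s \<xi> = cls v \<eta>" by (rule pre_rep_cases)
  obtain f k where f: "length f = leaves s" "length k = leaves v" "graft f s = graft k v"
    by (rule common_refinement)
  have e: "P f \<xi> = P k \<eta>" by (rule same_refinement[OF a(3) b(2) b(5)[symmetric] f])
  have lf: "leaves (graft k t) = leaves (graft f s)" "leaves (graft f s) = leaves (graft f u)"
    subgoal unfolding f(3) using leaves_graft[of k t] leaves_graft[of k v] b(1) f(2) by simp
    subgoal using a(1) f(1) by (simp add: leaves_graft)
    done
  have g': "g = F_class (graft k t, graft f s)"
    unfolding f(3) b(4) by (rule F_class_graft[symmetric]) (use b f in simp_all)
  have h': "h = F_class (graft f s, graft f u)"
    unfolding a(4) by (rule F_class_graft[symmetric]) (use a f in simp_all)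
  have d: "(graft f u, P f \<xi>) \<in> decorations H" by (rule decorations_graft) (use a f in simp_all)
  then have d': "(graft f s, P f \<xi>) \<in> decorations H" using lf by (simp add: decorations_iff)
  have X': "X = cls (graft f u) (P f \<xi>)"
    unfolding a(5) by (rule cls_graft[symmetric]) (use a f in simp_all)
  have "leaves (graft k t) = leaves (graft f u)" using lf by simp
  then show ?thesis
    unfolding g' h' F_mult[OF lf] X'
    using pyth_pre_rep[OF _ d, of "graft k t"] pyth_pre_rep[OF lf(2) d] pyth_pre_rep[OF lf(1) d'] by simp
qed

lemma pyth_pre_rep_one:
  assumes "X \<in> carrier V"
  shows "pyth_pre_rep H A B \<one>\<^bsub>thompson_F\<^esub> X = X"
proof -
  obtain s \<xi> where s: "(s, \<xi>) \<in> decorations H" "X = cls s \<xi>" using assms by (rule pre_space_cases)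
  show ?thesis using pyth_pre_rep[of s s \<xi>] s by (simp add: F_one)
qed

lemma unitary_pyth_pre_rep:
  assumes g: "g \<in> carrier thompson_F"
  shows "unitary_iso V V (pyth_pre_rep H A B g)"
proof -
  interpret F: group thompson_F by (rule group_thompson_F)
  let ?T = "pyth_pre_rep H A B g" and ?S = "pyth_pre_rep H A B (inv\<^bsub>thompson_F\<^esub> g)"
  have ST: "?S (?T X) = X" "?T (?S X) = X" if "X \<in> carrier V" for X
    using pyth_pre_rep_mult[of "inv\<^bsub>thompson_F\<^esub> g" g X] pyth_pre_rep_mult[of g "inv\<^bsub>thompson_F\<^esub> g" X] g that
    by (simp_all add: pyth_pre_rep_one)
  have "bij_betw ?T (carrier V) (carrier V)"
    by (rule bij_betw_byWitness[of _ ?S]) (use ST g pyth_pre_rep_closed in auto)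
  moreover have "?T (X \<oplus>\<^bsub>V\<^esub> Y) = ?T X \<oplus>\<^bsub>V\<^esub> ?T Y \<and> cip V (?T X) (?T Y) = cip V X Y \<and> ?T (c \<odot>\<^bsub>V\<^esub> X) = c \<odot>\<^bsub>V\<^esub> ?T X"
    if XY: "X \<in> carrier V" "Y \<in> carrier V" for X Y c
  proof -
    obtain t s \<xi> \<eta> where "leaves t = leaves s" "(s, \<xi>) \<in> decorations H" "(s, \<eta>) \<in> decorations H"
    "(t, \<xi>) \<in> decorations H" "(t, \<eta>) \<in> decorations H"
    "g = F_class (t, s)" "X = cls s \<xi>" "Y = cls s \<eta>"
      by (rule pre_rep_cases2[OF g XY])
    then show ?thesis
      by (simp add: pyth_pre_rep pre_add pre_smult pre_cip vadd_decorations smult_decorations)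
  qed
  ultimately show ?thesis unfolding unitary_iso_def by blast
qed

end

lemma unitary_iso_completion:
  assumes V: "pre_hilbert V" and T: "unitary_iso V V T"
  shows "unitary_iso (completion V) (completion V) (completion_map V T)"
proof -
  interpret pre_hilbert V by (rule V)
  interpret W: pre_hilbert "completion V" by (rule pre_hilbert_completion)
  have bij: "bij_betw T (carrier V) (carrier V)"
    and add: "\<And>x y. x \<in> carrier V \<Longrightarrow> y \<in> carrier V \<Longrightarrow> T (x \<oplus>\<^bsub>V\<^esub> y) = T x \<oplus>\<^bsub>V\<^esub> T y"
    and smult: "\<And>c x. x \<in> carrier V \<Longrightarrow> T (c \<odot>\<^bsub>V\<^esub> x) = c \<odot>\<^bsub>V\<^esub> T x"
    and cip: "\<And>x y. x \<in> carrier V \<Longrightarrow> y \<in> carrier V \<Longrightarrow> cip V (T x) (T y) = cip V x y"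
    using T by (auto simp: unitary_iso_def)
  have closed: "T u \<in> carrier V" if "u \<in> carrier V" for u using bij that by (auto simp: bij_betw_def)
  have iso: "vdist V (T u) (T v) = vdist V u v" if uv: "u \<in> carrier V" "v \<in> carrier V" for u v
  proof -
    have "(vdist V (T u) (T v))\<^sup>2 = (vdist V u v)\<^sup>2" using uv closed cip by (simp add: vdist_sq)
    then show ?thesis using uv closed by (simp add: power2_eq_iff_nonneg)
  qed
  have cm: "(\<lambda>n. T (x n)) \<in> cauchy_seqs V" "completion_map V T (limit_class V x) = limit_class V (\<lambda>n. T (x n))"
    if "x \<in> cauchy_seqs V" for x
    using completion_map[of T x] closed iso that by simp_all
  have onto: "\<exists>y\<in>cauchy_seqs V. x = (\<lambda>n. T (y n))" if x: "x \<in> cauchy_seqs V" for x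
  proof -
    define y where "y n = inv_into (carrier V) T (x n)" for n
    have yc: "y n \<in> carrier V" and Ty: "T (y n) = x n" for n
      using bij cauchy_seqs_carrier[OF x, of n] unfolding y_def
      by (auto simp: bij_betw_def inv_into_into f_inv_into_f)
    have "vdist V (y m) (y n) = vdist V (x m) (x n)" for m n
      using iso[OF yc[of m] yc[of n]] Ty by simp
    then have "y \<in> cauchy_seqs V" using x yc by (auto simp: cauchy_seqs_def)
    then show ?thesis using Ty by (intro bexI[of _ y]) auto
  qed
  have cipW: "cip (completion V) (completion_map V T X) (completion_map V T Y) = cip (completion V) X Y"
    if XY: "X \<in> carrier (completion V)" "Y \<in> carrier (completion V)" for X Y
  proof -
    obtain x where x: "x \<in> cauchy_seqs V" "X = limit_class V x" using XY(1) by (rule completion_cases)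
    obtain y where y: "y \<in> cauchy_seqs V" "Y = limit_class V y" using XY(2) by (rule completion_cases)
    have "(\<lambda>n. cip V (T (x n)) (T (y n))) \<longlonglongrightarrow> cip (completion V) (completion_map V T X) (completion_map V T Y)"
      unfolding x(2) y(2) cm(2)[OF x(1)] cm(2)[OF y(1)]
      using completion_cip[OF cm(1)[OF x(1)] cm(1)[OF y(1)]] by simp
    then have "(\<lambda>n. cip V (x n) (y n)) \<longlonglongrightarrow> cip (completion V) (completion_map V T X) (completion_map V T Y)"
      using cip x(1) y(1) by (simp add: cauchy_seqs_carrier)
    moreover have "(\<lambda>n. cip V (x n) (y n)) \<longlonglongrightarrow> cip (completion V) X Y"
      unfolding x(2) y(2) by (rule completion_cip[OF x(1) y(1)])
    ultimately show ?thesis by (rule LIMSEQ_unique)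
  qed
  have cl: "completion_map V T X \<in> carrier (completion V)" if X: "X \<in> carrier (completion V)" for X
  proof -
    obtain x where x: "x \<in> cauchy_seqs V" "X = limit_class V x" using X by (rule completion_cases)
    show ?thesis unfolding x(2) using cm x(1) by simp
  qed
  have "inj_on (completion_map V T) (carrier (completion V))"
  proof (rule inj_onI)
    fix X Y assume XY: "X \<in> carrier (completion V)" "Y \<in> carrier (completion V)"
      "completion_map V T X = completion_map V T Y"
    have "(vdist (completion V) X Y)\<^sup>2 = (vdist (completion V) (completion_map V T X) (completion_map V T Y))\<^sup>2"
      using XY(1,2) cl by (simp only: W.vdist_sq cipW)
    then show "X = Y" using XY cl by (simp add: W.vdist_eq_0_iff)
  qed
  moreover have "carrier (completion V) \<subseteq> completion_map V T ` carrier (completion V)"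
  proof
    fix X assume "X \<in> carrier (completion V)"
    then obtain x where x: "x \<in> cauchy_seqs V" "X = limit_class V x" by (rule completion_cases)
    obtain y where y: "y \<in> cauchy_seqs V" "x = (\<lambda>n. T (y n))" using onto[OF x(1)] by blast
    have "X = completion_map V T (limit_class V y)" unfolding x(2) using cm(2) y by simp
    then show "X \<in> completion_map V T ` carrier (completion V)" using y(1) by simp
  qed
  ultimately have "bij_betw (completion_map V T) (carrier (completion V)) (carrier (completion V))"
    using cl by (auto simp: bij_betw_def)
  moreover have "completion_map V T (X \<oplus>\<^bsub>completion V\<^esub> Y) = completion_map V T X \<oplus>\<^bsub>completion V\<^esub> completion_map V T Y"
    if XY: "X \<in> carrier (completion V)" "Y \<in> carrier (completion V)" for X Y
  proof -
    obtain x where x: "x \<in> cauchy_seqs V" "X = limit_class V x" using XY(1) by (rule completion_cases)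
    obtain y where y: "y \<in> cauchy_seqs V" "Y = limit_class V y" using XY(2) by (rule completion_cases)
    show ?thesis unfolding x(2) y(2) using x(1) y(1) cm
      by (simp add: completion_add cauchy_seqs_add add cauchy_seqs_carrier)
  qed
  moreover have "completion_map V T (c \<odot>\<^bsub>completion V\<^esub> X) = c \<odot>\<^bsub>completion V\<^esub> completion_map V T X"
    if X: "X \<in> carrier (completion V)" for c X
  proof -
    obtain x where x: "x \<in> cauchy_seqs V" "X = limit_class V x" using X by (rule completion_cases)
    show ?thesis unfolding x(2) using x(1) cm
      by (simp add: completion_smult cauchy_seqs_smult smult cauchy_seqs_carrier)
  qed
  ultimately show ?thesis unfolding unitary_iso_def using cipW by blast
qed

lemma (in pythagorean_pair) unitary_rep_pyth_rep:
  "unitary_rep thompson_F (pyth_space H A B) (pyth_rep H A B)"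
proof -
  interpret V: pre_hilbert V by (rule pre_hilbert_pyth_pre_space)
  have uni: "unitary_iso (completion V) (completion V) (pyth_rep H A B g)" if "g \<in> carrier thompson_F" for g
    unfolding pyth_rep_def
    by (rule unitary_iso_completion[OF pre_hilbert_pyth_pre_space unitary_pyth_pre_rep[OF that]])
  have iso: "vdist V (pyth_pre_rep H A B g X) (pyth_pre_rep H A B g Y) = vdist V X Y"
    if g: "g \<in> carrier thompson_F" and XY: "X \<in> carrier V" "Y \<in> carrier V" for g X Y
  proof -
    have "(vdist V (pyth_pre_rep H A B g X) (pyth_pre_rep H A B g Y))\<^sup>2 = (vdist V X Y)\<^sup>2"
      using unitary_pyth_pre_rep[OF g] XY pyth_pre_rep_closed[OF g]
      by (simp add: V.vdist_sq unitary_iso_def)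
    then show ?thesis using XY pyth_pre_rep_closed[OF g] by (simp add: power2_eq_iff_nonneg)
  qed
  have cm: "(\<lambda>n. pyth_pre_rep H A B g (x n)) \<in> cauchy_seqs V"
    "pyth_rep H A B g (limit_class V x) = limit_class V (\<lambda>n. pyth_pre_rep H A B g (x n))"
    if "g \<in> carrier thompson_F" "x \<in> cauchy_seqs V" for g x
    unfolding pyth_rep_def
    using V.completion_map[of "pyth_pre_rep H A B g", OF pyth_pre_rep_closed[OF that(1)] iso[OF that(1)] that(2)]
    by simp_all
  have "pyth_rep H A B (g \<otimes>\<^bsub>thompson_F\<^esub> h) X = pyth_rep H A B g (pyth_rep H A B h X)"
    if gh: "g \<in> carrier thompson_F" "h \<in> carrier thompson_F" and X: "X \<in> carrier (completion V)" for g h X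
  proof -
    obtain x where x: "x \<in> cauchy_seqs V" "X = limit_class V x" using X by (rule V.completion_cases)
    have "g \<otimes>\<^bsub>thompson_F\<^esub> h \<in> carrier thompson_F"
      using gh group.subgroup_self[OF group_thompson_F] by (simp add: subgroup.m_closed)
    then show ?thesis unfolding x(2) using gh x(1)
      by (simp add: cm pyth_pre_rep_mult V.cauchy_seqs_carrier)
  qed
  then show ?thesis unfolding unitary_rep_def pyth_space_def using uni by blast
qed

lemma hilbert_complex_line: "hilbert complex_line"
proof -
  have "pre_hilbert complex_line"
    by (rule pre_hilbertI) (auto simp: complex_line_def algebra_simps complex_neq_0 power2_eq_square)
  interpret pre_hilbert complex_line by fact
  have d: "vdist complex_line x y = dist x y" for x y
  proof -
    have "x \<ominus>\<^bsub>complex_line\<^esub> y = x - y"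
      using minus_eq_smult[of x y] by (simp add: complex_line_def)
    moreover have "vnorm complex_line z = cmod z" for z
      by (simp add: vnorm_def complex_line_def cmod_def power2_eq_square)
    ultimately show ?thesis by (simp add: vdist_def dist_norm)
  qed
  have "\<exists>l\<in>carrier complex_line. (\<lambda>n. vdist complex_line (x n) l) \<longlonglongrightarrow> 0" if "x \<in> cauchy_seqs complex_line" for x
  proof -
    have "Cauchy x" using that by (auto simp: cauchy_seqs_def d Cauchy_def)
    then obtain l where "x \<longlonglongrightarrow> l" using Cauchy_convergent convergent_def by blast
    then have "(\<lambda>n. dist (x n) l) \<longlonglongrightarrow> 0" by (rule tendsto_dist_iff[THEN iffD1])
    then show ?thesis unfolding d by (intro bexI[of _ l]) (simp_all add: complex_line_def)
  qed
  then show ?thesis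
    by (intro hilbert.intro hilbert_axioms.intro \<open>pre_hilbert complex_line\<close>)
qed

lemma pythagorean_pair_scalar:
  fixes a b :: complex
  assumes "(cmod a)\<^sup>2 + (cmod b)\<^sup>2 = 1"
  shows "pythagorean_pair complex_line ((*) a) ((*) b)"
proof (intro pythagorean_pair.intro pythagorean_pair_axioms.intro hilbert_complex_line)
  fix x y :: complex
  have "a * cnj a + b * cnj b = 1"
    using assms complex_norm_square[of a] complex_norm_square[of b] by (metis of_real_1 of_real_add)
  then have "(a * cnj a + b * cnj b) * (x * cnj y) = x * cnj y" by simp
  then show "cip complex_line (a * x) (a * y) + cip complex_line (b * x) (b * y) = cip complex_line x y"
    by (simp add: complex_line_def algebra_simps)
qed (simp_all add: complex_line_def algebra_simps)

end

theory Submission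
  imports Defs
begin

text \<open>A copy of the induced representation inside \<open>\<sigma>\<close> yields an isometry \<open>T : W \<rightarrow> \<H>\<close> with
  \<open>\<langle>\<sigma>(g) T v, T w\<rangle> = \<langle>\<theta>(g) v, w\<rangle>\<close> for \<open>g \<in> K\<close> and \<open>= 0\<close> for \<open>g \<notin> K\<close>. Let \<open>v\<close> be a unit vector and
  approximate \<open>T v\<close>, together with the images of an orthonormal basis of \<open>W\<close>, by decorations of one
  tree \<open>t\<close>. Since \<open>|a|, |b| < 1\<close>, \<open>t\<close> can be refined until every leaf carries little mass of \<open>T v\<close>. An
  element of \<open>F\<close> supported below a single leaf of \<open>t\<close> then almost fixes \<open>T v\<close>, so it must lie in \<open>K\<close>.
  Hence \<open>K\<close> also contains the element \<open>g\<close> that acts below every leaf of \<open>t\<close> by carrying the left comb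
  with \<open>n + 1\<close> leaves to the right one. On decorations of \<open>t\<close> its matrix coefficients are \<open>\<kappa>\<^sub>n\<close> times
  the inner product, where \<open>|\<kappa>\<^sub>n| \<le> (n + 1) max(|a|, |b|)^n\<close> tends to \<open>0\<close>. So the unit vector
  \<open>\<theta>(g) v\<close> is almost orthogonal to a basis of \<open>W\<close>, which is absurd.\<close>

section \<open>Orthonormal bases and completions\<close>

context pre_hilbert
begin

lemma cip_finsum_left:
  assumes "finite A" "f \<in> A \<rightarrow> carrier V" "y \<in> carrier V"
  shows "cip V (finsum V f A) y = (\<Sum>x\<in>A. cip V (f x) y)"
  using assms
proof (induction A rule: finite_induct)
  case empty
  then show ?case by simp
next
  case (insert x A)
  then have "f \<in> A \<rightarrow> carrier V" "f x \<in> carrier V" by auto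
  with insert show ?case by (simp add: cip_add_left)
qed

text \<open>Induction on \<open>S\<close>: the new vector minus its projection onto the current
  \<open>E\<close> is either zero or is normalised and added. The expansion over \<open>E\<close> is
  stated weakly, tested against every \<open>y\<close>, which is the form that Parseval's identity
  uses.\<close>

lemma gram_schmidt:
  assumes "finite S" "S \<subseteq> carrier V"
  shows "\<exists>E. finite E \<and> E \<subseteq> carrier V \<and> (\<forall>e\<in>E. \<forall>e'\<in>E. cip V e e' = of_bool (e = e')) \<and>
    (\<forall>x\<in>S. \<forall>y\<in>carrier V. cip V x y = (\<Sum>e\<in>E. cip V x e * cip V e y))"
  using assms
proof (induction S rule: finite_induct)
  case empty
  show ?case by (rule exI[of _ "{}"]) simp
next
  case (insert x S)
  have "S \<subseteq> carrier V" using insert.prems by simp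
  from insert.IH[OF this] obtain E where E: "finite E" "E \<subseteq> carrier V"
    and on': "\<forall>e\<in>E. \<forall>e'\<in>E. cip V e e' = of_bool (e = e')"
    and S': "\<forall>x\<in>S. \<forall>y\<in>carrier V. cip V x y = (\<Sum>e\<in>E. cip V x e * cip V e y)"
    by (elim exE conjE) (rule that)
  note on = on'[rule_format] and S = S'[rule_format]
  have x: "x \<in> carrier V" using insert.prems by simp
  have Ec: "\<And>e. e \<in> E \<Longrightarrow> e \<in> carrier V" using E(2) by blast
  define p where "p = finsum V (\<lambda>e. cip V x e \<odot> e) E"
  define x' where "x' = x \<ominus> p"
  have pc: "p \<in> carrier V" unfolding p_def using Ec by (intro finsum_closed) auto
  have x'c: "x' \<in> carrier V" unfolding x'_def using x pc by simp
  \<comment> \<open>The defect in the expansion of \<open>x\<close> over \<open>E\<close> is exactly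
    \<open>cip V x' y\<close>. It vanishes if \<open>x'\<close> is zero and is otherwise supplied by
    the one new vector.\<close>
  have x'y: "cip V x' y = cip V x y - (\<Sum>e\<in>E. cip V x e * cip V e y)" if "y \<in> carrier V" for y
  proof -
    have "cip V p y = (\<Sum>e\<in>E. cip V (cip V x e \<odot> e) y)"
      unfolding p_def using E Ec that by (intro cip_finsum_left) auto
    also have "\<dots> = (\<Sum>e\<in>E. cip V x e * cip V e y)"
      using Ec that by (intro sum.cong) (auto simp: cip_smult_left)
    finally show ?thesis unfolding x'_def using x pc that by (simp add: cip_minus_left)
  qed
  show ?case
  proof (cases "x' = \<zero>")
    case True
    then have "cip V x y = (\<Sum>e\<in>E. cip V x e * cip V e y)" if "y \<in> carrier V" for y
      using x'y[OF that] that by simp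
    then show ?thesis using E on S by (intro exI[of _ E]) auto
  next
    case False
    define N where "N = complex_of_real (vnorm V x')"
    have N0: "N \<noteq> 0" using False x'c by (simp add: N_def vnorm_eq_0_iff)
    have xx: "cip V x' x' = N * N" using cip_self[OF x'c] by (simp add: N_def power2_eq_square)
    have cN: "cnj N = N" by (simp add: N_def)
    define e' where "e' = (1 / N) \<odot> x'"
    have e'c: "e' \<in> carrier V" using x'c by (simp add: e'_def)
    have e'y: "cip V e' y = cip V x' y / N" "cip V y e' = cip V y x' / N" if "y \<in> carrier V" for y
      using that x'c cN by (simp_all add: e'_def cip_smult_left cip_smult_right)
    have orth: "cip V x' e = 0" if "e \<in> E" for e
    proof -
      have "(\<Sum>f\<in>E. cip V x f * cip V f e) = (\<Sum>f\<in>E. if f = e then cip V x e else 0)"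
        using that by (intro sum.cong) (auto simp: on)
      then show ?thesis using x'y[OF Ec[OF that]] that E(1) by simp
    qed
    have orth': "cip V e x' = 0" if "e \<in> E" for e
      using orth[OF that] cip_commute[OF Ec[OF that] x'c] by simp
    have e'e': "cip V e' e' = 1"
      using e'c x'c N0 xx by (simp add: e'y)
    have ee': "cip V e e' = 0" "cip V e' e = 0" if "e \<in> E" for e
      using orth[OF that] orth'[OF that] Ec[OF that] by (simp_all add: e'y)
    have ne: "e' \<notin> E" using ee' e'e' by force
    \<comment> \<open>Vectors of \<open>S\<close> expand over \<open>E\<close> alone, so they are
      orthogonal to \<open>e'\<close> and their expansions survive the insertion.\<close>
    have Se': "cip V s e' = 0" if "s \<in> S" for s using S[OF that e'c] ee' by simp
    have xe': "cip V x e' = N"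
      using x'y[OF e'c] ee' e'y(2)[OF x'c] xx N0 by simp
    show ?thesis
    proof (intro exI[of _ "insert e' E"] conjI ballI)
      fix s y assume s: "s \<in> insert x S" and y: "y \<in> carrier V"
      show "cip V s y = (\<Sum>e\<in>insert e' E. cip V s e * cip V e y)"
      proof (cases "s \<in> S")
        case True
        then show ?thesis using S[OF True y] Se' ne E(1) by simp
      next
        case False
        then have "s = x" using s by simp
        then show ?thesis using x'y[OF y] xe' e'y(1)[OF y] N0 ne E(1) by simp
      qed
    qed (use E e'c on ee' e'e' ne in auto)
  qed
qed

text \<open>The Gram-Schmidt expansion of a spanning set passes to its linear combinations; taking
  both arguments equal gives Parseval's identity.\<close>

lemma fin_dim_orthonormal_basis:
  assumes "fin_dim V"
  obtains E where "finite E" "E \<subseteq> carrier V" "\<forall>e\<in>E. vnorm V e = 1"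
    "\<forall>x\<in>carrier V. (vnorm V x)\<^sup>2 = (\<Sum>e\<in>E. (cmod (cip V x e))\<^sup>2)"
proof -
  from assms obtain S where S: "finite S" "S \<subseteq> carrier V"
    and span: "\<forall>v\<in>carrier V. \<exists>c. v = finsum V (\<lambda>s. c s \<odot> s) S"
    unfolding fin_dim_def by (elim exE conjE) (rule that)
  from gram_schmidt[OF S] obtain E where E: "finite E" "E \<subseteq> carrier V"
    and on: "\<forall>e\<in>E. \<forall>e'\<in>E. cip V e e' = of_bool (e = e')"
    and SE': "\<forall>x\<in>S. \<forall>y\<in>carrier V. cip V x y = (\<Sum>e\<in>E. cip V x e * cip V e y)"
    by (elim exE conjE) (rule that)
  note SE = SE'[rule_format]
  show ?thesis
  proof (rule that[OF E]; intro ballI)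
    show "vnorm V e = 1" if "e \<in> E" for e using on that by (simp add: vnorm_def)
    fix x assume x: "x \<in> carrier V"
    obtain c where c: "x = finsum V (\<lambda>s. c s \<odot> s) S" using bspec[OF span x] ..
    have xy: "cip V x y = (\<Sum>s\<in>S. c s * cip V s y)" if y: "y \<in> carrier V" for y
    proof -
      have "cip V x y = (\<Sum>s\<in>S. cip V (c s \<odot> s) y)"
        unfolding c using S y by (intro cip_finsum_left) auto
      also have "\<dots> = (\<Sum>s\<in>S. c s * cip V s y)"
        using S(2) y by (intro sum.cong refl cip_smult_left) auto
      finally show ?thesis .
    qed
    \<comment> \<open>Expand \<open>x\<close> over \<open>S\<close>, then each \<open>s\<close> over
      \<open>E\<close>. After swapping the sums, the sum over \<open>S\<close> recombines to
      \<open>cip V x e\<close>.\<close>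
    have "cip V x x = (\<Sum>s\<in>S. c s * (\<Sum>e\<in>E. cip V s e * cip V e x))"
      using x by (simp add: xy SE)
    also have "\<dots> = (\<Sum>s\<in>S. \<Sum>e\<in>E. c s * cip V s e * cip V e x)"
      by (simp add: sum_distrib_left mult.assoc)
    also have "\<dots> = (\<Sum>e\<in>E. (\<Sum>s\<in>S. c s * cip V s e) * cip V e x)"
      by (subst sum.swap) (simp add: sum_distrib_right)
    also have "\<dots> = (\<Sum>e\<in>E. complex_of_real ((cmod (cip V x e))\<^sup>2))"
    proof (rule sum.cong[OF refl])
      fix e assume "e \<in> E"
      then have e: "e \<in> carrier V" using E(2) by blast
      show "(\<Sum>s\<in>S. c s * cip V s e) * cip V e x = complex_of_real ((cmod (cip V x e))\<^sup>2)"
        using xy[OF e] cip_commute[OF e x] complex_norm_square[of "cip V x e"] by simp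
    qed
    finally show "(vnorm V x)\<^sup>2 = (\<Sum>e\<in>E. (cmod (cip V x e))\<^sup>2)"
      using x by (simp add: vnorm_sq)
  qed
qed

section \<open>Constant sequences in a completion, and stability of matrix coefficients\<close>

lemma completion_approx:
  assumes X: "X \<in> carrier (completion V)" and "0 < \<delta>"
  obtains z where "z \<in> carrier V" "vdist (completion V) X (limit_class V (\<lambda>n. z)) < \<delta>"
proof -
  obtain x where x: "x \<in> cauchy_seqs V" "X = limit_class V x" using X by (rule completion_cases)
  obtain N where N: "\<And>m n. m \<ge> N \<Longrightarrow> n \<ge> N \<Longrightarrow> vdist V (x m) (x n) < \<delta> / 2"
    using cauchy_seqsD[OF x(1), of "\<delta> / 2"] \<open>0 < \<delta>\<close> by auto
  have xN: "x N \<in> carrier V" using x(1) by (rule cauchy_seqs_carrier)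
  \<comment> \<open>The limit only preserves the weak inequality, hence the margin
    \<open>\<delta> / 2\<close>.\<close>
  have "vdist (completion V) X (limit_class V (\<lambda>n. x N)) \<le> \<delta> / 2"
    unfolding x(2)
    by (rule LIMSEQ_le_const2[OF completion_vdist[OF x(1) cauchy_seqs_const[OF xN]]])
      (use N less_imp_le in blast)
  then show ?thesis using that[OF xN] \<open>0 < \<delta>\<close> by simp
qed

lemma completion_cip_const:
  assumes "x \<in> carrier V" "y \<in> carrier V"
  shows "cip (completion V) (limit_class V (\<lambda>n. x)) (limit_class V (\<lambda>n. y)) = cip V x y"
  using LIMSEQ_unique[OF completion_cip[OF cauchy_seqs_const cauchy_seqs_const, OF assms] tendsto_const] .

end

text \<open>A unitary changes neither norms nor distances, so the error bound does not depend on
  \<open>\<pi>\<close>. One approximation of the vectors thus serves all group elements at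
  once.\<close>

lemma cip_rep_approx:
  assumes "pre_hilbert V" "unitary_iso V V \<pi>"
    "x \<in> carrier V" "x' \<in> carrier V" "y \<in> carrier V" "y' \<in> carrier V"
  shows "cmod (cip V (\<pi> x) y - cip V (\<pi> x') y') \<le> vdist V x x' * vnorm V y + vnorm V x' * vdist V y y'"
proof -
  interpret pre_hilbert V by fact
  have \<pi>c: "\<pi> u \<in> carrier V" if "u \<in> carrier V" for u
    using assms(2) that by (auto simp: unitary_iso_def bij_betw_def)
  have \<pi>i: "cip V (\<pi> u) (\<pi> v) = cip V u v" if "u \<in> carrier V" "v \<in> carrier V" for u v
    using assms(2) that by (simp add: unitary_iso_def)
  have "(vdist V (\<pi> x) (\<pi> x'))\<^sup>2 = (vdist V x x')\<^sup>2" using assms \<pi>c \<pi>i by (simp add: vdist_sq)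
  then have "vdist V (\<pi> x) (\<pi> x') = vdist V x x'" using assms \<pi>c by (simp add: power2_eq_iff_nonneg)
  moreover have "vnorm V (\<pi> x') = vnorm V x'" using assms \<pi>i by (simp add: vnorm_def)
  ultimately show ?thesis using cip_diff_le[of "\<pi> x" y "\<pi> x'" y'] assms \<pi>c by simp
qed

section \<open>Matrix coefficients of induced representations\<close>

text \<open>\<open>coset_bump G K W \<theta> g v\<close> is the vector of the induced space that is supported on the coset \<open>g K\<close>
  and takes the value \<open>v\<close> at \<open>g\<close>.\<close>

definition coset_bump ::
  "('g, 'k) monoid_scheme \<Rightarrow> 'g set \<Rightarrow> ('v, 'm) cspace_scheme \<Rightarrow> ('g \<Rightarrow> 'v \<Rightarrow> 'v) \<Rightarrow> 'g \<Rightarrow> 'v \<Rightarrow> 'g \<Rightarrow> 'v" where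
  "coset_bump G K W \<theta> g v = (\<lambda>x\<in>carrier G.
     if inv\<^bsub>G\<^esub> g \<otimes>\<^bsub>G\<^esub> x \<in> K then \<theta> (inv\<^bsub>G\<^esub> (inv\<^bsub>G\<^esub> g \<otimes>\<^bsub>G\<^esub> x)) v else \<zero>\<^bsub>W\<^esub>)"

locale induction_data = group G for G (structure) +
  fixes K :: "'a set" and W :: "('w, 'm) cspace_scheme" and \<theta> :: "'a \<Rightarrow> 'w \<Rightarrow> 'w"
  assumes subgroup_K: "subgroup K G" and pre_hilbert_W: "pre_hilbert W"
    and rep_\<theta>: "unitary_rep (G\<lparr>carrier := K\<rparr>) W \<theta>"
begin

sublocale W: pre_hilbert W by (rule pre_hilbert_W)
sublocale K: subgroup K G by (rule subgroup_K)

lemma rep_closed: "k \<in> K \<Longrightarrow> v \<in> carrier W \<Longrightarrow> \<theta> k v \<in> carrier W"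
  using rep_\<theta> bij_betwE[of "\<theta> k" "carrier W" "carrier W"] by (simp add: unitary_rep_def unitary_iso_def)

lemma rep_cip: "k \<in> K \<Longrightarrow> v \<in> carrier W \<Longrightarrow> w \<in> carrier W \<Longrightarrow> cip W (\<theta> k v) (\<theta> k w) = cip W v w"
  using rep_\<theta> by (simp add: unitary_rep_def unitary_iso_def)

lemma rep_mult: "k \<in> K \<Longrightarrow> l \<in> K \<Longrightarrow> v \<in> carrier W \<Longrightarrow> \<theta> (k \<otimes> l) v = \<theta> k (\<theta> l v)"
  using rep_\<theta> by (simp add: unitary_rep_def)

text \<open>\<open>unitary_rep\<close> only asks for multiplicativity; the operator at the identity
  is idempotent and injective, hence trivial.\<close>

lemma rep_one: "v \<in> carrier W \<Longrightarrow> \<theta> \<one> v = v"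
proof -
  assume v: "v \<in> carrier W"
  have "inj_on (\<theta> \<one>) (carrier W)"
    using rep_\<theta> by (auto simp: unitary_rep_def unitary_iso_def bij_betw_def)
  moreover have "\<theta> \<one> (\<theta> \<one> v) = \<theta> \<one> v" using rep_mult[of \<one> \<one> v] v by simp
  ultimately show ?thesis using v rep_closed[of \<one> v] by (meson inj_onD K.one_closed)
qed

lemma rep_zero: "k \<in> K \<Longrightarrow> \<theta> k \<zero>\<^bsub>W\<^esub> = \<zero>\<^bsub>W\<^esub>"
  using rep_cip[of k "\<zero>\<^bsub>W\<^esub>" "\<zero>\<^bsub>W\<^esub>"] rep_closed[of k "\<zero>\<^bsub>W\<^esub>"] W.cip_pos[of "\<theta> k \<zero>\<^bsub>W\<^esub>"] by force

abbreviation "bump \<equiv> coset_bump G K W \<theta>"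
abbreviation "I \<equiv> ind_space G K W \<theta>"

lemma coset_rep_closed:
  assumes "C \<in> lcosets K"
  shows "coset_rep C \<in> carrier G" "coset_rep C <# K = C"
proof -
  obtain c where c: "c \<in> carrier G" "C = c <# K" using assms by (auto simp: LCOSETS_def)
  have "coset_rep C \<in> C" unfolding coset_rep_def c(2) using lcos_self[OF c(1) subgroup_K] by (rule someI)
  then have C: "coset_rep C \<in> c <# K" using c by simp
  show "coset_rep C \<in> carrier G" using C c(1) K.elemlcos_carrier[OF is_group] by blast
  show "coset_rep C <# K = C" using l_repr_independence[OF C c(1) subgroup_K] c(2) by simp
qed

text \<open>Reduces every sum over cosets that involves a bump to a single term.\<close>

lemma bump_coset_rep_zero:
  assumes "g \<in> carrier G" "C \<in> lcosets K" "C \<noteq> g <# K"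
  shows "bump g v (coset_rep C) = \<zero>\<^bsub>W\<^esub>"
proof -
  let ?c = "coset_rep C"
  note c = coset_rep_closed[OF assms(2)]
  have "inv g \<otimes> ?c \<notin> K"
  proof
    assume k: "inv g \<otimes> ?c \<in> K"
    have "?c = g \<otimes> (inv g \<otimes> ?c)" using assms(1) c(1) by (simp add: m_assoc[symmetric])
    then have "?c \<in> g <# K" using k by (auto simp: l_coset_def)
    then show False using l_repr_independence[OF _ assms(1) subgroup_K] c(2) assms(3) by metis
  qed
  then show ?thesis using c(1) by (simp add: coset_bump_def)
qed

text \<open>Right translation by \<open>k\<close> preserves membership of
  \<open>inv g \<otimes> x\<close> in \<open>K\<close>, and inversion reverses the product, which
  yields the covariance rule. Square-summability holds because only the coset of \<open>g\<close>
  contributes.\<close>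

lemma bump_closed:
  assumes g: "g \<in> carrier G" and v: "v \<in> carrier W"
  shows "bump g v \<in> carrier I"
proof -
  have vals: "bump g v \<in> carrier G \<rightarrow>\<^sub>E carrier W"
    using v by (auto simp: coset_bump_def intro!: rep_closed K.m_inv_closed)
  have "bump g v (x \<otimes> k) = \<theta> (inv k) (bump g v x)" if x: "x \<in> carrier G" and k: "k \<in> K" for x k
  proof -
    have kG: "k \<in> carrier G" using k by simp
    have eq: "inv g \<otimes> (x \<otimes> k) = (inv g \<otimes> x) \<otimes> k" using g x kG by (simp add: m_assoc)
    show ?thesis
    proof (cases "inv g \<otimes> x \<in> K")
      case True
      then have "inv g \<otimes> x \<otimes> k \<in> K" using k by simp
      moreover have "inv (inv g \<otimes> x \<otimes> k) = inv k \<otimes> inv (inv g \<otimes> x)"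
        using g x kG by (intro inv_mult_group) simp_all
      ultimately show ?thesis using True g x k kG v rep_mult[of "inv k" "inv (inv g \<otimes> x)" v]
        by (simp add: coset_bump_def eq)
    next
      case False
      have "inv g \<otimes> x \<otimes> k \<notin> K"
      proof
        assume "inv g \<otimes> x \<otimes> k \<in> K"
        then have "inv g \<otimes> x \<otimes> k \<otimes> inv k \<in> K" using k by (meson K.m_closed K.m_inv_closed)
        then show False using False g x kG by (simp add: m_assoc)
      qed
      then show ?thesis using False g x k kG by (simp add: coset_bump_def eq rep_zero)
    qed
  qed
  moreover have "{C \<in> lcosets K. (vnorm W (bump g v (coset_rep C)))\<^sup>2 \<noteq> 0} \<subseteq> {g <# K}"
    using bump_coset_rep_zero[OF g, of _ v] W.vnorm_eq_0_iff[of "\<zero>\<^bsub>W\<^esub>"] by force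
  then have "(\<lambda>C. (vnorm W (bump g v (coset_rep C)))\<^sup>2) summable_on lcosets K"
    by (intro finite_nonzero_values_imp_summable_on) (rule finite_subset, auto)
  ultimately show ?thesis using vals by (simp add: ind_space_def)
qed

lemma ind_rep_bump:
  assumes "g \<in> carrier G"
  shows "ind_rep G g (bump \<one> v) = bump g v"
proof -
  have "bump \<one> v (inv g \<otimes> x) = bump g v x" if "x \<in> carrier G" for x
    using assms that by (simp add: coset_bump_def)
  then show ?thesis by (auto simp: ind_rep_def coset_bump_def)
qed

text \<open>The bump at the identity lives on the coset \<open>K\<close>, so only that coset
  contributes, and the other bump vanishes there unless \<open>g\<close> is in
  \<open>K\<close>.\<close>

lemma bump_cip:
  assumes g: "g \<in> carrier G" and v: "v \<in> carrier W" "w \<in> carrier W"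
  shows "cip I (bump g v) (bump \<one> w) = (if g \<in> K then cip W (\<theta> g v) w else 0)"
proof -
  \<comment> \<open>\<open>c\<close> is an arbitrary element of \<open>K\<close>, possibly not the
    identity; both values carry the twist by \<open>\<theta> (inv c)\<close>, which cancels by
    unitarity.\<close>
  define c where "c = coset_rep K"
  have KK: "\<one> <# K = K" by (rule lcos_mult_one) (rule K.subset)
  have KC: "K \<in> lcosets K" using KK by (auto simp: LCOSETS_def)
  have c: "c \<in> K" unfolding c_def coset_rep_def by (rule someI[of _ \<one>]) simp
  have b1: "bump \<one> w (coset_rep C) = \<zero>\<^bsub>W\<^esub>" if "C \<in> lcosets K" "C \<noteq> K" for C
    using bump_coset_rep_zero[of \<one> C w] KK that by simp
  have vals: "bump g v x \<in> carrier W" if "x \<in> carrier G" for x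
    using that v by (auto simp: coset_bump_def intro!: rep_closed K.m_inv_closed)
  have "cip I (bump g v) (bump \<one> w) =
      (\<Sum>\<^sub>\<infinity>C\<in>lcosets K. cip W (bump g v (coset_rep C)) (bump \<one> w (coset_rep C)))"
    by (simp add: ind_space_def)
  also have "\<dots> = (\<Sum>\<^sub>\<infinity>C\<in>{K}. cip W (bump g v (coset_rep C)) (bump \<one> w (coset_rep C)))"
    using KC b1 vals coset_rep_closed(1) by (intro infsum_cong_neutral) auto
  also have "\<dots> = cip W (bump g v c) (bump \<one> w c)" by (simp add: c_def)
  also have "\<dots> = (if g \<in> K then cip W (\<theta> g v) w else 0)"
  proof -
    have w: "bump \<one> w c = \<theta> (inv c) w" using c by (simp add: coset_bump_def)
    show ?thesis
    proof (cases "g \<in> K")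
      case True
      then have "bump g v c = \<theta> (inv (inv g \<otimes> c)) v" using c by (simp add: coset_bump_def)
      also have "inv (inv g \<otimes> c) = inv c \<otimes> g" using c g by (simp add: inv_mult_group)
      also have "\<theta> (inv c \<otimes> g) v = \<theta> (inv c) (\<theta> g v)" using True c v by (intro rep_mult) auto
      finally show ?thesis unfolding w using True c v rep_cip[of "inv c" "\<theta> g v" w] by (simp add: rep_closed)
    next
      case False
      have "inv g \<otimes> c \<notin> K"
      proof
        assume "inv g \<otimes> c \<in> K"
        then have "c \<otimes> inv (inv g \<otimes> c) \<in> K" using c by (meson K.m_closed K.m_inv_closed)
        then show False using False c g by (simp add: inv_mult_group m_assoc[symmetric])
      qed
      then have "bump g v c = \<zero>\<^bsub>W\<^esub>" using c by (simp add: coset_bump_def)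
      then show ?thesis unfolding w using False c v by (simp add: rep_closed)
    qed
  qed
  finally show ?thesis .
qed

text \<open>Take the image of the bump at the identity under the intertwiner. Translates by elements
  outside \<open>K\<close> move that bump to a different coset, which gives the
  orthogonality.\<close>

lemma ind_contained_coefficients:
  assumes "rep_contained G I (ind_rep G) L \<rho>"
  obtains T where "\<forall>v\<in>carrier W. T v \<in> carrier L"
    "\<forall>g\<in>carrier G. \<forall>v\<in>carrier W. \<forall>w\<in>carrier W.
      cip L (\<rho> g (T v)) (T w) = (if g \<in> K then cip W (\<theta> g v) w else 0)"
    "\<forall>v\<in>carrier W. \<forall>w\<in>carrier W. cip L (T v) (T w) = cip W v w"
proof -
  obtain M U where M: "subrep G L \<rho> M" and U: "unitary_iso I (L\<lparr>carrier := M\<rparr>) U"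
    and eqv: "\<And>g v. g \<in> carrier G \<Longrightarrow> v \<in> carrier I \<Longrightarrow> U (ind_rep G g v) = \<rho> g (U v)"
    using assms unfolding rep_contained_def unitarily_equivalent_def by blast
  have M_sub: "M \<subseteq> carrier L"
    using M submodule.axioms(1)[THEN subgroup.subset] by (fastforce simp: subrep_def closed_subspace_def)
  have Uc: "U x \<in> M" if "x \<in> carrier I" for x using U that by (auto simp: unitary_iso_def bij_betw_def)
  have Ui: "cip L (U x) (U y) = cip I x y" if "x \<in> carrier I" "y \<in> carrier I" for x y
    using U that by (simp add: unitary_iso_def)
  show ?thesis
  proof (rule that[of "\<lambda>v. U (bump \<one> v)"]; intro ballI)
    show "U (bump \<one> v) \<in> carrier L" if "v \<in> carrier W" for v
      using Uc M_sub bump_closed[OF one_closed that] by blast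
    show "cip L (\<rho> g (U (bump \<one> v))) (U (bump \<one> w)) = (if g \<in> K then cip W (\<theta> g v) w else 0)"
      if "g \<in> carrier G" "v \<in> carrier W" "w \<in> carrier W" for g v w
      using that by (simp add: eqv[symmetric] bump_closed ind_rep_bump Ui bump_cip)
    show "cip L (U (bump \<one> v)) (U (bump \<one> w)) = cip W v w" if "v \<in> carrier W" "w \<in> carrier W" for v w
      using that by (simp add: bump_closed Ui bump_cip rep_one)
  qed
qed

end

section \<open>Leafwise elements and comb trees\<close>

lemma fleaves_replicate [simp]: "fleaves (replicate n t) = n * leaves t"
  by (induction n) auto

lemma fcomp_trivial: "fcomp (replicate (fleaves f) Leaf) f = f"
  by (induction f) (simp_all add: graft_trivial min_def)

lemma fcomp_of_trivial: "length p = n \<Longrightarrow> fcomp p (replicate n Leaf) = p"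
proof (induction n arbitrary: p)
  case (Suc n)
  then show ?case by (cases p) auto
qed simp

text \<open>Where both forests carry the same trees \<open>p\<close>, these can be trimmed: growing
  both trees of the trimmed pair by \<open>?h\<close> restores them. The same \<open>?h\<close> fits
  both sides because \<open>f\<close> and \<open>g\<close> have equally many leaves.\<close>

lemma F_class_graft_prefix:
  assumes "length p + length f = leaves t" "length g = length f" "fleaves g = fleaves f"
  shows "F_class (graft (p @ f) t, graft (p @ g) t) =
    F_class (graft (replicate (length p) Leaf @ f) t, graft (replicate (length p) Leaf @ g) t)"
proof -
  let ?h = "p @ replicate (fleaves f) Leaf" and ?L = "replicate (length p) Leaf"
  have c: "fcomp ?h (?L @ f) = p @ f" "fcomp ?h (?L @ g) = p @ g"
    using assms(3) fcomp_trivial[of g] by (simp_all add: fcomp_append fcomp_trivial fcomp_of_trivial)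
  have "graft ?h (graft (?L @ f) t) = graft (p @ f) t" "graft ?h (graft (?L @ g) t) = graft (p @ g) t"
    using assms c graft_graft[of "?L @ f" t ?h] graft_graft[of "?L @ g" t ?h] by simp_all
  moreover have "leaves (graft (?L @ f) t) = length ?h" "leaves (graft (?L @ g) t) = length ?h"
    using assms by (simp_all add: leaves_graft)
  ultimately show ?thesis using F_class_graft[of "graft (?L @ f) t" "graft (?L @ g) t" ?h] by simp
qed

lemma F_class_graft_suffix:
  assumes "length f + length p = leaves t" "length g = length f" "fleaves g = fleaves f"
  shows "F_class (graft (f @ p) t, graft (g @ p) t) =
    F_class (graft (f @ replicate (length p) Leaf) t, graft (g @ replicate (length p) Leaf) t)"
proof -
  let ?h = "replicate (fleaves f) Leaf @ p" and ?L = "replicate (length p) Leaf"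
  have c: "fcomp ?h (f @ ?L) = f @ p" "fcomp ?h (g @ ?L) = g @ p"
    using assms(3) fcomp_trivial[of g] by (simp_all add: fcomp_append fcomp_trivial fcomp_of_trivial)
  have "graft ?h (graft (f @ ?L) t) = graft (f @ p) t" "graft ?h (graft (g @ ?L) t) = graft (g @ p) t"
    using assms c graft_graft[of "f @ ?L" t ?h] graft_graft[of "g @ ?L" t ?h] by simp_all
  moreover have "leaves (graft (f @ ?L) t) = length ?h" "leaves (graft (g @ ?L) t) = length ?h"
    using assms by (simp_all add: leaves_graft)
  ultimately show ?thesis using F_class_graft[of "graft (f @ ?L) t" "graft (g @ ?L) t" ?h] by simp
qed

text \<open>The element is the product of the single-leaf elements, accumulated from left to right
  by induction on the number \<open>i\<close> of leaves already treated.\<close>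

lemma leafwise_mem_subgroup:
  assumes K: "subgroup K thompson_F" and uv: "leaves u = leaves v"
    and single: "\<And>i j. i + Suc j = leaves t \<Longrightarrow>
      F_class (graft (replicate i Leaf @ u # replicate j Leaf) t, graft (replicate i Leaf @ v # replicate j Leaf) t) \<in> K"
  shows "F_class (graft (replicate (leaves t) u) t, graft (replicate (leaves t) v) t) \<in> K"
proof -
  have "F_class (graft (replicate i u @ replicate j Leaf) t, graft (replicate i v @ replicate j Leaf) t) \<in> K"
    if "i + j = leaves t" for i j
    using that
  proof (induction i arbitrary: j)
    case 0
    then show ?case using subgroup.one_closed[OF K] by (simp add: F_one)
  next
    case (Suc i)
    let ?L = "replicate j Leaf" and ?ui = "replicate i u" and ?vi = "replicate i v"
    have fl: "i * leaves u = i * leaves v" using uv by simp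
    have "F_class (graft (?ui @ Leaf # ?L) t, graft (?vi @ Leaf # ?L) t) \<in> K"
      using Suc.IH[of "Suc j"] Suc.prems by simp
    \<comment> \<open>Growing the untouched next leaf to \<open>u\<close> on both sides keeps the
      class. Below, the single-leaf factor has its left leaves grown to \<open>v\<close>, so the two
      pairs share the middle tree \<open>graft (?vi @ u # ?L) t\<close> and can be
      multiplied.\<close>
    moreover have "F_class (graft (?ui @ u # ?L) t, graft (?vi @ u # ?L) t) =
        F_class (graft (?ui @ Leaf # ?L) t, graft (?vi @ Leaf # ?L) t)"
      using F_class_graft_suffix[of ?ui "[u] @ ?L" t ?vi] F_class_graft_suffix[of ?ui "[Leaf] @ ?L" t ?vi]
        Suc.prems fl by simp
    ultimately have 1: "F_class (graft (?ui @ u # ?L) t, graft (?vi @ u # ?L) t) \<in> K" by simp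
    have "F_class (graft (?vi @ u # ?L) t, graft (?vi @ v # ?L) t) =
        F_class (graft (replicate i Leaf @ u # ?L) t, graft (replicate i Leaf @ v # ?L) t)"
      using F_class_graft_prefix[of ?vi "u # ?L" t "v # ?L"] Suc.prems uv by simp
    then have 2: "F_class (graft (?vi @ u # ?L) t, graft (?vi @ v # ?L) t) \<in> K"
      using single[of i j] Suc.prems by simp
    have "F_class (graft (?ui @ u # ?L) t, graft (?vi @ v # ?L) t) \<in> K"
      using subgroup.m_closed[OF K 1 2] Suc.prems uv by (simp add: F_mult leaves_graft)
    then show ?case by (simp add: replicate_app_Cons_same)
  qed
  from this[of "leaves t" 0] show ?thesis by simp
qed

section \<open>Coefficients at the leaves of full trees and combs\<close>

fun full_tree :: "nat \<Rightarrow> btree" where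
  "full_tree 0 = Leaf"
| "full_tree (Suc n) = Node (full_tree n) (full_tree n)"

fun left_comb :: "nat \<Rightarrow> btree" where
  "left_comb 0 = Leaf"
| "left_comb (Suc n) = Node (left_comb n) Leaf"

fun right_comb :: "nat \<Rightarrow> btree" where
  "right_comb 0 = Leaf"
| "right_comb (Suc n) = Node Leaf (right_comb n)"

lemma leaves_left_comb [simp]: "leaves (left_comb n) = Suc n"
  by (induction n) auto

lemma leaves_right_comb [simp]: "leaves (right_comb n) = Suc n"
  by (induction n) auto

abbreviation "tree_coeffs a b \<equiv> Phi_tree ((*) (a :: complex)) ((*) b)"

lemma Phi_tree_scalar: "tree_coeffs a b t (x * y) = map ((*) x) (tree_coeffs a b t y)"
  by (induction t arbitrary: y) (simp_all add: mult.left_commute[of _ x])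

text \<open>Every leaf lies at depth \<open>n\<close>, and each edge on its path multiplies by
  \<open>a\<close> or \<open>b\<close>.\<close>

lemma full_tree_coeffs_bound:
  assumes "cmod a \<le> c" "cmod b \<le> c" "z \<in> set (tree_coeffs a b (full_tree n) x)"
  shows "cmod z \<le> c ^ n * cmod x"
  using assms(3)
proof (induction n arbitrary: x)
  case (Suc n)
  have c: "0 \<le> c" using assms(1) norm_ge_zero[of a] by linarith
  have "cmod z \<le> c ^ n * cmod (a * x) \<or> cmod z \<le> c ^ n * cmod (b * x)" using Suc by auto
  moreover have "c ^ n * cmod (a * x) \<le> c ^ n * (c * cmod x)" "c ^ n * cmod (b * x) \<le> c ^ n * (c * cmod x)"
    using assms(1,2) c by (auto simp: norm_mult intro!: mult_left_mono mult_right_mono)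
  ultimately show ?case by (simp add: mult_ac) linarith
qed simp

text \<open>Leaf \<open>j\<close> is reached by \<open>j\<close> steps to the right, each a factor
  \<open>b\<close>, and at most one step to the left.\<close>

lemma right_comb_coeffs_bound:
  assumes "cmod a \<le> 1" "cmod b \<le> c" "j \<le> n"
  shows "cmod (tree_coeffs a b (right_comb n) x ! j) \<le> c ^ j * cmod x"
  using assms(3)
proof (induction n arbitrary: j x)
  case (Suc n)
  have c: "0 \<le> c" using assms(2) norm_ge_zero[of b] by linarith
  show ?case
  proof (cases j)
    case 0
    then show ?thesis using assms(1) by (simp add: norm_mult mult_left_le_one_le)
  next
    case (Suc i)
    have "cmod (tree_coeffs a b (right_comb n) (b * x) ! i) \<le> c ^ i * cmod (b * x)"
      using Suc.IH Suc.prems Suc by simp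
    also have "\<dots> \<le> c ^ i * (c * cmod x)"
      using assms(2) c by (auto simp: norm_mult intro!: mult_left_mono mult_right_mono)
    also have "\<dots> = c ^ j * cmod x" using Suc by simp
    finally show ?thesis using Suc by simp
  qed
qed simp

text \<open>Here leaf \<open>j\<close> is reached by \<open>n - j\<close> steps to the left and at
  most one to the right. The exponent complements the one for the right comb.\<close>

lemma left_comb_coeffs_bound:
  assumes "cmod a \<le> c" "cmod b \<le> 1" "j \<le> n"
  shows "cmod (tree_coeffs a b (left_comb n) x ! j) \<le> c ^ (n - j) * cmod x"
  using assms(3)
proof (induction n arbitrary: j x)
  case (Suc n)
  have c: "0 \<le> c" using assms(1) norm_ge_zero[of a] by linarith
  show ?case
  proof (cases "j = Suc n")
    case True
    then show ?thesis using assms(2) by (simp add: nth_append norm_mult mult_left_le_one_le)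
  next
    case False
    then have j: "j \<le> n" using Suc.prems by simp
    have "cmod (tree_coeffs a b (left_comb n) (a * x) ! j) \<le> c ^ (n - j) * cmod (a * x)"
      using Suc.IH j by simp
    also have "\<dots> \<le> c ^ (n - j) * (c * cmod x)"
      using assms(1) c by (auto simp: norm_mult intro!: mult_left_mono mult_right_mono)
    also have "\<dots> = c ^ (Suc n - j) * cmod x" using j by (simp add: Suc_diff_le)
    finally show ?thesis using j by (simp add: nth_append)
  qed
qed simp

text \<open>For trees with equally many leaves this is the matrix coefficient of
  \<open>F_class (t, s)\<close> at the vector that decorates the one-leaf tree by 1.\<close>

definition tree_overlap :: "complex \<Rightarrow> complex \<Rightarrow> btree \<Rightarrow> btree \<Rightarrow> complex" where
  "tree_overlap a b s t = list_cip complex_line (tree_coeffs a b s 1) (tree_coeffs a b t 1)"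

lemma list_cip_complex_line:
  assumes "length \<xi> = length \<eta>"
  shows "list_cip complex_line \<xi> \<eta> = (\<Sum>i<length \<xi>. \<xi> ! i * cnj (\<eta> ! i))"
  using assms
  by (induction \<xi> \<eta> rule: list_induct2)
    (simp_all add: list_cip_def complex_line_def sum.lessThan_Suc_shift del: sum.lessThan_Suc)

lemma tree_overlap_Leaf [simp]: "tree_overlap a b Leaf Leaf = 1"
  by (simp add: tree_overlap_def list_cip_complex_line)

lemma list_cip_tree_coeffs:
  assumes "leaves s = leaves t"
  shows "list_cip complex_line (tree_coeffs a b s x) (tree_coeffs a b t y) = x * cnj y * tree_overlap a b s t"
  using assms Phi_tree_scalar[of a b s x 1] Phi_tree_scalar[of a b t y 1]
  by (simp add: tree_overlap_def list_cip_complex_line sum_distrib_left mult_ac)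

text \<open>Equal leaf counts tree by tree align the blocks, and scalars factor out of each block. A
  leafwise element therefore weights the contribution of each leaf by an overlap.\<close>

lemma list_cip_Phi:
  assumes "map leaves f = map leaves g" "length \<xi> = length f" "length \<eta> = length f"
  shows "list_cip complex_line (Phi ((*) a) ((*) b) f \<xi>) (Phi ((*) a) ((*) b) g \<eta>) =
    (\<Sum>i<length f. \<xi> ! i * cnj (\<eta> ! i) * tree_overlap a b (f ! i) (g ! i))"
  using assms
proof (induction f arbitrary: g \<xi> \<eta>)
  case Nil
  then show ?case by (simp add: list_cip_def)
next
  case (Cons s f)
  obtain t g' where g: "g = t # g'" "leaves s = leaves t" "map leaves f = map leaves g'" using Cons.prems(1) by auto
  obtain x \<xi>' where x: "\<xi> = x # \<xi>'" "length \<xi>' = length f" using Cons.prems(2) by (cases \<xi>) auto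
  obtain y \<eta>' where y: "\<eta> = y # \<eta>'" "length \<eta>' = length f" using Cons.prems(3) by (cases \<eta>) auto
  have "list_cip complex_line (p @ q) (p' @ q') = list_cip complex_line p p' + list_cip complex_line q q'"
    if "length p = length p'" for p q p' q' using that by (simp add: list_cip_def)
  then show ?case
    unfolding g(1) x(1) y(1) using Cons.IH[OF g(3) x(2) y(2)] g(2)
    by (simp add: list_cip_tree_coeffs sum.lessThan_Suc_shift del: sum.lessThan_Suc)
qed

text \<open>At leaf \<open>i\<close> the two bounds multiply to
  \<open>c ^ (n - i) * c ^ i = c ^ n\<close>, and there are \<open>n + 1\<close> leaves.\<close>

lemma comb_overlap_bound:
  assumes "cmod a \<le> c" "cmod b \<le> c" "c \<le> 1"
  shows "cmod (tree_overlap a b (left_comb n) (right_comb n)) \<le> real (Suc n) * c ^ n"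
proof -
  have c: "0 \<le> c" using assms(1) norm_ge_zero[of a] by linarith
  have "cmod (tree_overlap a b (left_comb n) (right_comb n)) \<le>
      (\<Sum>i<Suc n. cmod (tree_coeffs a b (left_comb n) 1 ! i * cnj (tree_coeffs a b (right_comb n) 1 ! i)))"
    unfolding tree_overlap_def by (subst list_cip_complex_line) (simp_all add: norm_sum del: sum.lessThan_Suc)
  also have "\<dots> \<le> (\<Sum>i<Suc n. c ^ n)"
  proof (rule sum_mono)
    fix i assume "i \<in> {..<Suc n}"
    then have i: "i \<le> n" by simp
    have "cmod (tree_coeffs a b (left_comb n) 1 ! i) * cmod (tree_coeffs a b (right_comb n) 1 ! i) \<le> c ^ (n - i) * c ^ i"
      using left_comb_coeffs_bound[of a c b i n 1] right_comb_coeffs_bound[of a b c i n 1] assms i c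
      by (intro mult_mono) auto
    also have "\<dots> = c ^ n" using i by (simp flip: power_add)
    finally show "cmod (tree_coeffs a b (left_comb n) 1 ! i * cnj (tree_coeffs a b (right_comb n) 1 ! i)) \<le> c ^ n"
      by (simp add: norm_mult)
  qed
  finally show ?thesis by simp
qed

lemma comb_overlap_tendsto_0:
  assumes "cmod a < 1" "cmod b < 1"
  shows "(\<lambda>n. tree_overlap a b (left_comb n) (right_comb n)) \<longlonglongrightarrow> 0"
proof -
  define c where "c = max (cmod a) (cmod b)"
  have c: "cmod a \<le> c" "cmod b \<le> c" "0 \<le> c" "c < 1" using assms by (auto simp: c_def le_max_iff_disj)
  have "(\<lambda>n. real n * c ^ n + c ^ n) \<longlonglongrightarrow> 0 + 0"
    using c powser_times_n_limit_0[of c] by (intro tendsto_add LIMSEQ_power_zero) simp_all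
  then have "(\<lambda>n. real (Suc n) * c ^ n) \<longlonglongrightarrow> 0" by (simp add: algebra_simps)
  then have "(\<lambda>n. cmod (tree_overlap a b (left_comb n) (right_comb n))) \<longlonglongrightarrow> 0"
    using comb_overlap_bound c by (elim null_dominated) auto
  then show ?thesis by (rule tendsto_norm_zero_cancel)
qed

section \<open>Scalar Pythagorean representations\<close>

lemma complex_line_simps [simp]:
  "carrier complex_line = UNIV" "cip complex_line x y = x * cnj y"
  by (simp_all add: complex_line_def)

section \<open>Common trees and matrix coefficients for an arbitrary Pythagorean pair\<close>

context pythagorean_pair
begin

text \<open>Trees are directed: when \<open>t\<close> is grown to accommodate one more vector, the
  earlier decorations are transported along the same forest.\<close>

lemma finite_common_tree:
  assumes "finite Z" "Z \<subseteq> carrier V"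
  shows "\<exists>t. \<forall>z\<in>Z. \<exists>\<xi>. (t, \<xi>) \<in> decorations H \<and> z = cls t \<xi>"
  using assms
proof (induction Z rule: finite_induct)
  case empty
  show ?case by simp
next
  case (insert x Z)
  have "Z \<subseteq> carrier V" using insert.prems by simp
  from insert.IH[OF this] obtain t where t: "\<forall>z\<in>Z. \<exists>\<xi>. (t, \<xi>) \<in> decorations H \<and> z = cls t \<xi>" ..
  have "x \<in> carrier V" using insert.prems by simp
  then obtain f \<xi> where f: "length f = leaves t" "(graft f t, \<xi>) \<in> decorations H" "x = cls (graft f t) \<xi>"
    by (rule pre_space_refine)
  have "\<exists>\<xi>. (graft f t, \<xi>) \<in> decorations H \<and> z = cls (graft f t) \<xi>" if "z \<in> Z" for z
  proof -
    from bspec[OF t that] obtain \<eta> where "(t, \<eta>) \<in> decorations H" "z = cls t \<eta>"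
      by (elim exE conjE) (rule that)
    then show ?thesis using f(1) by (intro exI[of _ "P f \<eta>"]) (simp add: decorations_graft cls_graft)
  qed
  moreover have "\<exists>\<xi>. (graft f t, \<xi>) \<in> decorations H \<and> x = cls (graft f t) \<xi>"
    using f(2,3) by (intro exI[of _ \<xi>] conjI)
  ultimately show ?case by (intro exI[of _ "graft f t"] ballI) (erule insertE, simp_all)
qed

text \<open>The element moves a decoration of \<open>graft f t\<close> unchanged to
  \<open>graft g t\<close>, so the first vector is refined along \<open>f\<close> and the second
  along \<open>g\<close>.\<close>

lemma pyth_pre_rep_graft_cip:
  assumes d: "(t, \<xi>) \<in> decorations H" "(t, \<eta>) \<in> decorations H"
    and f: "length f = leaves t" "length g = leaves t" "fleaves f = fleaves g"
  shows "cip V (pyth_pre_rep H A B (F_class (graft g t, graft f t)) (cls t \<xi>)) (cls t \<eta>) =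
    list_cip H (P f \<xi>) (P g \<eta>)"
proof -
  have l: "leaves (graft g t) = leaves (graft f t)" using f by (simp add: leaves_graft)
  have 1: "(graft f t, P f \<xi>) \<in> decorations H" "(graft g t, P g \<eta>) \<in> decorations H"
    using d f by (simp_all add: decorations_graft)
  then have 2: "(graft g t, P f \<xi>) \<in> decorations H" using l by (simp add: decorations_iff)
  have "pyth_pre_rep H A B (F_class (graft g t, graft f t)) (cls t \<xi>) = cls (graft g t) (P f \<xi>)"
    using pyth_pre_rep[OF l 1(1)] cls_graft[OF d(1) f(1)] by simp
  then show ?thesis using pre_cip[OF 2 1(2)] cls_graft[OF d(2) f(2)] by simp
qed

lemma pyth_rep_const:
  assumes g: "g \<in> carrier thompson_F" and z: "z \<in> carrier V"
  shows "pyth_rep H A B g (limit_class V (\<lambda>n. z)) = limit_class V (\<lambda>n. pyth_pre_rep H A B g z)"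
proof -
  interpret V: pre_hilbert V by (rule pre_hilbert_pyth_pre_space)
  have "vdist V (pyth_pre_rep H A B g X) (pyth_pre_rep H A B g Y) = vdist V X Y"
    if XY: "X \<in> carrier V" "Y \<in> carrier V" for X Y
  proof -
    have "(vdist V (pyth_pre_rep H A B g X) (pyth_pre_rep H A B g Y))\<^sup>2 = (vdist V X Y)\<^sup>2"
      using unitary_pyth_pre_rep[OF g] XY pyth_pre_rep_closed[OF g]
      by (simp add: V.vdist_sq unitary_iso_def)
    then show ?thesis using XY pyth_pre_rep_closed[OF g] by (simp add: power2_eq_iff_nonneg)
  qed
  then show ?thesis unfolding pyth_rep_def
    using V.completion_map(2)[of "pyth_pre_rep H A B g" "\<lambda>n. z"] pyth_pre_rep_closed[OF g] z by simp
qed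

end

lemma Phi_full_tree_bound:
  assumes "cmod a \<le> c" "cmod b \<le> c" "z \<in> set (Phi ((*) a) ((*) b) (replicate (length \<xi>) (full_tree m)) \<xi>)"
    and "\<And>x. x \<in> set \<xi> \<Longrightarrow> cmod x \<le> B"
  shows "cmod z \<le> c ^ m * B"
  using assms(3,4)
proof (induction \<xi>)
  case (Cons x \<xi>)
  have c: "0 \<le> c" using assms(1) norm_ge_zero[of a] by linarith
  consider "z \<in> set (tree_coeffs a b (full_tree m) x)"
    | "z \<in> set (Phi ((*) a) ((*) b) (replicate (length \<xi>) (full_tree m)) \<xi>)"
    using Cons.prems(1) by auto
  then show ?case
  proof cases
    case 1
    then have "cmod z \<le> c ^ m * cmod x" by (rule full_tree_coeffs_bound[OF assms(1,2)])
    also have "\<dots> \<le> c ^ m * B" using Cons.prems(2) c by (intro mult_left_mono) auto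
    finally show ?thesis .
  next
    case 2
    then show ?thesis using Cons by simp
  qed
qed simp

text \<open>The induced representation is visible only through \<open>disjoint\<close>. A single
  \<open>g\<close> has to serve all of \<open>E\<close>, since Parseval's identity will be summed
  over it.\<close>

lemma exists_nearly_orthogonal_translate:
  fixes a b :: complex
  defines "L \<equiv> pyth_space complex_line ((*) a) ((*) b)" and "\<sigma> \<equiv> pyth_rep complex_line ((*) a) ((*) b)"
  assumes ab: "(cmod a)\<^sup>2 + (cmod b)\<^sup>2 = 1" "a \<noteq> 0" "b \<noteq> 0"
    and K: "subgroup K thompson_F"
    and w: "w \<in> carrier L" "vnorm L w = 1"
    and disjoint: "\<And>g. g \<in> carrier thompson_F \<Longrightarrow> g \<notin> K \<Longrightarrow> cip L (\<sigma> g w) w = 0"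
    and E: "finite E" "E \<subseteq> carrier L" "\<And>e. e \<in> E \<Longrightarrow> vnorm L e = 1"
    and \<delta>: "0 < \<delta>"
  obtains g where "g \<in> K" "\<forall>e\<in>E. cmod (cip L (\<sigma> g w) e) < \<delta>"
proof -
  interpret pythagorean_pair complex_line "(*) a" "(*) b" by (rule pythagorean_pair_scalar[OF ab(1)])
  interpret V: pre_hilbert V by (rule pre_hilbert_pyth_pre_space)
  have LV: "L = completion V" by (simp add: L_def pyth_space_def)
  interpret L: pre_hilbert L unfolding LV by (rule V.pre_hilbert_completion)
  have unit: "unitary_iso L L (\<sigma> g)" if "g \<in> carrier thompson_F" for g
    using unitary_rep_pyth_rep that by (simp add: unitary_rep_def L_def \<sigma>_def)
  let ?\<iota> = "\<lambda>z. limit_class V (\<lambda>n. z)"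
  have \<iota>c: "?\<iota> z \<in> carrier L" if "z \<in> carrier V" for z using that by (simp add: LV)
  \<comment> \<open>Error budget: \<open>K1\<close> is refuted by
    \<open>1 - 2 * d \<le> 3 * d + 2 * d\<close>, which fails for \<open>d \<le> 1 / 9\<close>; the
    final estimate is \<open>4 * d + 3 * d\<close>, below \<open>\<delta>\<close>.\<close>
  define d where "d = min (\<delta> / 9) (1 / 9)"
  have d: "0 < d" "d \<le> 1 / 9" "9 * d \<le> \<delta>" using \<delta> by (auto simp: d_def min_def)
  have "\<exists>z\<in>carrier V. vdist L x (?\<iota> z) < d" if "x \<in> carrier L" for x
    using V.completion_approx[of x d] that d(1) unfolding LV by blast
  then obtain q where q: "\<And>x. x \<in> carrier L \<Longrightarrow> q x \<in> carrier V"
    "\<And>x. x \<in> carrier L \<Longrightarrow> vdist L x (?\<iota> (q x)) < d" by metis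
  have qn: "vnorm L (?\<iota> (q x)) \<le> 1 + d" "1 - d \<le> vnorm L (?\<iota> (q x))" if "x \<in> carrier L" "vnorm L x = 1" for x
    using L.vnorm_diff_le[of x "?\<iota> (q x)"] q[OF that(1)] \<iota>c that by auto
  \<comment> \<open>Replacing \<open>x\<close> costs \<open>d\<close>; replacing \<open>y\<close>
    costs at most \<open>2 * d\<close>, because the approximant of \<open>x\<close> has norm at most
    \<open>1 + d \<le> 2\<close>.\<close>
  have approx: "cmod (cip L (\<sigma> g x) y - cip V (pyth_pre_rep complex_line ((*) a) ((*) b) g (q x)) (q y)) \<le> 3 * d"
    if g: "g \<in> carrier thompson_F" and x: "x \<in> carrier L" "vnorm L x = 1" and y: "y \<in> carrier L" "vnorm L y = 1" for g x y
  proof -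
    have "cip V (pyth_pre_rep complex_line ((*) a) ((*) b) g (q x)) (q y) = cip L (\<sigma> g (?\<iota> (q x))) (?\<iota> (q y))"
      unfolding \<sigma>_def using g q(1) x y
      by (simp add: pyth_rep_const LV V.completion_cip_const pyth_pre_rep_closed)
    moreover have "cmod (cip L (\<sigma> g x) y - cip L (\<sigma> g (?\<iota> (q x))) (?\<iota> (q y)))
        \<le> vdist L x (?\<iota> (q x)) * vnorm L y + vnorm L (?\<iota> (q x)) * vdist L y (?\<iota> (q y))"
      using x y q(1) \<iota>c by (intro cip_rep_approx unit g L.pre_hilbert_axioms) auto
    moreover have "vnorm L (?\<iota> (q x)) * vdist L y (?\<iota> (q y)) \<le> 2 * d"
      using qn(1)[OF x] q(2)[OF y(1)] d y q(1) \<iota>c by (intro mult_mono) auto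
    ultimately show ?thesis using q(2)[OF x(1)] y(2) by auto
  qed
  have "q ` insert w E \<subseteq> carrier V" using q(1) w(1) E(2) by blast
  then have "\<exists>t. \<forall>z\<in>q ` insert w E. \<exists>\<xi>. (t, \<xi>) \<in> decorations complex_line \<and> z = cls t \<xi>"
    using E(1) by (intro finite_common_tree finite_imageI) simp_all
  then obtain t0 where t0: "\<forall>z\<in>q ` insert w E. \<exists>\<xi>. (t0, \<xi>) \<in> decorations complex_line \<and> z = cls t0 \<xi>" ..
  have "q w \<in> q ` insert w E" by simp
  from bspec[OF t0 this] obtain \<xi>0 where \<xi>0: "(t0, \<xi>0) \<in> decorations complex_line" "q w = cls t0 \<xi>0"
    by (elim exE conjE) (rule that)
  define c where "c = max (cmod a) (cmod b)"
  \<comment> \<open>This is where \<open>a\<close> and \<open>b\<close> being nonzero enters: each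
    squared modulus is 1 minus a positive number.\<close>
  have "cmod a < 1" "cmod b < 1"
  proof -
    have "0 < (cmod a)\<^sup>2" "0 < (cmod b)\<^sup>2" using ab by simp_all
    then have "(cmod a)\<^sup>2 < 1\<^sup>2" "(cmod b)\<^sup>2 < 1\<^sup>2" using ab(1) unfolding one_power2 by linarith+
    then show "cmod a < 1" "cmod b < 1" using power_less_imp_less_base zero_le_one by blast+
  qed
  then have c: "cmod a \<le> c" "cmod b \<le> c" "0 \<le> c" "c < 1" by (auto simp: c_def le_max_iff_disj)
  \<comment> \<open>\<open>B\<close> bounds all decorations of \<open>q w\<close> on
    \<open>t0\<close>; \<open>m\<close> further full levels bring them down to at most
    \<open>c ^ m * B\<close>, below \<open>d\<close>.\<close>
  define B where "B = sum_list (map cmod \<xi>0)"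
  have B: "cmod x \<le> B" if "x \<in> set \<xi>0" for x
    unfolding B_def using that by (intro member_le_sum_list) auto
  have "(\<lambda>m. c ^ m * B) \<longlonglongrightarrow> 0 * B" using c by (intro tendsto_mult_right LIMSEQ_power_zero) simp
  then have "\<exists>m. c ^ m * B < d" using d(1) by (metis (lifting) mult_zero_left order_tendstoD(2) eventually_sequentially order_refl)
  then obtain m where m: "c ^ m * B < d" ..
  \<comment> \<open>The overlap depends on the combs alone, so one \<open>n\<close> works below
    every leaf of any tree.\<close>
  have "\<exists>n. cmod (tree_overlap a b (left_comb n) (right_comb n)) < d"
    using comb_overlap_tendsto_0[OF \<open>cmod a < 1\<close> \<open>cmod b < 1\<close>] d(1)
    by (metis LIMSEQ_iff diff_zero order_refl)
  then obtain n where n: "cmod (tree_overlap a b (left_comb n) (right_comb n)) < d" ..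
  define \<kappa> where "\<kappa> = tree_overlap a b (left_comb n) (right_comb n)"
  define f0 where "f0 = replicate (leaves t0) (full_tree m)"
  define t where "t = graft f0 t0"
  have t_rep: "\<exists>\<xi>. (t, \<xi>) \<in> decorations complex_line \<and> q z = cls t \<xi>" if "z \<in> insert w E" for z
  proof -
    have "q z \<in> q ` insert w E" using that by (rule imageI)
    from bspec[OF t0 this] obtain \<eta> where \<eta>: "(t0, \<eta>) \<in> decorations complex_line" "q z = cls t0 \<eta>"
      by (elim exE conjE) (rule that)
    have "length f0 = leaves t0" by (simp add: f0_def)
    then show ?thesis unfolding t_def \<eta>(2)
      by (intro exI[of _ "P f0 \<eta>"] conjI decorations_graft[OF \<eta>(1)] cls_graft[OF \<eta>(1), symmetric])
  qed
  define \<xi> where "\<xi> = Phi ((*) a) ((*) b) f0 \<xi>0"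
  have \<xi>: "(t, \<xi>) \<in> decorations complex_line" "q w = cls t \<xi>"
    unfolding t_def \<xi>_def using \<xi>0 by (simp_all add: f0_def decorations_graft cls_graft)
  have len: "length \<xi> = leaves t" using \<xi>(1) by (simp add: decorations_iff)
  have small: "cmod (\<xi> ! i) < d" if "i < leaves t" for i
  proof -
    have "\<xi> ! i \<in> set \<xi>" using len that by simp
    then have "cmod (\<xi> ! i) \<le> c ^ m * B"
      using Phi_full_tree_bound[OF c(1,2), of "\<xi> ! i" \<xi>0 m B] B \<xi>0(1)
      by (simp add: \<xi>_def f0_def decorations_iff)
    then show ?thesis using m by simp
  qed
  have qcip: "cip V (cls t \<zeta>) (cls t \<eta>) = (\<Sum>i<leaves t. \<zeta> ! i * cnj (\<eta> ! i))"
    if "(t, \<zeta>) \<in> decorations complex_line" "(t, \<eta>) \<in> decorations complex_line" for \<zeta> \<eta>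
    using that by (simp add: pre_cip list_cip_complex_line decorations_iff)
  have qw: "1 - 2 * d \<le> cmod (cip V (q w) (q w))"
  proof -
    have "cip V (q w) (q w) = complex_of_real ((vnorm L (?\<iota> (q w)))\<^sup>2)"
      using L.cip_self[OF \<iota>c[OF q(1)[OF w(1)]]] q(1)[OF w(1)] by (simp add: LV V.completion_cip_const)
    then have "cmod (cip V (q w) (q w)) = (vnorm L (?\<iota> (q w)))\<^sup>2" by (simp add: norm_power)
    moreover have "(1 - d)\<^sup>2 \<le> (vnorm L (?\<iota> (q w)))\<^sup>2" using qn(2)[OF w] d by (intro power_mono) auto
    moreover have "1 - 2 * d \<le> (1 - d)\<^sup>2" by (simp add: power2_diff)
    ultimately show ?thesis by linarith
  qed
  \<comment> \<open>Outside \<open>K\<close> the coefficient at \<open>w\<close> would be zero, but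
    changing a single leaf only alters the squared norm of \<open>q w\<close> by the small term at
    that leaf.\<close>
  have K1: "F_class (graft (replicate i Leaf @ right_comb n # replicate j Leaf) t,
      graft (replicate i Leaf @ left_comb n # replicate j Leaf) t) \<in> K" (is "?h \<in> K")
    if ij: "i + Suc j = leaves t" for i j
  proof (rule ccontr)
    let ?f = "replicate i Leaf @ left_comb n # replicate j Leaf"
    let ?g = "replicate i Leaf @ right_comb n # replicate j Leaf"
    assume "?h \<notin> K"
    moreover have h: "?h \<in> carrier thompson_F" using ij by (intro F_class_carrier) (simp add: leaves_graft)
    ultimately have "cip L (\<sigma> ?h w) w = 0" using disjoint by blast
    then have le: "cmod (cip V (pyth_pre_rep complex_line ((*) a) ((*) b) ?h (q w)) (q w)) \<le> 3 * d"
      using approx[OF h w w] by simp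
    \<comment> \<open>Away from leaf \<open>i\<close> both trees are trivial, with overlap
      1.\<close>
    have ov: "tree_overlap a b (?f ! k) (?g ! k) = (if k = i then \<kappa> else 1)" if "k < leaves t" for k
      using that ij by (auto simp: nth_append nth_Cons' \<kappa>_def)
    have "cip V (pyth_pre_rep complex_line ((*) a) ((*) b) ?h (q w)) (q w) =
        (\<Sum>k<leaves t. \<xi> ! k * cnj (\<xi> ! k) * tree_overlap a b (?f ! k) (?g ! k))"
      unfolding \<xi>(2) using ij len \<xi>(1) by (subst pyth_pre_rep_graft_cip) (simp_all add: list_cip_Phi)
    also have "\<dots> = (\<Sum>k<leaves t. \<xi> ! k * cnj (\<xi> ! k) - (if k = i then \<xi> ! i * cnj (\<xi> ! i) * (1 - \<kappa>) else 0))"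
      using ov by (intro sum.cong) (auto simp: algebra_simps)
    also have "\<dots> = cip V (q w) (q w) - \<xi> ! i * cnj (\<xi> ! i) * (1 - \<kappa>)"
      unfolding \<xi>(2) using ij qcip[OF \<xi>(1) \<xi>(1)] by (simp add: sum_subtractf)
    finally have "cmod (cip V (q w) (q w)) \<le> 3 * d + cmod (\<xi> ! i * cnj (\<xi> ! i) * (1 - \<kappa>))"
      using le norm_triangle_ineq2[of "cip V (q w) (q w)" "\<xi> ! i * cnj (\<xi> ! i) * (1 - \<kappa>)"] by simp
    \<comment> \<open>One factor \<open>d\<close> is enough; the other copy of the leaf value is
      bounded by 1.\<close>
    moreover have "cmod (\<xi> ! i * cnj (\<xi> ! i) * (1 - \<kappa>)) \<le> (d * 1) * 2"
      unfolding norm_mult complex_mod_cnj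
    proof (intro mult_mono)
      show "cmod (\<xi> ! i) \<le> d" "cmod (\<xi> ! i) \<le> 1" using small[of i] ij d by simp_all
      show "cmod (1 - \<kappa>) \<le> 2" using n d norm_triangle_ineq4[of 1 \<kappa>] by (simp add: \<kappa>_def)
    qed (use d in simp_all)
    ultimately show False using qw d by simp
  qed
  \<comment> \<open>With combs below every leaf, each term of the inner product is multiplied by the
    same \<open>\<kappa>\<close>, which factors out of the sum.\<close>
  define g where "g = F_class (graft (replicate (leaves t) (right_comb n)) t, graft (replicate (leaves t) (left_comb n)) t)"
  have gK: "g \<in> K" unfolding g_def by (rule leafwise_mem_subgroup[OF K _ K1]) simp_all
  have gF: "g \<in> carrier thompson_F" using gK subgroup.subset[OF K] by blast
  show ?thesis
  proof (rule that[OF gK], rule ballI)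
    fix e assume e: "e \<in> E"
    then have eL: "e \<in> carrier L" "vnorm L e = 1" using E by auto
    have "e \<in> insert w E" using e by simp
    from t_rep[OF this] obtain \<eta> where \<eta>: "(t, \<eta>) \<in> decorations complex_line" "q e = cls t \<eta>"
      by (elim exE conjE) (rule that)
    have len': "length \<eta> = leaves t" using \<eta>(1) by (simp add: decorations_iff)
    have "cip V (pyth_pre_rep complex_line ((*) a) ((*) b) g (q w)) (q e) =
        (\<Sum>k<leaves t. \<xi> ! k * cnj (\<eta> ! k) * \<kappa>)"
      unfolding \<xi>(2) \<eta>(2) g_def using len len' \<xi>(1) \<eta>(1)
      by (subst pyth_pre_rep_graft_cip) (simp_all add: list_cip_Phi \<kappa>_def)
    also have "\<dots> = cip V (q w) (q e) * \<kappa>"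
      unfolding \<xi>(2) \<eta>(2) qcip[OF \<xi>(1) \<eta>(1)] by (simp add: sum_distrib_right)
    finally have "cmod (cip V (pyth_pre_rep complex_line ((*) a) ((*) b) g (q w)) (q e)) = cmod (cip V (q w) (q e)) * cmod \<kappa>"
      by (simp add: norm_mult)
    also have "\<dots> \<le> 4 * d"
    proof (intro mult_mono)
      have "cmod (cip V (q w) (q e)) \<le> vnorm L (?\<iota> (q w)) * vnorm L (?\<iota> (q e))"
        using L.cauchy_schwarz[OF \<iota>c \<iota>c, OF q(1) q(1), OF w(1) eL(1)] q(1)[OF w(1)] q(1)[OF eL(1)]
        by (simp add: LV V.completion_cip_const)
      also have "\<dots> \<le> 2 * 2"
        using qn(1)[OF w] qn(1)[OF eL] d \<iota>c q(1) w(1) eL(1) by (intro mult_mono) auto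
      finally show "cmod (cip V (q w) (q e)) \<le> 4" by simp
      show "cmod \<kappa> \<le> d" using n by (simp add: \<kappa>_def)
    qed (use d in simp_all)
    finally have "cmod (cip L (\<sigma> g w) e) \<le> 4 * d + 3 * d"
      using approx[OF gF w eL] norm_triangle_ineq2[of "cip L (\<sigma> g w) e"
          "cip V (pyth_pre_rep complex_line ((*) a) ((*) b) g (q w)) (q e)"] by linarith
    then show "cmod (cip L (\<sigma> g w) e) < \<delta>" using d by linarith
  qed
qed

theorem corollaryD:
  fixes a b :: complex
    and K :: "(btree \<times> btree) set set"
    and W :: "'w cspace"
    and \<theta> :: "(btree \<times> btree) set \<Rightarrow> 'w \<Rightarrow> 'w"
  assumes "(cmod a)\<^sup>2 + (cmod b)\<^sup>2 = 1" and "a \<noteq> 0" and "b \<noteq> 0"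
    and "subgroup K thompson_F" and "K \<noteq> {\<one>\<^bsub>thompson_F\<^esub>}"
    and "hilbert W" and "fin_dim W" and "carrier W \<noteq> {\<zero>\<^bsub>W\<^esub>}"
    and "unitary_rep (thompson_F\<lparr>carrier := K\<rparr>) W \<theta>"
  shows "\<not> rep_contained thompson_F (ind_space thompson_F K W \<theta>) (ind_rep thompson_F)
      (pyth_space complex_line ((*) a) ((*) b)) (pyth_rep complex_line ((*) a) ((*) b))"
proof
  let ?L = "pyth_space complex_line ((*) a) ((*) b)" and ?\<sigma> = "pyth_rep complex_line ((*) a) ((*) b)"
  assume contained: "rep_contained thompson_F (ind_space thompson_F K W \<theta>) (ind_rep thompson_F) ?L ?\<sigma>"
  interpret induction_data thompson_F K W \<theta>
    using assms group_thompson_F by (auto simp: induction_data_def induction_data_axioms_def hilbert_def)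
  from contained obtain T where T: "\<forall>v\<in>carrier W. T v \<in> carrier ?L"
    "\<forall>g\<in>carrier thompson_F. \<forall>v\<in>carrier W. \<forall>w\<in>carrier W.
      cip ?L (?\<sigma> g (T v)) (T w) = (if g \<in> K then cip W (\<theta> g v) w else 0)"
    "\<forall>v\<in>carrier W. \<forall>w\<in>carrier W. cip ?L (T v) (T w) = cip W v w"
    by (rule ind_contained_coefficients)
  note Tc = T(1)[rule_format] and Tcoef = T(2)[rule_format] and Tcip = T(3)[rule_format]
  have Tn: "vnorm ?L (T v) = vnorm W v" if "v \<in> carrier W" for v
    using Tcip[OF that that] by (simp add: vnorm_def)
  obtain E where E: "finite E" "E \<subseteq> carrier W" "\<forall>e\<in>E. vnorm W e = 1"
    and parseval': "\<forall>x\<in>carrier W. (vnorm W x)\<^sup>2 = (\<Sum>e\<in>E. (cmod (cip W x e))\<^sup>2)"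
    using assms(7) by (rule W.fin_dim_orthonormal_basis)
  note parseval = parseval'[rule_format]
  obtain x where x: "x \<in> carrier W" "x \<noteq> \<zero>\<^bsub>W\<^esub>" using assms(8) W.zero_closed by blast
  \<comment> \<open>Over an empty \<open>E\<close>, Parseval's identity would force the nonzero
    \<open>x\<close> to have norm 0.\<close>
  have "E \<noteq> {}" using parseval[OF x(1)] x W.vnorm_eq_0_iff by auto
  then obtain v where v: "v \<in> E" by blast
  then have vW: "v \<in> carrier W" "vnorm W v = 1" using E by auto
  \<comment> \<open>Coefficients below \<open>1 / N \<le> 1\<close> have squares below
    \<open>1 / N\<close>, so the \<open>N\<close> squares sum to less than 1, contradicting that
    \<open>\<theta> g v\<close> is a unit vector.\<close>
  define N where "N = real (card E)"
  have N: "1 \<le> N" using \<open>E \<noteq> {}\<close> E(1) by (simp add: N_def card_gt_0_iff Suc_leI)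
  obtain g where g: "g \<in> K" "\<forall>e\<in>T ` E. cmod (cip ?L (?\<sigma> g (T v)) e) < 1 / N"
  proof (rule exists_nearly_orthogonal_translate[OF assms(1-4), of "T v" "T ` E" "1 / N"])
    show "cip ?L (?\<sigma> g (T v)) (T v) = 0" if "g \<in> carrier thompson_F" "g \<notin> K" for g
      using Tcoef[OF that(1) vW(1) vW(1)] that(2) by simp
  qed (use E Tc Tn vW N in auto)
  have gv: "\<theta> g v \<in> carrier W" using g(1) vW(1) by (rule rep_closed)
  have lt: "cmod (cip W (\<theta> g v) e) < 1 / N" if "e \<in> E" for e
    using bspec[OF g(2), of "T e"] Tcoef[of g v e] g(1) that vW(1) E(2) by auto
  have small: "(cmod (cip W (\<theta> g v) e))\<^sup>2 < 1 / N" if "e \<in> E" for e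
  proof -
    have "1 / N \<le> 1" using N by simp
    then have "cmod (cip W (\<theta> g v) e) * cmod (cip W (\<theta> g v) e) \<le> cmod (cip W (\<theta> g v) e) * 1"
      using lt[OF that] by (intro mult_left_mono) auto
    then show ?thesis using lt[OF that] by (simp add: power2_eq_square)
  qed
  have "(vnorm W (\<theta> g v))\<^sup>2 < (\<Sum>e\<in>E. 1 / N)"
    unfolding parseval[OF gv] using small E(1) \<open>E \<noteq> {}\<close> by (intro sum_strict_mono)
  also have "\<dots> = 1" using N by (simp add: N_def)
  finally have "vnorm W (\<theta> g v) < 1" using W.vnorm_nonneg[OF gv] by (simp add: power2_less_1_iff)
  then show False using rep_cip[OF g(1) vW(1) vW(1)] vW(2) by (simp add: vnorm_def)
qed

end
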